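(* Let $X=\{X(t)\}_{t\ge0}$ be the generalized fractional Brownian motion with parameters $(\alpha,\gamma)$, and let $H=\alpha-\tfrac{\gamma}{2}+\tfrac12$. The following hold. (i) If $-\tfrac12+\tfrac{\gamma}{2}<\alpha\le\tfrac12$ and $\gamma\in(0,1)$ (resulting in $H\in(0,1)$), then $X$ is not mean square differentiable and does not have differentiable sample paths; in particular, for every $s\in\mathbb{R}_+$, $$\limsup_{t\to s}\left|\frac{X(t)-X(s)}{t-s}\right|=+\infty$$ with probability one. (ii) If $\tfrac12<\alpha<\tfrac12+\tfrac{\gamma}{2}$ and $\gamma\in(0,1)$ (resulting in $H\in(\tfrac12,1)$), then, with probability one, the sample path of $X$ is continuously differentiable once, with derivative $$\frac{\mathrm{d}X(t)}{\mathrm{d}t}=c\int_{-\infty}^{t}\alpha\,(t-s)^{\alpha-1}|s|^{-\gamma/2}\,\mathrm{d}B(s),\qquad t\ge0,$$ but not twice.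
   Context: Let $B(\mathrm{d}u)$ be a Gaussian random measure on $\mathbb{R}$ with Lebesgue control measure $\mathrm{d}u$ (equivalently, the white noise of a two-sided standard Brownian motion $B$). For $\gamma\in[0,1)$ and $\alpha\in(-\frac12+\frac{\gamma}{2},\frac12+\frac{\gamma}{2})$, the generalized fractional Brownian motion (GFBM) is the mean-zero Gaussian process with continuous sample paths given by $$X(t)= c\int_{\mathbb{R}}\big((t-u)_+^{\alpha}-(-u)_+^{\alpha}\big)\,|u|^{-\gamma/2}\,B(\mathrm{d}u),\qquad t\ge 0,$$ where $x_+^{\alpha}=x^{\alpha}$ if $x>0$ and $x_+^{\alpha}=0$ otherwise, and $c=c(\alpha,\gamma)>0$ is the normalization constant for which $\mathrm{Var}(X(t))=t^{2H}$ for all $t\ge0$, that is, $c^{-2}=\int_0^1(1-v)^{2\alpha}v^{-\gamma}\,\mathrm{d}v+\int_0^\infty[(1+v)^{\alpha}-v^{\alpha}]^2v^{-\gamma}\,\mathrm{d}v$. The derivative formula in (ii) refers to this realization of $X$, with the same $B$ in the definition of $X$ and in the formula. $\mathbb{R}_+=[0,\infty)$.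
   Formalization: In (ii), continuous differentiability and the derivative formula are stated for t > 0 instead of t ≥ 0: at t = 0 the integrand is not square integrable, since 2α−2−γ < −1, and X has almost surely no derivative there because H < 1. *)

theory Defs
  imports "HOL-Probability.Probability"
begin

text \<open>Gaussian random measure on the real line with Lebesgue control measure: a set function,
  defined on the Borel sets of finite Lebesgue measure, that is independently scattered, almost
  surely countably additive, and has \<open>B A\<close> normally distributed with mean 0 and variance the
  Lebesgue measure of \<open>A\<close>. Null sets are treated separately because the library's
  \<^const>\<open>normal_density\<close> describes a normal law only for positive standard deviation.\<close>

locale gaussian_white_noise = prob_space M
  for M :: "'a measure" and B :: "real set \<Rightarrow> 'a \<Rightarrow> real" +
  assumes noise_measurable:
      "A \<in> fmeasurable lborel \<Longrightarrow> B A \<in> borel_measurable M"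
    and noise_normal:
      "A \<in> fmeasurable lborel \<Longrightarrow> measure lborel A > 0 \<Longrightarrow>
        distributed M lborel (B A) (normal_density 0 (sqrt (measure lborel A)))"
    and noise_null:
      "A \<in> fmeasurable lborel \<Longrightarrow> measure lborel A = 0 \<Longrightarrow> AE \<omega> in M. B A \<omega> = 0"
    and noise_independent:
      "range F \<subseteq> fmeasurable lborel \<Longrightarrow> disjoint_family F \<Longrightarrow>
        indep_vars (\<lambda>_. borel) (\<lambda>i::nat. B (F i)) UNIV"
    and noise_countably_additive:
      "range F \<subseteq> fmeasurable lborel \<Longrightarrow> disjoint_family F \<Longrightarrow>
        (\<Union>i. F i) \<in> fmeasurable lborel \<Longrightarrow>
        AE \<omega> in M. (\<lambda>i::nat. B (F i) \<omega>) sums B (\<Union>i. F i) \<omega>"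

text \<open>The value \<open>y = 0\<close> contributes nothing to the sum, even though \<open>B\<close> is unconstrained on the
  set where \<open>s\<close> vanishes when that set has infinite measure.\<close>

definition simple_wiener_integral ::
    "(real set \<Rightarrow> 'a \<Rightarrow> real) \<Rightarrow> (real \<Rightarrow> real) \<Rightarrow> 'a \<Rightarrow> real" where
  "simple_wiener_integral B s \<omega> = (\<Sum>y\<in>range s. y * B {u. s u = y} \<omega>)"

text \<open>\<open>Y\<close> is a version of the Wiener integral of the deterministic function \<open>f\<close>: the mean square
  limit of the integrals of simple functions tending to \<open>f\<close> in \<open>L\<^sup>2(\<real>)\<close>. This determines \<open>Y\<close> up to
  almost sure equality and forces \<open>f\<close> to be square integrable.\<close>

definition has_wiener_integral ::
    "'a measure \<Rightarrow> (real set \<Rightarrow> 'a \<Rightarrow> real) \<Rightarrow> (real \<Rightarrow> real) \<Rightarrow> ('a \<Rightarrow> real) \<Rightarrow> bool" where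
  "has_wiener_integral M B f Y \<longleftrightarrow>
     f \<in> borel_measurable lborel \<and> Y \<in> borel_measurable M \<and>
     (\<exists>s. (\<forall>n::nat. Bochner_Integration.simple_bochner_integrable lborel (s n)) \<and>
          (\<lambda>n. \<integral>\<^sup>+u. ennreal ((s n u - f u)\<^sup>2) \<partial>lborel) \<longlonglongrightarrow> 0 \<and>
          (\<lambda>n. \<integral>\<^sup>+\<omega>. ennreal ((simple_wiener_integral B (s n) \<omega> - Y \<omega>)\<^sup>2) \<partial>M) \<longlonglongrightarrow> 0)"

definition pos_powr :: "real \<Rightarrow> real \<Rightarrow> real" where
  "pos_powr x a = (if x > 0 then x powr a else 0)"

definition gfbm_kernel :: "real \<Rightarrow> real \<Rightarrow> real \<Rightarrow> real \<Rightarrow> real" where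
  "gfbm_kernel \<alpha> \<gamma> t u = (pos_powr (t - u) \<alpha> - pos_powr (- u) \<alpha>) * \<bar>u\<bar> powr (- \<gamma> / 2)"

definition gfbm_const :: "real \<Rightarrow> real \<Rightarrow> real" where
  "gfbm_const \<alpha> \<gamma> = 1 / sqrt
     ((LBINT v:{0<..<1}. (1 - v) powr (2 * \<alpha>) * v powr (- \<gamma>)) +
      (LBINT v:{0<..}. ((1 + v) powr \<alpha> - v powr \<alpha>)\<^sup>2 * v powr (- \<gamma>)))"

text \<open>\<open>X\<close> is indexed by all reals, but only its values at times \<open>t \<ge> 0\<close> are constrained.\<close>

locale gfbm = gaussian_white_noise M B
  for M :: "'a measure" and B :: "real set \<Rightarrow> 'a \<Rightarrow> real"
    and \<alpha> \<gamma> :: real and X :: "real \<Rightarrow> 'a \<Rightarrow> real" +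
  assumes gamma_range: "0 \<le> \<gamma>" "\<gamma> < 1"
    and alpha_range: "- 1 / 2 + \<gamma> / 2 < \<alpha>" "\<alpha> < 1 / 2 + \<gamma> / 2"
    and process_measurable: "t \<ge> 0 \<Longrightarrow> X t \<in> borel_measurable M"
    and process_integral:
      "t \<ge> 0 \<Longrightarrow> \<exists>Y. has_wiener_integral M B (gfbm_kernel \<alpha> \<gamma> t) Y \<and>
        (AE \<omega> in M. X t \<omega> = gfbm_const \<alpha> \<gamma> * Y \<omega>)"
    and continuous_paths: "AE \<omega> in M. continuous_on {0..} (\<lambda>t. X t \<omega>)"

definition mean_square_differentiable_at ::
    "'a measure \<Rightarrow> real set \<Rightarrow> (real \<Rightarrow> 'a \<Rightarrow> real) \<Rightarrow> real \<Rightarrow> bool" where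
  "mean_square_differentiable_at M T X s \<longleftrightarrow>
     (\<exists>Y \<in> borel_measurable M. integrable M (\<lambda>\<omega>. (Y \<omega>)\<^sup>2) \<and>
        ((\<lambda>t. \<integral>\<^sup>+\<omega>. ennreal (((X t \<omega> - X s \<omega>) / (t - s) - Y \<omega>)\<^sup>2) \<partial>M) \<longlongrightarrow> 0)
          (at s within T))"

end

theory Submission imports Defs begin

text \<open>A Wiener integral of \<open>f\<close> is centred Gaussian with variance \<open>\<integral>f\<^sup>2\<close>. If the variances of the difference
  quotients at a point tend to infinity, the small ball bound \<open>P(\<bar>Y\<bar> \<le> K) \<le> 2 K / \<sigma>\<close> makes them almost
  surely unbounded; this gives (i), and in (ii) it shows that the derivative is not differentiable.
  For \<open>\<alpha> > 1/2\<close> the kernel quotients converge to the derivative kernel in \<open>L\<^sup>2\<close> at rate \<open>h powr (\<alpha> - 1/2)\<close>,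
  locally uniformly in \<open>t > 0\<close>, so the second differences of \<open>X\<close> with step \<open>h\<close> have variance of order
  \<open>h powr (2 * \<alpha> + 1)\<close>. Since \<open>2\<alpha> + 1 > 2\<close>, high moments of the dyadic second differences are summable and
  force continuously differentiable paths. The pathwise derivative is then an almost sure limit of
  Wiener integrals, hence itself a Wiener integral.\<close>

section \<open>Wiener integrals\<close>

text \<open>Differentiability is claimed for t > 0 only: at t = 0 the squared derivative kernel is
  of order |s|^(2\<alpha> - 2 - \<gamma>), with exponent below -1, so the integral does not exist
  there; accordingly X(h)/h has variance h^(2H - 2), which blows up as H < 1. The upper bounds for
  the weighted kernels therefore carry a distance a > 0 from the origin. The noise is given by its
  values on sets and is additive only almost surely, so Gaussianity is obtained through
  characteristic functions of simple integrals, and the isometry is then read off the second moment.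
  A continuous version of the derivative process, built separately, would still have to be matched
  with the given paths of X; second differences of X itself avoid this. Second moments do not
  suffice for them: about 2^n cells at level n face a gain of only 2^(-n (2\<alpha> - 1)) per cell,
  and 2\<alpha> - 1 < 1. Gaussian moments of high order raise this gain to any power.\<close>

lemma simple_bochner_integrable_lborelD:
  fixes s :: "real \<Rightarrow> real"
  assumes "Bochner_Integration.simple_bochner_integrable lborel s"
  shows "finite (range s)" "s \<in> borel_measurable borel"
    and "y \<noteq> 0 \<Longrightarrow> s -` {y} \<in> fmeasurable lborel"
proof -
  have s: "simple_function lborel s" and e: "emeasure lborel {u. s u \<noteq> 0} \<noteq> \<infinity>"
    using assms by (auto simp: simple_bochner_integrable.simps)
  show "finite (range s)"
    using simple_functionD(1)[OF s] by simp
  show m: "s \<in> borel_measurable borel"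
    using borel_measurable_simple_function[OF s] by simp
  assume "y \<noteq> 0"
  note [measurable] = m
  have "{u. s u \<noteq> 0} \<in> sets borel"
    by measurable
  then have "emeasure lborel (s -` {y}) \<le> emeasure lborel {u. s u \<noteq> 0}"
    using \<open>y \<noteq> 0\<close> by (intro emeasure_mono) auto
  then show "s -` {y} \<in> fmeasurable lborel"
    using e measurable_sets_borel[OF m, of "{y}"]
    by (intro fmeasurableI) (auto simp: top.not_eq_extremum intro: le_less_trans)
qed

text \<open>The value 0 is left out because its level set has infinite Lebesgue measure, so the
  indicator of that set is not integrable.\<close>

lemma simple_bochner_integrable_power2:
  fixes s :: "real \<Rightarrow> real"
  assumes "Bochner_Integration.simple_bochner_integrable lborel s"
  shows "has_bochner_integral lborel (\<lambda>u. (s u)\<^sup>2) (\<Sum>y\<in>range s - {0}. y\<^sup>2 * measure lborel (s -` {y}))"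
proof -
  note D = simple_bochner_integrable_lborelD[OF assms]
  have "(s u)\<^sup>2 = (\<Sum>y\<in>range s - {0}. y\<^sup>2 * indicator (s -` {y}) u)" for u
  proof -
    have "(\<Sum>y\<in>range s - {0}. y\<^sup>2 * indicator (s -` {y}) u) =
        (\<Sum>y\<in>range s - {0}. if y = s u then y\<^sup>2 else 0)"
      by (intro sum.cong) (auto simp: indicator_def)
    then show ?thesis using D(1) by simp
  qed
  moreover have "has_bochner_integral lborel (\<lambda>u. \<Sum>y\<in>range s - {0}. y\<^sup>2 * indicator (s -` {y}) u)
      (\<Sum>y\<in>range s - {0}. y\<^sup>2 * measure lborel (s -` {y}))"
    using D(3) by (intro has_bochner_integral_sum has_bochner_integral_mult_right
        has_bochner_integral_real_indicator) (auto simp: fmeasurable_def)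
  ultimately show ?thesis by simp
qed

lemma simple_bochner_integrable_lincomb:
  fixes s t :: "real \<Rightarrow> real"
  assumes s: "Bochner_Integration.simple_bochner_integrable lborel s"
    and t: "Bochner_Integration.simple_bochner_integrable lborel t"
  shows "Bochner_Integration.simple_bochner_integrable lborel (\<lambda>u. a * s u + b * t u)"
proof -
  have *: "simple_function lborel s" "simple_function lborel t"
    and e: "emeasure lborel {u. s u \<noteq> 0} < \<infinity>" "emeasure lborel {u. t u \<noteq> 0} < \<infinity>"
    using assms by (auto simp: simple_bochner_integrable.simps less_top)
  have [measurable]: "s \<in> borel_measurable borel" "t \<in> borel_measurable borel"
    using simple_bochner_integrable_lborelD(2) s t by auto
  have "emeasure lborel {u. a * s u + b * t u \<noteq> 0} \<le> emeasure lborel ({u. s u \<noteq> 0} \<union> {u. t u \<noteq> 0})"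
    by (intro emeasure_mono) auto
  also have "\<dots> \<le> emeasure lborel {u. s u \<noteq> 0} + emeasure lborel {u. t u \<noteq> 0}"
    by (intro emeasure_subadditive) auto
  also have "\<dots> < \<infinity>" using e by (simp add: less_top)
  finally show ?thesis
    using * by (intro simple_bochner_integrable.intros) (auto intro!: simple_function_add simple_function_mult)
qed

section \<open>Gaussian law and almost sure linearity of integrals of simple functions\<close>

context gaussian_white_noise begin

text \<open>For positive measure the noise is rescaled to a standard normal variable. A null set
  gives the point mass at 0, which the same formula covers with variance 0, so later arguments need
  no case split.\<close>

lemma char_distr_noise:
  assumes A: "A \<in> fmeasurable lborel"
  shows "char (distr M borel (B A)) \<theta> = of_real (exp (- (\<theta>\<^sup>2 * measure lborel A) / 2))"
proof (cases "measure lborel A = 0")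
  case True
  have "distr M borel (B A) = distr M borel (\<lambda>_. 0)"
    using noise_null[OF A True] noise_measurable[OF A] by (intro distr_cong_AE) auto
  then show ?thesis
    using True by (simp add: char_def integral_distr prob_space del: distr_const)
next
  case False
  define \<sigma> where "\<sigma> = sqrt (measure lborel A)"
  have \<sigma>: "0 < \<sigma>" "\<sigma>\<^sup>2 = measure lborel A"
    using False by (auto simp: \<sigma>_def less_le)
  note [measurable] = noise_measurable[OF A]
  have "distributed M lborel (\<lambda>\<omega>. (B A \<omega> - 0) / \<sigma>) std_normal_density"
    using noise_normal[OF A] False \<sigma>(1) unfolding \<sigma>_def[symmetric]
    by (subst normal_standard_normal_convert[symmetric]) (auto simp: less_le)
  then have D: "distr M borel (\<lambda>\<omega>. B A \<omega> / \<sigma>) = std_normal_distribution"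
    unfolding distributed_def by (simp cong: distr_cong)
  have "char (distr M borel (B A)) \<theta> = char (distr M borel (\<lambda>\<omega>. B A \<omega> / \<sigma>)) (\<theta> * \<sigma>)"
    using \<sigma>(1) by (simp add: char_def integral_distr)
  then show ?thesis
    by (simp add: D char_std_normal_distribution power_mult_distrib \<sigma>(2))
qed

text \<open>Independence is assumed for whole sequences of disjoint sets, so a finite family is
  continued by empty sets, which are disjoint from everything, themselves included.\<close>

lemma noise_indep_finite:
  assumes "\<And>i. i < n \<Longrightarrow> A i \<in> fmeasurable lborel" and "disjoint_family_on A {..<n::nat}"
  shows "indep_vars (\<lambda>_. borel) (\<lambda>i. B (A i)) {..<n}"
proof -
  define F where "F i = (if i < n then A i else {})" for i
  have "indep_vars (\<lambda>_. borel) (\<lambda>i. B (F i)) UNIV"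
    using assms by (intro noise_independent) (auto simp: F_def disjoint_family_on_def)
  then have "indep_vars (\<lambda>_. borel) (\<lambda>i. B (F i)) {..<n}"
    by (rule indep_vars_subset) simp
  moreover have "indep_vars (\<lambda>_. borel) (\<lambda>i. B (F i)) {..<n} \<longleftrightarrow> ?thesis"
    by (rule indep_vars_cong) (auto simp: F_def)
  ultimately show ?thesis by simp
qed

lemma char_distr_sum_noise:
  assumes A: "\<And>i. i < n \<Longrightarrow> A i \<in> fmeasurable lborel" and "disjoint_family_on A {..<n::nat}"
  shows "char (distr M borel (\<lambda>\<omega>. \<Sum>i<n. c i * B (A i) \<omega>)) \<theta> =
    of_real (exp (- (\<theta>\<^sup>2 * (\<Sum>i<n. (c i)\<^sup>2 * measure lborel (A i))) / 2))"
proof -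
  have "indep_vars (\<lambda>_. borel) (\<lambda>i \<omega>. c i * B (A i) \<omega>) {..<n}"
    by (rule indep_vars_compose2[OF noise_indep_finite[OF assms]]) auto
  then have "char (distr M borel (\<lambda>\<omega>. \<Sum>i<n. c i * B (A i) \<omega>)) \<theta> =
    (\<Prod>i<n. char (distr M borel (\<lambda>\<omega>. c i * B (A i) \<omega>)) \<theta>)"
    by (rule char_distr_sum)
  also have "\<dots> = (\<Prod>i<n. char (distr M borel (B (A i))) (\<theta> * c i))"
    using noise_measurable[OF A] by (intro prod.cong refl) (simp add: char_def integral_distr mult.assoc)
  also have "\<dots> = of_real (\<Prod>i<n. exp (- (\<theta>\<^sup>2 * ((c i)\<^sup>2 * measure lborel (A i))) / 2))"
    using A by (simp add: char_distr_noise power_mult_distrib mult.assoc)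
  also have "(\<Prod>i<n. exp (- (\<theta>\<^sup>2 * ((c i)\<^sup>2 * measure lborel (A i))) / 2)) =
      exp (- (\<theta>\<^sup>2 * (\<Sum>i<n. (c i)\<^sup>2 * measure lborel (A i))) / 2)"
    by (simp add: exp_sum[symmetric] sum_negf sum_distrib_left sum_divide_distrib)
  finally show ?thesis .
qed

text \<open>Countable additivity is applied to A, C and infinitely many empty sets; the noise of the
  empty set vanishes only almost surely, so the series reduces to two terms off a null set.\<close>

lemma AE_noise_Un:
  assumes "A \<in> fmeasurable lborel" "C \<in> fmeasurable lborel" "A \<inter> C = {}"
  shows "AE \<omega> in M. B (A \<union> C) \<omega> = B A \<omega> + B C \<omega>"
proof -
  define F where "F i = (if i = 0 then A else if i = 1 then C else {})" for i :: nat
  have U: "(\<Union>i. F i) = A \<union> C"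
    by (auto simp: F_def split: if_splits)
  have "AE \<omega> in M. (\<lambda>i. B (F i) \<omega>) sums B (\<Union>i. F i) \<omega>"
    using assms by (intro noise_countably_additive)
      (auto simp: F_def disjoint_family_on_def U simp flip: One_nat_def)
  moreover have "AE \<omega> in M. B {} \<omega> = 0"
    by (rule noise_null) auto
  ultimately show ?thesis
  proof eventually_elim
    fix \<omega> assume S: "(\<lambda>i. B (F i) \<omega>) sums B (\<Union>i. F i) \<omega>" and 0: "B {} \<omega> = 0"
    have "(\<lambda>i. B (F i) \<omega>) sums (\<Sum>i\<in>{0,1}. B (F i) \<omega>)"
      by (rule sums_finite) (auto simp: F_def 0)
    then show "B (A \<union> C) \<omega> = B A \<omega> + B C \<omega>"
      using sums_unique2[OF S] by (simp add: U) (simp add: F_def)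
  qed
qed

lemma AE_noise_UN:
  assumes "finite I" "\<And>i. i \<in> I \<Longrightarrow> A i \<in> fmeasurable lborel" "disjoint_family_on A I"
  shows "AE \<omega> in M. B (\<Union>i\<in>I. A i) \<omega> = (\<Sum>i\<in>I. B (A i) \<omega>)"
  using assms
proof (induction I rule: finite_induct)
  case empty
  have "AE \<omega> in M. B {} \<omega> = 0"
    by (rule noise_null) auto
  then show ?case by simp
next
  case (insert i I)
  have "AE \<omega> in M. B (\<Union>i\<in>I. A i) \<omega> = (\<Sum>i\<in>I. B (A i) \<omega>)"
    using insert by (auto simp: disjoint_family_on_def)
  moreover have "AE \<omega> in M. B (A i \<union> (\<Union>i\<in>I. A i)) \<omega> = B (A i) \<omega> + B (\<Union>i\<in>I. A i) \<omega>"
    using insert by (intro AE_noise_Un) (auto simp: disjoint_family_on_def)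
  ultimately show ?case
    by eventually_elim (use insert in simp)
qed

text \<open>Evaluates the simple integral on a partition finer than the one into level sets, so that
  integrals of different simple functions can be compared on a common refinement.\<close>

lemma AE_simple_wiener_integral_comp:
  fixes p :: "real \<Rightarrow> 'b" and v :: "'b \<Rightarrow> real"
  assumes fin: "finite (range p)"
    and meas: "\<And>z. v z \<noteq> 0 \<Longrightarrow> p -` {z} \<in> fmeasurable lborel"
  shows "AE \<omega> in M. simple_wiener_integral B (\<lambda>u. v (p u)) \<omega> = (\<Sum>z\<in>range p. v z * B (p -` {z}) \<omega>)"
proof -
  have "AE \<omega> in M. \<forall>y\<in>v ` range p. y \<noteq> 0 \<longrightarrow>
      B {u. v (p u) = y} \<omega> = (\<Sum>z\<in>{z\<in>range p. v z = y}. B (p -` {z}) \<omega>)"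
  proof (rule AE_finite_allI)
    fix y assume "y \<in> v ` range p"
    show "AE \<omega> in M. y \<noteq> 0 \<longrightarrow>
        B {u. v (p u) = y} \<omega> = (\<Sum>z\<in>{z\<in>range p. v z = y}. B (p -` {z}) \<omega>)"
    proof (cases "y = 0")
      case False
      have "{u. v (p u) = y} = (\<Union>z\<in>{z\<in>range p. v z = y}. p -` {z})"
        by auto
      with False show ?thesis
        using AE_noise_UN[of "{z\<in>range p. v z = y}" "\<lambda>z. p -` {z}"] fin meas
        by (auto simp: disjoint_family_on_def)
    qed simp
  qed (use fin in simp)
  then show ?thesis
  proof eventually_elim
    fix \<omega> assume *: "\<forall>y\<in>v ` range p. y \<noteq> 0 \<longrightarrow>
      B {u. v (p u) = y} \<omega> = (\<Sum>z\<in>{z\<in>range p. v z = y}. B (p -` {z}) \<omega>)"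
    have "(\<Sum>z\<in>range p. v z * B (p -` {z}) \<omega>) =
        (\<Sum>y\<in>v ` range p. \<Sum>z\<in>{z\<in>range p. v z = y}. v z * B (p -` {z}) \<omega>)"
      by (rule sum.image_gen[OF fin])
    also have "\<dots> = (\<Sum>y\<in>v ` range p. y * B {u. v (p u) = y} \<omega>)"
    proof (intro sum.cong refl)
      fix y assume y: "y \<in> v ` range p"
      have "(\<Sum>z\<in>{z\<in>range p. v z = y}. v z * B (p -` {z}) \<omega>) =
          y * (\<Sum>z\<in>{z\<in>range p. v z = y}. B (p -` {z}) \<omega>)"
        unfolding sum_distrib_left by (intro sum.cong) auto
      also have "\<dots> = y * B {u. v (p u) = y} \<omega>"
        using * y by (cases "y = 0") auto
      finally show "(\<Sum>z\<in>{z\<in>range p. v z = y}. v z * B (p -` {z}) \<omega>) = y * B {u. v (p u) = y} \<omega>" .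
    qed
    finally show "simple_wiener_integral B (\<lambda>u. v (p u)) \<omega> = (\<Sum>z\<in>range p. v z * B (p -` {z}) \<omega>)"
      by (simp add: simple_wiener_integral_def image_image)
  qed
qed

text \<open>On the zero set of s, which has infinite measure, the noise is unconstrained and
  possibly not even measurable. Removing that term leaves only sets of finite measure.\<close>

lemma simple_wiener_integral_nonzero:
  fixes s :: "real \<Rightarrow> real"
  assumes "Bochner_Integration.simple_bochner_integrable lborel s"
  shows "simple_wiener_integral B s \<omega> = (\<Sum>y\<in>range s - {0}. y * B (s -` {y}) \<omega>)"
  unfolding simple_wiener_integral_def using simple_bochner_integrable_lborelD(1)[OF assms]
  by (intro sum.mono_neutral_cong_right) (auto simp: vimage_def)

lemma simple_wiener_integral_measurable:
  fixes s :: "real \<Rightarrow> real"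
  assumes "Bochner_Integration.simple_bochner_integrable lborel s"
  shows "simple_wiener_integral B s \<in> borel_measurable M"
  using noise_measurable simple_bochner_integrable_lborelD(3)[OF assms]
  unfolding simple_wiener_integral_nonzero[OF assms, abs_def] by (auto intro!: borel_measurable_sum)

text \<open>Level sets of distinct values are disjoint, so the summands are independent Gaussians
  and their variances add up to the squared L2 norm.\<close>

lemma char_distr_simple_wiener_integral:
  fixes s :: "real \<Rightarrow> real"
  assumes "Bochner_Integration.simple_bochner_integrable lborel s"
  shows "char (distr M borel (simple_wiener_integral B s)) \<theta> =
    of_real (exp (- (\<theta>\<^sup>2 * (\<integral>u. (s u)\<^sup>2 \<partial>lborel)) / 2))"
proof -
  note D = simple_bochner_integrable_lborelD[OF assms]
  \<comment> \<open>The nonzero values are enumerated because the formula for independent sums is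
    indexed by an initial segment of the naturals.\<close>
  obtain e where e: "bij_betw e {..<card (range s - {0})} (range s - {0})"
    using ex_bij_betw_nat_finite[of "range s - {0}"] D(1) by (auto simp: atLeast0LessThan)
  let ?n = "card (range s - {0})"
  have inj: "inj_on e {..<?n}" using e by (rule bij_betw_imp_inj_on)
  have e0: "e i \<noteq> 0" if "i < ?n" for i using bij_betwE[OF e] that by auto
  have "simple_wiener_integral B s \<omega> = (\<Sum>i<?n. e i * B (s -` {e i}) \<omega>)" for \<omega>
    unfolding simple_wiener_integral_nonzero[OF assms] by (rule sum.reindex_bij_betw[OF e, symmetric])
  moreover have "(\<integral>u. (s u)\<^sup>2 \<partial>lborel) = (\<Sum>i<?n. (e i)\<^sup>2 * measure lborel (s -` {e i}))"
    unfolding has_bochner_integral_integral_eq[OF simple_bochner_integrable_power2[OF assms]]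
    by (rule sum.reindex_bij_betw[OF e, symmetric])
  moreover have "disjoint_family_on (\<lambda>i. s -` {e i}) {..<?n}"
    using inj by (auto simp: disjoint_family_on_def inj_on_def)
  ultimately show ?thesis
    using char_distr_sum_noise[of ?n "\<lambda>i. s -` {e i}" e \<theta>] D(3)[OF e0] by (simp cong: distr_cong)
qed

text \<open>All three integrals are evaluated on the common refinement given by the level sets of
  the pair (s, t). Only the cell of (0, 0) can have infinite measure, and there every coefficient
  vanishes.\<close>

lemma AE_simple_wiener_integral_lincomb:
  fixes s t :: "real \<Rightarrow> real"
  assumes s: "Bochner_Integration.simple_bochner_integrable lborel s"
    and t: "Bochner_Integration.simple_bochner_integrable lborel t"
  shows "AE \<omega> in M. simple_wiener_integral B (\<lambda>u. a * s u + b * t u) \<omega> =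
    a * simple_wiener_integral B s \<omega> + b * simple_wiener_integral B t \<omega>"
proof -
  define p where "p u = (s u, t u)" for u
  note Ds = simple_bochner_integrable_lborelD[OF s] and Dt = simple_bochner_integrable_lborelD[OF t]
  have "range p \<subseteq> range s \<times> range t"
    by (auto simp: p_def)
  then have fin: "finite (range p)"
    using Ds(1) Dt(1) by (auto intro: finite_subset)
  have pz: "p -` {z} = s -` {fst z} \<inter> t -` {snd z}" for z
    by (auto simp: p_def)
  have meas: "p -` {z} \<in> fmeasurable lborel" if "z \<noteq> (0, 0)" for z
  proof -
    have sets: "s -` {fst z} \<in> sets lborel" "t -` {snd z} \<in> sets lborel"
      using Ds(2) Dt(2) by (auto intro: measurable_sets_borel)
    from that have "fst z \<noteq> 0 \<or> snd z \<noteq> 0" by (auto simp: prod_eq_iff)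
    then show ?thesis
    proof
      assume "fst z \<noteq> 0"
      then show ?thesis
        unfolding pz using Ds(3) sets by (intro fmeasurable_Int_fmeasurable) auto
    next
      assume "snd z \<noteq> 0"
      then show ?thesis
        unfolding pz Int_commute[of "s -` {fst z}"] using Dt(3) sets
        by (intro fmeasurable_Int_fmeasurable) auto
    qed
  qed
  note * = AE_simple_wiener_integral_comp[where p = p, OF fin meas]
  have "AE \<omega> in M. simple_wiener_integral B (\<lambda>u. a * fst (p u) + b * snd (p u)) \<omega> =
        (\<Sum>z\<in>range p. (a * fst z + b * snd z) * B (p -` {z}) \<omega>)"
    and "AE \<omega> in M. simple_wiener_integral B (\<lambda>u. fst (p u)) \<omega> = (\<Sum>z\<in>range p. fst z * B (p -` {z}) \<omega>)"
    and "AE \<omega> in M. simple_wiener_integral B (\<lambda>u. snd (p u)) \<omega> = (\<Sum>z\<in>range p. snd z * B (p -` {z}) \<omega>)"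
    by (rule *; auto)+
  then show ?thesis
    unfolding p_def fst_conv snd_conv
    by eventually_elim (simp add: sum_distrib_left sum.distrib[symmetric] algebra_simps)
qed

end

section \<open>Mean square limits: norms and characteristic functions\<close>

lemma nn_integral_power2_diff_le:
  fixes f g h :: "'a \<Rightarrow> real"
  assumes [measurable]: "f \<in> borel_measurable M" "g \<in> borel_measurable M" "h \<in> borel_measurable M"
  shows "(\<integral>\<^sup>+x. ennreal ((f x - h x)\<^sup>2) \<partial>M) \<le>
    2 * (\<integral>\<^sup>+x. ennreal ((f x - g x)\<^sup>2) \<partial>M) + 2 * (\<integral>\<^sup>+x. ennreal ((g x - h x)\<^sup>2) \<partial>M)"
proof -
  have "(f x - h x)\<^sup>2 \<le> 2 * (f x - g x)\<^sup>2 + 2 * (g x - h x)\<^sup>2" for x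
    using sum_squares_bound[of "f x - g x" "g x - h x"] by (simp add: power2_eq_square algebra_simps)
  then have "(\<integral>\<^sup>+x. ennreal ((f x - h x)\<^sup>2) \<partial>M) \<le>
      (\<integral>\<^sup>+x. ennreal (2 * (f x - g x)\<^sup>2 + 2 * (g x - h x)\<^sup>2) \<partial>M)"
    by (intro nn_integral_mono ennreal_leI)
  also have "\<dots> = (\<integral>\<^sup>+x. 2 * ennreal ((f x - g x)\<^sup>2) + 2 * ennreal ((g x - h x)\<^sup>2) \<partial>M)"
    by (simp add: ennreal_mult)
  finally show ?thesis
    by (simp add: nn_integral_add nn_integral_cmult)
qed

text \<open>Young's inequality compares the squares of s n and f pointwise, at the price of an
  arbitrarily small multiple of the square of f, so the squared norms converge. The hypothesis uses
  extended integrals, so that square integrability of f is a conclusion.\<close>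

lemma L2_limit:
  fixes s :: "nat \<Rightarrow> 'a \<Rightarrow> real"
  assumes s: "\<And>n. integrable M (\<lambda>x. (s n x)\<^sup>2)"
    and [measurable]: "\<And>n. s n \<in> borel_measurable M" "f \<in> borel_measurable M"
    and lim: "(\<lambda>n. \<integral>\<^sup>+x. ennreal ((s n x - f x)\<^sup>2) \<partial>M) \<longlonglongrightarrow> 0"
  shows "integrable M (\<lambda>x. (f x)\<^sup>2)" and "(\<lambda>n. \<integral>x. (s n x)\<^sup>2 \<partial>M) \<longlonglongrightarrow> (\<integral>x. (f x)\<^sup>2 \<partial>M)"
proof -
  have ev: "eventually (\<lambda>n. (\<integral>\<^sup>+x. ennreal ((s n x - f x)\<^sup>2) \<partial>M) < \<infinity>) sequentially"
    using lim by (rule order_tendstoD) simp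
  then obtain n where n: "(\<integral>\<^sup>+x. ennreal ((s n x - f x)\<^sup>2) \<partial>M) < \<infinity>"
    by (auto simp: eventually_sequentially)
  have "(\<integral>\<^sup>+x. ennreal ((f x - 0)\<^sup>2) \<partial>M) \<le>
      2 * (\<integral>\<^sup>+x. ennreal ((f x - s n x)\<^sup>2) \<partial>M) + 2 * (\<integral>\<^sup>+x. ennreal ((s n x - 0)\<^sup>2) \<partial>M)"
    by (rule nn_integral_power2_diff_le) auto
  also have "\<dots> < \<infinity>"
    using n integrableD(2)[OF s[of n]]
    by (simp add: power2_commute ennreal_mult_less_top less_top nn_integral_eq_integral[OF s])
  finally show f: "integrable M (\<lambda>x. (f x)\<^sup>2)"
    by (intro integrableI_nonneg) auto
  define D where "D n = enn2real (\<integral>\<^sup>+x. ennreal ((s n x - f x)\<^sup>2) \<partial>M)" for n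
  define F where "F = (\<integral>x. (f x)\<^sup>2 \<partial>M)"
  have F: "0 \<le> F" unfolding F_def by simp
  have D: "D \<longlonglongrightarrow> 0"
    unfolding D_def by (rule tendsto_enn2real) (use lim in simp_all)
  have bound: "\<bar>(\<integral>x. (s n x)\<^sup>2 \<partial>M) - F\<bar> \<le> e * F + (1 + 1 / e) * D n"
    if fin: "(\<integral>\<^sup>+x. ennreal ((s n x - f x)\<^sup>2) \<partial>M) < \<infinity>" and e: "e > 0" for n and e :: real
  proof -
    have i: "integrable M (\<lambda>x. (s n x - f x)\<^sup>2)"
      using fin by (intro integrableI_nonneg) auto
    have Dn: "D n = (\<integral>x. (s n x - f x)\<^sup>2 \<partial>M)"
      unfolding D_def by (simp add: nn_integral_eq_integral[OF i])
    have "\<bar>(s n x)\<^sup>2 - (f x)\<^sup>2\<bar> \<le> e * (f x)\<^sup>2 + (1 + 1 / e) * (s n x - f x)\<^sup>2" for x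
    proof -
      define d where "d = s n x - f x"
      \<comment> \<open>Expanding this square gives 2 |f d| \<le> e f^2 + d^2 / e; the factor 1 + 1
        / e in the claim collects d^2 and d^2 / e.\<close>
      have "0 \<le> (sqrt e * \<bar>f x\<bar> - \<bar>d\<bar> / sqrt e)\<^sup>2" by simp
      also have "\<dots> = e * (f x)\<^sup>2 + d\<^sup>2 / e - 2 * (\<bar>f x\<bar> * \<bar>d\<bar>)"
        using e by (simp add: power2_diff power_mult_distrib power_divide)
      finally have "2 * \<bar>f x * d\<bar> \<le> e * (f x)\<^sup>2 + d\<^sup>2 / e" by (simp add: abs_mult)
      moreover have "(s n x)\<^sup>2 - (f x)\<^sup>2 = d\<^sup>2 + 2 * (f x * d)"
        by (simp add: d_def power2_eq_square algebra_simps)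
      ultimately have "\<bar>(s n x)\<^sup>2 - (f x)\<^sup>2\<bar> \<le> d\<^sup>2 + (e * (f x)\<^sup>2 + d\<^sup>2 / e)"
        using zero_le_power2[of d] by linarith
      then show ?thesis by (simp add: d_def algebra_simps)
    qed
    then have "(\<integral>x. \<bar>(s n x)\<^sup>2 - (f x)\<^sup>2\<bar> \<partial>M) \<le> (\<integral>x. e * (f x)\<^sup>2 + (1 + 1 / e) * (s n x - f x)\<^sup>2 \<partial>M)"
      using s f i by (intro integral_mono) auto
    also have "\<dots> = e * F + (1 + 1 / e) * D n"
      using f i by (simp add: F_def Dn)
    finally have "(\<integral>x. \<bar>(s n x)\<^sup>2 - (f x)\<^sup>2\<bar> \<partial>M) \<le> e * F + (1 + 1 / e) * D n" .
    moreover have "\<bar>(\<integral>x. (s n x)\<^sup>2 - (f x)\<^sup>2 \<partial>M)\<bar> \<le> (\<integral>x. \<bar>(s n x)\<^sup>2 - (f x)\<^sup>2\<bar> \<partial>M)"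
      by (rule integral_abs_bound)
    ultimately show ?thesis using s f by (simp add: F_def)
  qed
  show "(\<lambda>n. \<integral>x. (s n x)\<^sup>2 \<partial>M) \<longlonglongrightarrow> (\<integral>x. (f x)\<^sup>2 \<partial>M)"
    unfolding F_def[symmetric]
  proof (rule LIMSEQ_I)
    fix r :: real assume r: "0 < r"
    \<comment> \<open>This choice makes \<open>e * F\<close> less than r / 2; the 1 in the
      denominator guards against F = 0.\<close>
    define e where "e = r / (2 * (F + 1))"
    have e: "e > 0" using r F by (simp add: e_def)
    have eF: "e * F < r / 2"
      using r F by (simp add: e_def field_simps)
    have "(\<lambda>n. (1 + 1 / e) * D n) \<longlonglongrightarrow> (1 + 1 / e) * 0"
      using D by (intro tendsto_intros)
    then have "eventually (\<lambda>n. (1 + 1 / e) * D n < r / 2) sequentially"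
      by (rule order_tendstoD) (use r in simp)
    with ev have "eventually (\<lambda>n. norm ((\<integral>x. (s n x)\<^sup>2 \<partial>M) - F) < r) sequentially"
    proof eventually_elim
      case (elim n)
      then show ?case using bound[OF elim(1) e] eF by (simp only: real_norm_def)
    qed
    then show "\<exists>no. \<forall>n\<ge>no. norm ((\<integral>x. (s n x)\<^sup>2 \<partial>M) - F) < r"
      by (simp add: eventually_sequentially)
  qed
qed

lemma cmod_iexp_diff_le: "cmod (iexp a - iexp b) \<le> \<bar>a - b\<bar>"
proof -
  have "iexp a - iexp b = iexp b * (iexp (a - b) - 1)"
    by (simp add: exp_diff of_real_diff algebra_simps)
  then have "cmod (iexp a - iexp b) = cmod (iexp (a - b) - 1)"
    by (simp add: norm_mult)
  also have "\<dots> \<le> \<bar>a - b\<bar>"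
    using iexp_approx1[of "a - b" 0] by simp
  finally show ?thesis .
qed

text \<open>The map x -> exp(i \<theta> x) is Lipschitz with constant |\<theta>|, so the difference
  is at most |\<theta>| E|S n - Y|, and Cauchy-Schwarz against the constant 1 turns this into the
  mean square distance. The bound is kept in squared form to match the hypothesis.\<close>

lemma (in prob_space) char_L2_limit:
  assumes [measurable]: "\<And>n. S n \<in> borel_measurable M" "Y \<in> borel_measurable M"
    and lim: "(\<lambda>n. \<integral>\<^sup>+\<omega>. ennreal ((S n \<omega> - Y \<omega> :: real)\<^sup>2) \<partial>M) \<longlonglongrightarrow> 0"
  shows "(\<lambda>n. char (distr M borel (S n)) \<theta>) \<longlonglongrightarrow> char (distr M borel Y) \<theta>"
proof -
  have int: "integrable M (\<lambda>\<omega>. iexp (\<theta> * Z \<omega>))" if [measurable]: "Z \<in> borel_measurable M" for Z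
    by (rule integrable_const_bound[where B = 1]) auto
  have char: "char (distr M borel Z) \<theta> = (\<integral>\<omega>. iexp (\<theta> * Z \<omega>) \<partial>M)"
    if [measurable]: "Z \<in> borel_measurable M" for Z
    by (simp add: char_def integral_distr)
  have "ennreal ((cmod (char (distr M borel (S n)) \<theta> - char (distr M borel Y) \<theta>))\<^sup>2) \<le>
      ennreal (\<theta>\<^sup>2) * (\<integral>\<^sup>+\<omega>. ennreal ((S n \<omega> - Y \<omega>)\<^sup>2) \<partial>M)" for n
  proof -
    have "char (distr M borel (S n)) \<theta> - char (distr M borel Y) \<theta> =
        (\<integral>\<omega>. iexp (\<theta> * S n \<omega>) - iexp (\<theta> * Y \<omega>) \<partial>M)"
      using int[of "S n"] int[of Y] by (simp only: char assms(1,2) Bochner_Integration.integral_diff)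
    then have "ennreal (cmod (char (distr M borel (S n)) \<theta> - char (distr M borel Y) \<theta>)) \<le>
        (\<integral>\<^sup>+\<omega>. cmod (iexp (\<theta> * S n \<omega>) - iexp (\<theta> * Y \<omega>)) \<partial>M)"
      using integral_norm_bound_ennreal[of M "\<lambda>\<omega>. iexp (\<theta> * S n \<omega>) - iexp (\<theta> * Y \<omega>)"]
        int[of "S n"] int[of Y] by simp
    also have "\<dots> \<le> (\<integral>\<^sup>+\<omega>. ennreal \<bar>\<theta> * (S n \<omega> - Y \<omega>)\<bar> * 1 \<partial>M)"
      using cmod_iexp_diff_le[of "\<theta> * S n _" "\<theta> * Y _"]
      by (intro nn_integral_mono) (simp add: right_diff_distrib del: of_real_mult)
    finally have "(ennreal (cmod (char (distr M borel (S n)) \<theta> - char (distr M borel Y) \<theta>)))\<^sup>2 \<le>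
        (\<integral>\<^sup>+\<omega>. ennreal \<bar>\<theta> * (S n \<omega> - Y \<omega>)\<bar> * 1 \<partial>M)\<^sup>2"
      by (rule power_mono) simp
    also have "\<dots> \<le> (\<integral>\<^sup>+\<omega>. (ennreal \<bar>\<theta> * (S n \<omega> - Y \<omega>)\<bar>)\<^sup>2 \<partial>M) * (\<integral>\<^sup>+\<omega>. 1\<^sup>2 \<partial>M)"
      by (rule Cauchy_Schwarz_nn_integral) auto
    also have "\<dots> = ennreal (\<theta>\<^sup>2) * (\<integral>\<^sup>+\<omega>. ennreal ((S n \<omega> - Y \<omega>)\<^sup>2) \<partial>M)"
      by (simp add: ennreal_power power_mult_distrib ennreal_mult nn_integral_cmult emeasure_space_1)
    finally show ?thesis by (simp add: ennreal_power)
  qed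
  note bound = this
  have lim': "(\<lambda>n. ennreal (\<theta>\<^sup>2) * (\<integral>\<^sup>+\<omega>. ennreal ((S n \<omega> - Y \<omega>)\<^sup>2) \<partial>M)) \<longlonglongrightarrow> ennreal (\<theta>\<^sup>2) * 0"
    using lim by (intro ennreal_tendsto_cmult) auto
  have "(\<lambda>n. ennreal ((cmod (char (distr M borel (S n)) \<theta> - char (distr M borel Y) \<theta>))\<^sup>2)) \<longlonglongrightarrow> ennreal 0"
    using lim' bound by (intro tendsto_sandwich[OF _ _ tendsto_const lim'[unfolded mult_zero_right, folded ennreal_0]]) auto
  then have "(\<lambda>n. (cmod (char (distr M borel (S n)) \<theta> - char (distr M borel Y) \<theta>))\<^sup>2) \<longlonglongrightarrow> 0"
    by (subst (asm) tendsto_ennreal_iff) auto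
  then show ?thesis
    by (simp add: tendsto_norm_zero_iff LIM_zero_iff)
qed

section \<open>Law, moments, linearity and closure of the Wiener integral\<close>

context gaussian_white_noise begin

lemma has_wiener_integral_measurable:
  assumes "has_wiener_integral M B f Y"
  shows "f \<in> borel_measurable borel" "Y \<in> borel_measurable M"
  using assms by (auto simp: has_wiener_integral_def)

text \<open>The formula holds for the approximating simple functions. Along them the variances
  converge to the squared norm of f and the characteristic functions to that of Y, so it persists in
  the limit.\<close>

lemma has_wiener_integral_char:
  assumes "has_wiener_integral M B f Y"
  shows "integrable lborel (\<lambda>u. (f u)\<^sup>2)"
    and "char (distr M borel Y) \<theta> = of_real (exp (- (\<theta>\<^sup>2 * (\<integral>u. (f u)\<^sup>2 \<partial>lborel)) / 2))"
proof -
  from assms obtain s where [measurable]: "f \<in> borel_measurable borel" "Y \<in> borel_measurable M"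
    and s: "\<And>n. Bochner_Integration.simple_bochner_integrable lborel (s n)"
    and lim: "(\<lambda>n. \<integral>\<^sup>+u. ennreal ((s n u - f u)\<^sup>2) \<partial>lborel) \<longlonglongrightarrow> 0"
    and limS: "(\<lambda>n. \<integral>\<^sup>+\<omega>. ennreal ((simple_wiener_integral B (s n) \<omega> - Y \<omega>)\<^sup>2) \<partial>M) \<longlonglongrightarrow> 0"
    by (auto simp: has_wiener_integral_def)
  note [measurable] = simple_bochner_integrable_lborelD(2)[OF s] simple_wiener_integral_measurable[OF s]
  have int: "integrable lborel (\<lambda>u. (s n u)\<^sup>2)" for n
    using simple_bochner_integrable_power2[OF s] by (rule integrable.intros)
  show "integrable lborel (\<lambda>u. (f u)\<^sup>2)"
    by (rule L2_limit(1)[OF int _ _ lim]) auto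
  have "(\<lambda>n. \<integral>u. (s n u)\<^sup>2 \<partial>lborel) \<longlonglongrightarrow> (\<integral>u. (f u)\<^sup>2 \<partial>lborel)"
    by (rule L2_limit(2)[OF int _ _ lim]) auto
  then have "(\<lambda>n. complex_of_real (exp (- (\<theta>\<^sup>2 * (\<integral>u. (s n u)\<^sup>2 \<partial>lborel)) / 2))) \<longlonglongrightarrow>
      of_real (exp (- (\<theta>\<^sup>2 * (\<integral>u. (f u)\<^sup>2 \<partial>lborel)) / 2))"
    by (intro tendsto_intros) auto
  moreover have "(\<lambda>n. char (distr M borel (simple_wiener_integral B (s n))) \<theta>) \<longlonglongrightarrow> char (distr M borel Y) \<theta>"
    by (rule char_L2_limit[OF _ _ limS]) auto
  ultimately show "char (distr M borel Y) \<theta> = of_real (exp (- (\<theta>\<^sup>2 * (\<integral>u. (f u)\<^sup>2 \<partial>lborel)) / 2))"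
    unfolding char_distr_simple_wiener_integral[OF s] by (rule LIMSEQ_unique[symmetric])
qed

text \<open>The law is written as a scaled standard normal law and not by a density, so that the
  degenerate case of variance 0 is included.\<close>

lemma has_wiener_integral_distr:
  assumes "has_wiener_integral M B f Y"
  shows "distr M borel Y = distr std_normal_distribution borel (\<lambda>x. sqrt (\<integral>u. (f u)\<^sup>2 \<partial>lborel) * x)"
proof (rule Levy_uniqueness)
  interpret N: real_distribution std_normal_distribution by (rule real_dist_normal_dist)
  show "real_distribution (distr M borel Y)"
    using has_wiener_integral_measurable(2)[OF assms] by (rule real_distribution_distr)
  show "real_distribution (distr std_normal_distribution borel (\<lambda>x. sqrt (\<integral>u. (f u)\<^sup>2 \<partial>lborel) * x))"
    by (rule N.real_distribution_distr) simp
  show "char (distr M borel Y) = char (distr std_normal_distribution borel (\<lambda>x. sqrt (\<integral>u. (f u)\<^sup>2 \<partial>lborel) * x))"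
  proof
    fix \<theta>
    have "char (distr std_normal_distribution borel (\<lambda>x. sqrt (\<integral>u. (f u)\<^sup>2 \<partial>lborel) * x)) \<theta> =
        char std_normal_distribution (\<theta> * sqrt (\<integral>u. (f u)\<^sup>2 \<partial>lborel))"
      by (simp add: char_def integral_distr mult.assoc)
    then show "char (distr M borel Y) \<theta> = char (distr std_normal_distribution borel (\<lambda>x. sqrt (\<integral>u. (f u)\<^sup>2 \<partial>lborel) * x)) \<theta>"
      by (simp add: has_wiener_integral_char(2)[OF assms] char_std_normal_distribution power_mult_distrib)
  qed
qed

text \<open>The factor (2k)! / (2^k k!) is the double factorial (2k - 1)!!, the moment of order 2k
  of a standard normal variable.\<close>

lemma has_wiener_integral_moment:
  assumes W: "has_wiener_integral M B f Y"
  shows "(\<integral>\<^sup>+\<omega>. ennreal ((Y \<omega>) ^ (2 * k)) \<partial>M) =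
    ennreal (fact (2 * k) / (2 ^ k * fact k) * (\<integral>u. (f u)\<^sup>2 \<partial>lborel) ^ k)"
proof -
  note [measurable] = has_wiener_integral_measurable(2)[OF W]
  define v where "v = (\<integral>u. (f u)\<^sup>2 \<partial>lborel)"
  have v: "0 \<le> v" by (simp add: v_def)
  have "(\<integral>\<^sup>+\<omega>. ennreal ((Y \<omega>) ^ (2 * k)) \<partial>M) = (\<integral>\<^sup>+x. ennreal (x ^ (2 * k)) \<partial>distr M borel Y)"
    by (simp add: nn_integral_distr)
  also have "\<dots> = (\<integral>\<^sup>+x. ennreal ((sqrt v * x) ^ (2 * k)) \<partial>std_normal_distribution)"
    unfolding has_wiener_integral_distr[OF W] v_def[symmetric] by (simp add: nn_integral_distr)
  also have "\<dots> = (\<integral>\<^sup>+x. ennreal (v ^ k) * ennreal (std_normal_density x * x ^ (2 * k)) \<partial>lborel)"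
  proof -
    have "(sqrt v * x) ^ (2 * k) = v ^ k * x ^ (2 * k)" for x
      using v by (simp add: power_mult power_mult_distrib)
    then show ?thesis
      using v by (subst nn_integral_density)
        (auto simp: ennreal_mult[symmetric] ac_simps zero_le_even_power intro!: nn_integral_cong)
  qed
  also have "\<dots> = ennreal (v ^ k) * (\<integral>\<^sup>+x. ennreal (std_normal_density x * x ^ (2 * k)) \<partial>lborel)"
    by (rule nn_integral_cmult) simp
  also have "(\<integral>\<^sup>+x. ennreal (std_normal_density x * x ^ (2 * k)) \<partial>lborel) =
      ennreal (fact (2 * k) / (2 ^ k * fact k))"
    by (subst nn_integral_eq_integral) (auto simp: integral_std_normal_moment_even integrable_std_normal_moment)
  finally show ?thesis
    using v by (simp add: v_def[symmetric] ennreal_mult[symmetric] mult.commute)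
qed

lemma has_wiener_integral_isometry:
  assumes W: "has_wiener_integral M B f Y"
  shows "(\<integral>\<^sup>+\<omega>. ennreal ((Y \<omega>)\<^sup>2) \<partial>M) = (\<integral>\<^sup>+u. ennreal ((f u)\<^sup>2) \<partial>lborel)"
proof -
  have "(\<integral>\<^sup>+\<omega>. ennreal ((Y \<omega>)\<^sup>2) \<partial>M) = ennreal (\<integral>u. (f u)\<^sup>2 \<partial>lborel)"
    using has_wiener_integral_moment[OF W, of 1] by simp
  also have "\<dots> = (\<integral>\<^sup>+u. ennreal ((f u)\<^sup>2) \<partial>lborel)"
    using has_wiener_integral_char(1)[OF W] by (intro nn_integral_eq_integral[symmetric]) auto
  finally show ?thesis .
qed

text \<open>After division by the standard deviation \<sigma> the event is an interval of length 2 K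
  / \<sigma>, and the standard normal density is at most 1. The crude constant is harmless, since
  only the decay in \<sigma> matters.\<close>

lemma has_wiener_integral_small_ball:
  assumes W: "has_wiener_integral M B f Y" and pos: "0 < (\<integral>u. (f u)\<^sup>2 \<partial>lborel)" and "0 \<le> K"
  shows "emeasure M {\<omega>\<in>space M. \<bar>Y \<omega>\<bar> \<le> K} \<le> ennreal (2 * K / sqrt (\<integral>u. (f u)\<^sup>2 \<partial>lborel))"
proof -
  note [measurable] = has_wiener_integral_measurable(2)[OF W]
  define v where "v = sqrt (\<integral>u. (f u)\<^sup>2 \<partial>lborel)"
  have v: "0 < v" using pos by (simp add: v_def)
  have "emeasure M {\<omega>\<in>space M. \<bar>Y \<omega>\<bar> \<le> K} = emeasure (distr M borel Y) {x. \<bar>x\<bar> \<le> K}"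
    by (simp add: emeasure_distr vimage_def Int_def conj_commute)
  also have "\<dots> = emeasure std_normal_distribution {x. \<bar>v * x\<bar> \<le> K}"
    unfolding has_wiener_integral_distr[OF W] v_def[symmetric] by (simp add: emeasure_distr vimage_def)
  also have "{x. \<bar>v * x\<bar> \<le> K} = {- (K / v)..K / v}"
    using v by (auto simp: abs_le_iff field_simps)
  also have "emeasure std_normal_distribution \<dots> =
      (\<integral>\<^sup>+x. ennreal (std_normal_density x) * indicator {- (K / v)..K / v} x \<partial>lborel)"
    by (simp add: emeasure_density)
  also have "\<dots> \<le> (\<integral>\<^sup>+x. 1 * indicator {- (K / v)..K / v} x \<partial>lborel)"
  proof (intro nn_integral_mono mult_right_mono)
    fix x :: real
    have "1 \<le> sqrt (2 * pi)"
      using pi_gt3 by (intro real_le_rsqrt) simp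
    then have "std_normal_density x \<le> 1 * 1"
      unfolding std_normal_density_def by (intro mult_mono) auto
    then show "ennreal (std_normal_density x) \<le> 1" by simp
  qed simp
  also have "\<dots> = ennreal (2 * K / v)"
    using v \<open>0 \<le> K\<close> by simp
  finally show ?thesis by (simp add: v_def)
qed

text \<open>The Y n may be dependent: the event that all Y n with n \<ge> m stay within k lies in
  every single small ball event, and the probabilities of these tend to 0. Restricting to integers k
  and m keeps the number of null sets countable.\<close>

lemma has_wiener_integral_unbounded:
  assumes W: "\<And>n. has_wiener_integral M B (f n) (Y n)"
    and lim: "filterlim (\<lambda>n. \<integral>u. (f n u)\<^sup>2 \<partial>lborel) at_top sequentially"
  shows "AE \<omega> in M. \<forall>K m. \<exists>n\<ge>m. K < \<bar>Y n \<omega>\<bar>"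
proof -
  note [measurable] = has_wiener_integral_measurable(2)[OF W]
  have "AE \<omega> in M. \<not> (\<forall>n\<ge>m. \<bar>Y n \<omega>\<bar> \<le> real k)" for k m :: nat
  proof (rule AE_I)
    let ?N = "{\<omega>\<in>space M. \<forall>n\<ge>m. \<bar>Y n \<omega>\<bar> \<le> real k}"
    show "{\<omega>\<in>space M. \<not> \<not> (\<forall>n\<ge>m. \<bar>Y n \<omega>\<bar> \<le> real k)} \<subseteq> ?N" by auto
    show "?N \<in> sets M" by measurable
    have "filterlim (\<lambda>n. sqrt (\<integral>u. (f n u)\<^sup>2 \<partial>lborel)) at_top sequentially"
      using sqrt_at_top lim by (rule filterlim_compose)
    then have "(\<lambda>n. ennreal (2 * real k / sqrt (\<integral>u. (f n u)\<^sup>2 \<partial>lborel))) \<longlonglongrightarrow> ennreal 0"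
      by (intro tendsto_ennrealI tendsto_divide_0[OF tendsto_const] filterlim_at_top_imp_at_infinity)
    moreover have "eventually (\<lambda>n. emeasure M ?N \<le> ennreal (2 * real k / sqrt (\<integral>u. (f n u)\<^sup>2 \<partial>lborel))) sequentially"
      using filterlim_at_top_dense[THEN iffD1, OF lim, rule_format, of 0] eventually_ge_at_top[of m]
    proof eventually_elim
      case (elim n)
      have "emeasure M ?N \<le> emeasure M {\<omega>\<in>space M. \<bar>Y n \<omega>\<bar> \<le> real k}"
        using elim by (intro emeasure_mono) auto
      also have "\<dots> \<le> ennreal (2 * real k / sqrt (\<integral>u. (f n u)\<^sup>2 \<partial>lborel))"
        using elim by (intro has_wiener_integral_small_ball W) auto
      finally show ?case .
    qed
    ultimately have "emeasure M ?N \<le> ennreal 0"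
      by (rule tendsto_lowerbound) simp
    then show "emeasure M ?N = 0" by simp
  qed
  then have "AE \<omega> in M. \<forall>k m. \<not> (\<forall>n\<ge>m. \<bar>Y n \<omega>\<bar> \<le> real k)"
    by (simp add: AE_all_countable)
  then show ?thesis
  proof eventually_elim
    fix \<omega> assume *: "\<forall>k m. \<not> (\<forall>n\<ge>m. \<bar>Y n \<omega>\<bar> \<le> real k)"
    show "\<forall>K m. \<exists>n\<ge>m. K < \<bar>Y n \<omega>\<bar>"
    proof (intro allI)
      fix K :: real and m :: nat
      obtain k :: nat where "K \<le> real k" using real_arch_simple by blast
      then show "\<exists>n\<ge>m. K < \<bar>Y n \<omega>\<bar>" using * by (meson le_less_trans not_le)
    qed
  qed
qed

lemma has_wiener_integral_cong_AE:
  assumes W: "has_wiener_integral M B f Y" and [measurable]: "Z \<in> borel_measurable M"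
    and eq: "AE \<omega> in M. Y \<omega> = Z \<omega>"
  shows "has_wiener_integral M B f Z"
proof -
  have "(\<integral>\<^sup>+\<omega>. ennreal ((simple_wiener_integral B s \<omega> - Y \<omega>)\<^sup>2) \<partial>M) =
      (\<integral>\<^sup>+\<omega>. ennreal ((simple_wiener_integral B s \<omega> - Z \<omega>)\<^sup>2) \<partial>M)" for s
    using eq by (intro nn_integral_cong_AE) auto
  with W show ?thesis by (simp add: has_wiener_integral_def)
qed

text \<open>The same linear combination of the two approximating sequences works. Simple integrals
  are linear only almost surely, which is enough because they enter through an integral over
  M.\<close>

lemma has_wiener_integral_lincomb:
  assumes W: "has_wiener_integral M B f Y" and V: "has_wiener_integral M B g Z"
  shows "has_wiener_integral M B (\<lambda>u. a * f u + b * g u) (\<lambda>\<omega>. a * Y \<omega> + b * Z \<omega>)"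
proof -
  note [measurable] = has_wiener_integral_measurable[OF W] has_wiener_integral_measurable[OF V]
  from W obtain s where s: "\<And>n. Bochner_Integration.simple_bochner_integrable lborel (s n)"
    and lim_s: "(\<lambda>n. \<integral>\<^sup>+u. ennreal ((s n u - f u)\<^sup>2) \<partial>lborel) \<longlonglongrightarrow> 0"
      "(\<lambda>n. \<integral>\<^sup>+\<omega>. ennreal ((simple_wiener_integral B (s n) \<omega> - Y \<omega>)\<^sup>2) \<partial>M) \<longlonglongrightarrow> 0"
    by (auto simp: has_wiener_integral_def)
  from V obtain t where t: "\<And>n. Bochner_Integration.simple_bochner_integrable lborel (t n)"
    and lim_t: "(\<lambda>n. \<integral>\<^sup>+u. ennreal ((t n u - g u)\<^sup>2) \<partial>lborel) \<longlonglongrightarrow> 0"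
      "(\<lambda>n. \<integral>\<^sup>+\<omega>. ennreal ((simple_wiener_integral B (t n) \<omega> - Z \<omega>)\<^sup>2) \<partial>M) \<longlonglongrightarrow> 0"
    by (auto simp: has_wiener_integral_def)
  note [measurable] = simple_bochner_integrable_lborelD(2)[OF s] simple_wiener_integral_measurable[OF s]
    simple_bochner_integrable_lborelD(2)[OF t] simple_wiener_integral_measurable[OF t]
  have lim: "(\<lambda>n. \<integral>\<^sup>+x. ennreal ((a * p n x + b * q n x - (a * p' x + b * q' x))\<^sup>2) \<partial>N) \<longlonglongrightarrow> 0"
    if [measurable]: "\<And>n. p n \<in> borel_measurable N" "\<And>n. q n \<in> borel_measurable N"
      "p' \<in> borel_measurable N" "q' \<in> borel_measurable N"
    and lim: "(\<lambda>n. \<integral>\<^sup>+x. ennreal ((p n x - p' x)\<^sup>2) \<partial>N) \<longlonglongrightarrow> 0"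
      "(\<lambda>n. \<integral>\<^sup>+x. ennreal ((q n x - q' x)\<^sup>2) \<partial>N) \<longlonglongrightarrow> 0"
    for N :: "'c measure" and p q :: "nat \<Rightarrow> 'c \<Rightarrow> real" and p' q'
  proof -
    have "(\<integral>\<^sup>+x. ennreal ((a * p n x + b * q n x - (a * p' x + b * q' x))\<^sup>2) \<partial>N) \<le>
        2 * (ennreal (a\<^sup>2) * (\<integral>\<^sup>+x. ennreal ((p n x - p' x)\<^sup>2) \<partial>N)) +
        2 * (ennreal (b\<^sup>2) * (\<integral>\<^sup>+x. ennreal ((q n x - q' x)\<^sup>2) \<partial>N))" for n
    proof -
      have *: "(\<integral>\<^sup>+x. ennreal ((c * F x)\<^sup>2) \<partial>N) = ennreal (c\<^sup>2) * (\<integral>\<^sup>+x. ennreal ((F x)\<^sup>2) \<partial>N)"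
        if [measurable]: "F \<in> borel_measurable N" for c and F :: "'c \<Rightarrow> real"
        by (simp add: power_mult_distrib ennreal_mult nn_integral_cmult)
      have "(\<integral>\<^sup>+x. ennreal ((a * p n x + b * q n x - (a * p' x + b * q' x))\<^sup>2) \<partial>N) \<le>
          2 * (\<integral>\<^sup>+x. ennreal ((a * p n x + b * q n x - (a * p' x + b * q n x))\<^sup>2) \<partial>N) +
          2 * (\<integral>\<^sup>+x. ennreal ((a * p' x + b * q n x - (a * p' x + b * q' x))\<^sup>2) \<partial>N)"
        by (rule nn_integral_power2_diff_le) auto
      then show ?thesis
        by (simp add: right_diff_distrib[symmetric] *)
    qed
    note bound = this
    have lim': "(\<lambda>n. 2 * (ennreal (a\<^sup>2) * (\<integral>\<^sup>+x. ennreal ((p n x - p' x)\<^sup>2) \<partial>N)) +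
        2 * (ennreal (b\<^sup>2) * (\<integral>\<^sup>+x. ennreal ((q n x - q' x)\<^sup>2) \<partial>N))) \<longlonglongrightarrow>
        2 * (ennreal (a\<^sup>2) * 0) + 2 * (ennreal (b\<^sup>2) * 0)"
      using lim by (intro tendsto_add ennreal_tendsto_cmult) auto
    show ?thesis
      by (rule tendsto_sandwich[OF _ _ tendsto_const lim'[simplified]]) (simp_all add: bound)
  qed
  have "(\<integral>\<^sup>+\<omega>. ennreal ((simple_wiener_integral B (\<lambda>u. a * s n u + b * t n u) \<omega> - (a * Y \<omega> + b * Z \<omega>))\<^sup>2) \<partial>M) =
      (\<integral>\<^sup>+\<omega>. ennreal ((a * simple_wiener_integral B (s n) \<omega> + b * simple_wiener_integral B (t n) \<omega> -
        (a * Y \<omega> + b * Z \<omega>))\<^sup>2) \<partial>M)" for n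
    using AE_simple_wiener_integral_lincomb[OF s[of n] t[of n], of a b] by (intro nn_integral_cong_AE) auto
  then have "(\<lambda>n. \<integral>\<^sup>+\<omega>. ennreal ((simple_wiener_integral B (\<lambda>u. a * s n u + b * t n u) \<omega> -
      (a * Y \<omega> + b * Z \<omega>))\<^sup>2) \<partial>M) \<longlonglongrightarrow> 0"
    using lim[OF _ _ _ _ lim_s(2) lim_t(2)] by simp
  moreover have "(\<lambda>n. \<integral>\<^sup>+u. ennreal ((a * s n u + b * t n u - (a * f u + b * g u))\<^sup>2) \<partial>lborel) \<longlonglongrightarrow> 0"
    using lim[OF _ _ _ _ lim_s(1) lim_t(1)] by simp
  ultimately show ?thesis
    using simple_bochner_integrable_lincomb[OF s t]
    unfolding has_wiener_integral_def by (intro conjI exI[of _ "\<lambda>n u. a * s n u + b * t n u"]) auto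
qed

text \<open>By the isometry the Y n form a Cauchy sequence in mean square, and Fatou's lemma carries
  the bound over to the almost sure limit. A diagonal choice then supplies simple functions that
  serve f' and Y' at once.\<close>

lemma has_wiener_integral_limit:
  assumes W: "\<And>n. has_wiener_integral M B (f n) (Y n)"
    and [measurable]: "f' \<in> borel_measurable borel" "Y' \<in> borel_measurable M"
    and lim: "(\<lambda>n. \<integral>\<^sup>+u. ennreal ((f n u - f' u)\<^sup>2) \<partial>lborel) \<longlonglongrightarrow> 0"
    and ae: "AE \<omega> in M. (\<lambda>n. Y n \<omega>) \<longlonglongrightarrow> Y' \<omega>"
  shows "has_wiener_integral M B f' Y'"
proof -
  note [measurable] = has_wiener_integral_measurable[OF W]
  define d where "d n = (\<integral>\<^sup>+u. ennreal ((f n u - f' u)\<^sup>2) \<partial>lborel)" for n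
  have d: "d \<longlonglongrightarrow> 0" using lim by (simp add: d_def[abs_def])
  have iso: "(\<integral>\<^sup>+\<omega>. ennreal ((Y n \<omega> - Y m \<omega>)\<^sup>2) \<partial>M) \<le> 2 * d n + 2 * d m" for n m
  proof -
    have "(\<integral>\<^sup>+\<omega>. ennreal ((Y n \<omega> - Y m \<omega>)\<^sup>2) \<partial>M) = (\<integral>\<^sup>+u. ennreal ((f n u - f m u)\<^sup>2) \<partial>lborel)"
      using has_wiener_integral_isometry[OF has_wiener_integral_lincomb[OF W W, of 1 n "-1" m]] by simp
    also have "\<dots> \<le> 2 * (\<integral>\<^sup>+u. ennreal ((f n u - f' u)\<^sup>2) \<partial>lborel) + 2 * (\<integral>\<^sup>+u. ennreal ((f' u - f m u)\<^sup>2) \<partial>lborel)"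
      by (rule nn_integral_power2_diff_le) auto
    finally show ?thesis by (simp add: d_def power2_commute)
  qed
  have bound: "(\<integral>\<^sup>+\<omega>. ennreal ((Y n \<omega> - Y' \<omega>)\<^sup>2) \<partial>M) \<le> 2 * d n" for n
  proof -
    have "(\<integral>\<^sup>+\<omega>. ennreal ((Y n \<omega> - Y' \<omega>)\<^sup>2) \<partial>M) =
        (\<integral>\<^sup>+\<omega>. liminf (\<lambda>m. ennreal ((Y n \<omega> - Y m \<omega>)\<^sup>2)) \<partial>M)"
    proof (intro nn_integral_cong_AE, use ae in eventually_elim)
      fix \<omega> assume "(\<lambda>n. Y n \<omega>) \<longlonglongrightarrow> Y' \<omega>"
      then have "(\<lambda>m. ennreal ((Y n \<omega> - Y m \<omega>)\<^sup>2)) \<longlonglongrightarrow> ennreal ((Y n \<omega> - Y' \<omega>)\<^sup>2)"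
        by (intro tendsto_intros)
      then show "ennreal ((Y n \<omega> - Y' \<omega>)\<^sup>2) = liminf (\<lambda>m. ennreal ((Y n \<omega> - Y m \<omega>)\<^sup>2))"
        by (intro lim_imp_Liminf[symmetric]) auto
    qed
    also have "\<dots> \<le> liminf (\<lambda>m. \<integral>\<^sup>+\<omega>. ennreal ((Y n \<omega> - Y m \<omega>)\<^sup>2) \<partial>M)"
      by (rule nn_integral_liminf) auto
    also have "\<dots> \<le> liminf (\<lambda>m. 2 * d n + 2 * d m)"
      by (intro Liminf_mono always_eventually allI iso)
    also have "\<dots> = 2 * d n + 2 * 0"
      using d by (intro lim_imp_Liminf tendsto_add tendsto_const ennreal_tendsto_cmult) auto
    finally show ?thesis by simp
  qed
  \<comment> \<open>One simple function has to approximate both \<open>f n\<close> and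
    \<open>Y n\<close>, here up to 1 / (n + 1), because the definition of the integral couples the
    two limits through a common sequence.\<close>
  define Q where "Q n s \<longleftrightarrow> Bochner_Integration.simple_bochner_integrable lborel s \<and>
      (\<integral>\<^sup>+u. ennreal ((s u - f n u)\<^sup>2) \<partial>lborel) < ennreal (1 / real (Suc n)) \<and>
      (\<integral>\<^sup>+\<omega>. ennreal ((simple_wiener_integral B s \<omega> - Y n \<omega>)\<^sup>2) \<partial>M) < ennreal (1 / real (Suc n))" for n s
  have "\<exists>s. Q n s" for n
  proof -
    from W[of n] obtain s where s: "\<And>k. Bochner_Integration.simple_bochner_integrable lborel (s k)"
      and l: "(\<lambda>k. \<integral>\<^sup>+u. ennreal ((s k u - f n u)\<^sup>2) \<partial>lborel) \<longlonglongrightarrow> 0"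
        "(\<lambda>k. \<integral>\<^sup>+\<omega>. ennreal ((simple_wiener_integral B (s k) \<omega> - Y n \<omega>)\<^sup>2) \<partial>M) \<longlonglongrightarrow> 0"
      by (auto simp: has_wiener_integral_def)
    have "eventually (\<lambda>k. (\<integral>\<^sup>+u. ennreal ((s k u - f n u)\<^sup>2) \<partial>lborel) < ennreal (1 / real (Suc n)) \<and>
      (\<integral>\<^sup>+\<omega>. ennreal ((simple_wiener_integral B (s k) \<omega> - Y n \<omega>)\<^sup>2) \<partial>M) < ennreal (1 / real (Suc n))) sequentially"
      using l by (intro eventually_conj order_tendstoD(2)) auto
    then show ?thesis using s by (auto simp: eventually_sequentially Q_def)
  qed
  then obtain s where "\<And>n. Q n (s n)"
    using choice[of Q] by blast
  then have s: "\<And>n. Bochner_Integration.simple_bochner_integrable lborel (s n)"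
    and sf: "\<And>n. (\<integral>\<^sup>+u. ennreal ((s n u - f n u)\<^sup>2) \<partial>lborel) < ennreal (1 / real (Suc n))"
    and sY: "\<And>n. (\<integral>\<^sup>+\<omega>. ennreal ((simple_wiener_integral B (s n) \<omega> - Y n \<omega>)\<^sup>2) \<partial>M) < ennreal (1 / real (Suc n))"
    unfolding Q_def by blast+
  note [measurable] = simple_bochner_integrable_lborelD(2)[OF s] simple_wiener_integral_measurable[OF s]
  have "(\<lambda>n. 2 * ennreal (1 / real (Suc n)) + 2 * (2 * d n)) \<longlonglongrightarrow> 2 * ennreal 0 + 2 * (2 * 0)"
    using d by (intro tendsto_add ennreal_tendsto_cmult tendsto_ennrealI LIMSEQ_Suc[OF lim_1_over_n]) auto
  then have lim0: "(\<lambda>n. 2 * ennreal (1 / real (Suc n)) + 2 * (2 * d n)) \<longlonglongrightarrow> 0" by simp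
  have "(\<lambda>n. \<integral>\<^sup>+u. ennreal ((s n u - f' u)\<^sup>2) \<partial>lborel) \<longlonglongrightarrow> 0"
  proof (rule tendsto_sandwich[OF _ _ tendsto_const lim0])
    have "(\<integral>\<^sup>+u. ennreal ((s n u - f' u)\<^sup>2) \<partial>lborel) \<le> 2 * ennreal (1 / real (Suc n)) + 2 * (2 * d n)" for n
    proof -
      have "(\<integral>\<^sup>+u. ennreal ((s n u - f' u)\<^sup>2) \<partial>lborel) \<le>
          2 * (\<integral>\<^sup>+u. ennreal ((s n u - f n u)\<^sup>2) \<partial>lborel) + 2 * d n"
        unfolding d_def by (rule nn_integral_power2_diff_le) auto
      also have "\<dots> \<le> 2 * ennreal (1 / real (Suc n)) + 2 * (2 * d n)"
        using sf[of n] by (intro add_mono mult_left_mono) (auto intro: less_imp_le simp: mult_2)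
      finally show ?thesis .
    qed
    then show "\<forall>\<^sub>F n in sequentially. (\<integral>\<^sup>+u. ennreal ((s n u - f' u)\<^sup>2) \<partial>lborel) \<le>
        2 * ennreal (1 / real (Suc n)) + 2 * (2 * d n)" by simp
  qed simp
  moreover have "(\<lambda>n. \<integral>\<^sup>+\<omega>. ennreal ((simple_wiener_integral B (s n) \<omega> - Y' \<omega>)\<^sup>2) \<partial>M) \<longlonglongrightarrow> 0"
  proof (rule tendsto_sandwich[OF _ _ tendsto_const lim0])
    have "(\<integral>\<^sup>+\<omega>. ennreal ((simple_wiener_integral B (s n) \<omega> - Y' \<omega>)\<^sup>2) \<partial>M) \<le>
        2 * ennreal (1 / real (Suc n)) + 2 * (2 * d n)" for n
    proof -
      have "(\<integral>\<^sup>+\<omega>. ennreal ((simple_wiener_integral B (s n) \<omega> - Y' \<omega>)\<^sup>2) \<partial>M) \<le>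
          2 * (\<integral>\<^sup>+\<omega>. ennreal ((simple_wiener_integral B (s n) \<omega> - Y n \<omega>)\<^sup>2) \<partial>M) +
          2 * (\<integral>\<^sup>+\<omega>. ennreal ((Y n \<omega> - Y' \<omega>)\<^sup>2) \<partial>M)"
        by (rule nn_integral_power2_diff_le) auto
      also have "\<dots> \<le> 2 * ennreal (1 / real (Suc n)) + 2 * (2 * d n)"
        using sY[of n] bound[of n] by (intro add_mono mult_left_mono) (auto intro: less_imp_le)
      finally show ?thesis .
    qed
    then show "\<forall>\<^sub>F n in sequentially. (\<integral>\<^sup>+\<omega>. ennreal ((simple_wiener_integral B (s n) \<omega> - Y' \<omega>)\<^sup>2) \<partial>M) \<le>
        2 * ennreal (1 / real (Suc n)) + 2 * (2 * d n)" by simp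
  qed simp
  ultimately show ?thesis
    unfolding has_wiener_integral_def using s by (intro conjI exI[of _ s]) auto
qed

end

section \<open>Continuous differentiability from dyadic second differences\<close>

text \<open>Both end points of the increment move, as in strict differentiability, and this is what
  makes the derivative continuous. The slope L may depend on e, so the derivative has to be built as
  a limit of slopes.\<close>

lemma C1_if_strictly_differentiable:
  fixes f :: "real \<Rightarrow> real"
  assumes H: "\<And>x e. x \<in> U \<Longrightarrow> 0 < e \<Longrightarrow>
    \<exists>d>0. \<exists>L. \<forall>s t. x - d < s \<and> s < t \<and> t < x + d \<longrightarrow> \<bar>f t - f s - L * (t - s)\<bar> \<le> e * (t - s)"
  shows "\<exists>f'. (\<forall>x\<in>U. (f has_real_derivative f' x) (at x)) \<and> continuous_on U f'"
proof -
  \<comment> \<open>Two slopes that approximate f near a common point y can be tested on the same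
    short interval [y, z], so they differ by at most the sum of the two tolerances.\<close>
  have compare: "\<bar>L1 - L2\<bar> \<le> e1 + e2"
    if "\<And>s t. x1 - d1 < s \<Longrightarrow> s < t \<Longrightarrow> t < x1 + d1 \<Longrightarrow> \<bar>f t - f s - L1 * (t - s)\<bar> \<le> e1 * (t - s)"
      and "\<And>s t. x2 - d2 < s \<Longrightarrow> s < t \<Longrightarrow> t < x2 + d2 \<Longrightarrow> \<bar>f t - f s - L2 * (t - s)\<bar> \<le> e2 * (t - s)"
      and "x1 - d1 < y" "y < x1 + d1" "x2 - d2 < y" "y < x2 + d2"
    for x1 x2 d1 d2 L1 L2 e1 e2 y
  proof -
    define z where "z = (y + min (x1 + d1) (x2 + d2)) / 2"
    have z: "y < z" "z < x1 + d1" "z < x2 + d2"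
      using that(3-6) by (auto simp: z_def min_def)
    have "\<bar>f z - f y - L1 * (z - y)\<bar> \<le> e1 * (z - y)" "\<bar>f z - f y - L2 * (z - y)\<bar> \<le> e2 * (z - y)"
      using that z by auto
    then have "\<bar>(f z - f y - L2 * (z - y)) - (f z - f y - L1 * (z - y))\<bar> \<le> e1 * (z - y) + e2 * (z - y)"
      by linarith
    moreover have "(f z - f y - L2 * (z - y)) - (f z - f y - L1 * (z - y)) = (L1 - L2) * (z - y)"
      by (simp add: algebra_simps)
    ultimately have "\<bar>L1 - L2\<bar> * (z - y) \<le> (e1 + e2) * (z - y)"
      using z by (simp only: abs_mult distrib_right)
    then show ?thesis using z by simp
  qed
  have "\<exists>D. \<forall>e>0. \<exists>d>0. \<forall>s t. x - d < s \<longrightarrow> s < t \<longrightarrow> t < x + d \<longrightarrow> \<bar>f t - f s - D * (t - s)\<bar> \<le> e * (t - s)"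
    if x: "x \<in> U" for x
  proof -
    define Q where "Q e d L \<longleftrightarrow> 0 < d \<and>
      (\<forall>s t. x - d < s \<longrightarrow> s < t \<longrightarrow> t < x + d \<longrightarrow> \<bar>f t - f s - L * (t - s)\<bar> \<le> e * (t - s))" for e d L
    \<comment> \<open>The slopes for the tolerances 1 / (n + 1) are compared with each other at x
      itself, which makes them a Cauchy sequence.\<close>
    have "\<exists>d L. Q (1 / real (Suc n)) d L" for n
      using H[OF x, of "1 / real (Suc n)"] by (fastforce simp: Q_def)
    then obtain d L where Q: "\<And>n. Q (1 / real (Suc n)) (d n) (L n)"
      by metis
    have cmp: "\<bar>L n - L m\<bar> \<le> 1 / real (Suc n) + 1 / real (Suc m)" for n m
      using Q[of n] Q[of m] unfolding Q_def
      by (intro compare[of x "d n" "L n" _ x "d m" "L m" _ x]) auto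
    have "Cauchy L"
    proof (rule metric_CauchyI)
      fix e :: real assume "0 < e"
      then obtain N where N: "1 / real (Suc N) < e / 2"
        using reals_Archimedean[of "e / 2"] by (auto simp: inverse_eq_divide)
      have "dist (L m) (L n) < e" if "N \<le> m" "N \<le> n" for m n
      proof -
        have "1 / real (Suc m) \<le> 1 / real (Suc N)" "1 / real (Suc n) \<le> 1 / real (Suc N)"
          using that by (auto intro!: divide_left_mono)
        then show ?thesis using cmp[of m n] N unfolding dist_real_def by linarith
      qed
      then show "\<exists>N. \<forall>m\<ge>N. \<forall>n\<ge>N. dist (L m) (L n) < e" by blast
    qed
    then obtain D where D: "L \<longlonglongrightarrow> D"
      by (auto simp: Cauchy_convergent_iff convergent_def)
    have LD: "\<bar>L n - D\<bar> \<le> 1 / real (Suc n)" for n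
    proof -
      have "(\<lambda>m. \<bar>L n - L m\<bar>) \<longlonglongrightarrow> \<bar>L n - D\<bar>" using D by (intro tendsto_intros)
      moreover have "(\<lambda>m. 1 / real (Suc n) + 1 / real (Suc m)) \<longlonglongrightarrow> 1 / real (Suc n) + 0"
        by (intro tendsto_intros LIMSEQ_Suc[OF lim_1_over_n])
      ultimately show ?thesis
        using cmp[of n] by (intro LIMSEQ_le[where Y = "\<lambda>m. 1 / real (Suc n) + 1 / real (Suc m)"]) auto
    qed
    have "\<exists>d>0. \<forall>s t. x - d < s \<longrightarrow> s < t \<longrightarrow> t < x + d \<longrightarrow> \<bar>f t - f s - D * (t - s)\<bar> \<le> e * (t - s)"
      if "0 < e" for e
    proof -
      obtain n where n: "1 / real (Suc n) < e / 2"
        using reals_Archimedean[of "e / 2"] \<open>0 < e\<close> by (auto simp: inverse_eq_divide)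
      have "\<bar>f t - f s - D * (t - s)\<bar> \<le> e * (t - s)" if "x - d n < s" "s < t" "t < x + d n" for s t
      proof -
        have "\<bar>f t - f s - L n * (t - s)\<bar> \<le> 1 / real (Suc n) * (t - s)"
          using Q[of n] that by (auto simp: Q_def)
        moreover have "\<bar>(L n - D) * (t - s)\<bar> \<le> 1 / real (Suc n) * (t - s)"
          using mult_right_mono[OF LD[of n], of "t - s"] that by (simp add: abs_mult)
        moreover have "f t - f s - D * (t - s) = (f t - f s - L n * (t - s)) + (L n - D) * (t - s)"
          by (simp add: algebra_simps)
        ultimately have "\<bar>f t - f s - D * (t - s)\<bar> \<le> 2 * (1 / real (Suc n)) * (t - s)"
          by linarith
        also have "\<dots> \<le> e * (t - s)"
          using n that by (intro mult_right_mono) auto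
        finally show ?thesis .
      qed
      then show ?thesis using Q[of n] by (auto simp: Q_def)
    qed
    then show ?thesis by blast
  qed
  then obtain D where D: "\<And>x e. x \<in> U \<Longrightarrow> 0 < e \<Longrightarrow>
    \<exists>d>0. \<forall>s t. x - d < s \<longrightarrow> s < t \<longrightarrow> t < x + d \<longrightarrow> \<bar>f t - f s - D x * (t - s)\<bar> \<le> e * (t - s)"
    by metis
  have "(f has_real_derivative D x) (at x)" if x: "x \<in> U" for x
    unfolding DERIV_def
  proof (rule LIM_I)
    fix r :: real assume r: "0 < r"
    obtain d where d: "0 < d" and *: "\<And>s t. x - d < s \<Longrightarrow> s < t \<Longrightarrow> t < x + d \<Longrightarrow>
        \<bar>f t - f s - D x * (t - s)\<bar> \<le> r / 2 * (t - s)"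
      using D[OF x, of "r / 2"] r by auto
    have "\<bar>(f (x + h) - f x) / h - D x\<bar> < r" if h: "h \<noteq> 0" "\<bar>h\<bar> < d" for h
    proof -
      have "\<bar>f (x + h) - f x - D x * h\<bar> \<le> r / 2 * \<bar>h\<bar>"
        using h *[of x "x + h"] *[of "x + h" x] by (cases "0 < h") (auto simp: abs_minus_commute algebra_simps)
      moreover have "(f (x + h) - f x) / h - D x = (f (x + h) - f x - D x * h) / h"
        using h by (simp add: field_simps)
      ultimately have "\<bar>(f (x + h) - f x) / h - D x\<bar> \<le> r / 2"
        using h by (simp add: abs_divide divide_le_eq)
      then show ?thesis using r by linarith
    qed
    then show "\<exists>s>0. \<forall>h. h \<noteq> 0 \<and> norm (h - 0) < s \<longrightarrow> norm ((f (x + h) - f x) / h - D x) < r"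
      using d by auto
  qed
  moreover have "continuous_on U D"
    unfolding continuous_on_iff
  proof (intro ballI allI impI)
    fix x e assume x: "x \<in> U" and e: "0 < (e::real)"
    obtain d where d: "0 < d" and *: "\<And>s t. x - d < s \<Longrightarrow> s < t \<Longrightarrow> t < x + d \<Longrightarrow>
        \<bar>f t - f s - D x * (t - s)\<bar> \<le> e / 4 * (t - s)"
      using D[OF x, of "e / 4"] e by auto
    have "dist (D y) (D x) < e" if y: "y \<in> U" "dist y x < d" for y
    proof -
      obtain d' where d': "0 < d'" and **: "\<And>s t. y - d' < s \<Longrightarrow> s < t \<Longrightarrow> t < y + d' \<Longrightarrow>
          \<bar>f t - f s - D y * (t - s)\<bar> \<le> e / 4 * (t - s)"
        using D[OF y(1), of "e / 4"] e by auto
      \<comment> \<open>The window around x also contains y, so the slopes belonging to x and y can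
        be compared at the point y.\<close>
      have "\<bar>D y - D x\<bar> \<le> e / 4 + e / 4"
        using ** * by (rule compare[of y d' "D y" _ x d "D x" _ y]) (use d' y in \<open>auto simp: dist_real_def\<close>)
      then show ?thesis using e by (simp add: dist_real_def)
    qed
    then show "\<exists>d>0. \<forall>x'\<in>U. dist x' x < d \<longrightarrow> dist (D x') (D x) < e" using d by blast
  qed
  ultimately show ?thesis by blast
qed

text \<open>Slopes over dyadic cells change by at most \<open>\<delta> n\<close> between neighbours of level \<open>n\<close> and between a
  cell of level \<open>n\<close> and its parent, so all slopes within two adjacent cells of level \<open>m\<close> agree up to
  a tail of \<open>\<Sum>n. \<delta> n\<close>.\<close>

lemma C1_if_dyadic_second_differences:
  fixes f :: "real \<Rightarrow> real" and \<delta> :: "nat \<Rightarrow> real"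
  assumes cont: "continuous_on {a<..<b} f" and "0 \<le> a"
    and \<delta>: "summable \<delta>" "\<And>n. 0 \<le> \<delta> n"
    and second: "\<And>n i::nat. N \<le> n \<Longrightarrow> a < real i / 2 ^ n \<Longrightarrow> real (i + 2) / 2 ^ n < b \<Longrightarrow>
      2 ^ n * \<bar>f (real (i + 2) / 2 ^ n) - 2 * f (real (i + 1) / 2 ^ n) + f (real i / 2 ^ n)\<bar> \<le> \<delta> n"
  shows "\<exists>f'. (\<forall>x\<in>{a<..<b}. (f has_real_derivative f' x) (at x)) \<and> continuous_on {a<..<b} f'"
proof (rule C1_if_strictly_differentiable)
  fix x e :: real assume x: "x \<in> {a<..<b}" and e: "0 < e"
  define D where "D n i = 2 ^ n * (f (real (i + 1) / 2 ^ n) - f (real i / 2 ^ n))" for n i :: nat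
  have neighbour: "\<bar>D n (i + 1) - D n i\<bar> \<le> \<delta> n"
    if "N \<le> n" "a < real i / 2 ^ n" "real (i + 2) / 2 ^ n < b" for n i
  proof -
    have "D n (i + 1) - D n i =
        2 ^ n * (f (real (i + 2) / 2 ^ n) - 2 * f (real (i + 1) / 2 ^ n) + f (real i / 2 ^ n))"
      by (simp add: D_def algebra_simps)
    then show ?thesis using second[OF that] by (simp add: abs_mult)
  qed
  \<comment> \<open>The slope over a parent cell is the mean of the slopes over its two halves, so
    each half deviates from it by half of the difference between the halves.\<close>
  have child: "\<bar>D (Suc n) i - D n (i div 2)\<bar> \<le> \<delta> (Suc n)"
    if "N \<le> n" "a < real (i div 2) / 2 ^ n" "real (i div 2 + 1) / 2 ^ n < b" for n i
  proof -
    define k where "k = i div 2"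
    have k0: "real (2 * k) / 2 ^ Suc n = real k / 2 ^ n" and k2: "real (2 * k + 2) / 2 ^ Suc n = real (k + 1) / 2 ^ n"
      by (auto simp: field_simps)
    have avg: "D n k = (D (Suc n) (2 * k) + D (Suc n) (2 * k + 1)) / 2"
      using k0 k2 by (simp add: D_def algebra_simps)
    have nb: "\<bar>D (Suc n) (2 * k + 1) - D (Suc n) (2 * k)\<bar> \<le> \<delta> (Suc n)"
      using that unfolding k_def[symmetric] k0[symmetric] k2[symmetric] by (intro neighbour) auto
    have "i = 2 * k \<or> i = 2 * k + 1" by (auto simp: k_def)
    then show ?thesis
      using nb unfolding k_def[symmetric] avg by (elim disjE) (simp_all add: abs_le_iff field_simps)
  qed
  \<comment> \<open>The bounds on i say that cell i of level m + p lies in the union of the cells j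
    and j + 1 of level m. The term \<delta> m pays for passing from j + 1 to j, and each further
    level for one passage to the parent.\<close>
  have descend: "\<bar>D (m + p) i - D m j\<bar> \<le> (\<Sum>k=m..m + p. \<delta> k)"
    if "N \<le> m" "a < real j / 2 ^ m" "real (j + 2) / 2 ^ m < b" "j * 2 ^ p \<le> i" "i < (j + 2) * 2 ^ p"
    for m p i j
    using that(4,5)
  proof (induction p arbitrary: i)
    case 0
    then have "i = j \<or> i = j + 1" by auto
    then show ?case using neighbour[OF that(1-3)] \<delta>(2)[of m] by auto
  next
    case (Suc p)
    define k where "k = i div 2"
    have k: "j * 2 ^ p \<le> k" "k < (j + 2) * 2 ^ p"
      using Suc.prems by (auto simp: k_def less_mult_imp_div_less mult.assoc mult.commute[of 2])
    have "real (j * 2 ^ p) \<le> real k" "real (k + 1) \<le> real ((j + 2) * 2 ^ p)"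
      using k by (simp_all only: of_nat_le_iff)
    then have k': "real j / 2 ^ m \<le> real k / 2 ^ (m + p)" "real (k + 1) / 2 ^ (m + p) \<le> real (j + 2) / 2 ^ m"
      using mult_left_mono[of "real (k + 1)" "real ((j + 2) * 2 ^ p)" "2 ^ m"]
      by (auto simp: power_add field_simps)
    have "\<bar>D (Suc (m + p)) i - D (m + p) k\<bar> \<le> \<delta> (Suc (m + p))"
      unfolding k_def using k' that by (intro child) (auto simp: k_def)
    moreover have "\<bar>D (m + p) k - D m j\<bar> \<le> (\<Sum>k=m..m + p. \<delta> k)"
      by (rule Suc.IH[OF k])
    ultimately show ?case by simp
  qed
  obtain N' where N': "\<And>m n. N' \<le> m \<Longrightarrow> norm (\<Sum>k=m..n. \<delta> k) < e"
    using summable_partial_sum_bound[OF \<delta>(1) e] by blast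
  \<comment> \<open>With cell length below r, four cells of level m fit between x and either end of
    the interval, which leaves room for the two cells around x.\<close>
  define r where "r = min (x - a) (b - x) / 4"
  have r: "0 < r" using x by (simp add: r_def)
  obtain m0 where m0: "(1 / 2) ^ m0 < r"
    using real_arch_pow_inv[OF r, of "1 / 2"] by auto
  define m where "m = max m0 (max N N')"
  have "(1 / 2 :: real) ^ m \<le> (1 / 2) ^ m0"
    by (rule power_decreasing) (auto simp: m_def)
  with m0 have m: "1 / 2 ^ m < r" by (simp add: power_divide)
  then have mx: "4 / 2 ^ m < x - a" "4 / 2 ^ m < b - x"
    by (auto simp: r_def)
  then have mx': "4 < 2 ^ m * (x - a)" "4 < 2 ^ m * (b - x)"
    by (auto simp: field_simps)
  \<comment> \<open>The shift by 1/2 keeps x at least half a cell away from both ends of the union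
    of the cells j and j + 1; this yields the window of radius half a cell used at the end.\<close>
  define j where "j = nat \<lfloor>2 ^ m * x - 1 / 2\<rfloor>"
  have "0 \<le> 2 ^ m * a" using \<open>0 \<le> a\<close> by simp
  then have "0 \<le> \<lfloor>2 ^ m * x - 1 / 2\<rfloor>"
    using mx' by (simp add: algebra_simps)
  then have j: "real j \<le> 2 ^ m * x - 1 / 2" "2 ^ m * x - 1 / 2 < real j + 1"
    unfolding j_def by (auto simp: of_nat_nat)
  have ja: "a < real j / 2 ^ m" and jb: "real (j + 2) / 2 ^ m < b"
    using j mx' by (auto simp: field_simps)
  define L where "L = D m j"
  have slope: "\<bar>D (m + p) i - L\<bar> \<le> e" if "j * 2 ^ p \<le> i" "i < (j + 2) * 2 ^ p" for p i
  proof -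
    have "\<bar>D (m + p) i - L\<bar> \<le> (\<Sum>k=m..m + p. \<delta> k)"
      unfolding L_def using ja jb that by (intro descend) (auto simp: m_def)
    also have "\<dots> \<le> e"
    proof -
      have "N' \<le> m" by (simp add: m_def)
      from N'[OF this, of "m + p"] show ?thesis by (simp add: abs_less_iff)
    qed
    finally show ?thesis .
  qed
  \<comment> \<open>The increment telescopes over the cells between u and v. Each cell contributes
    an error of e times its own length, so the errors add up to e times the total length.\<close>
  have dyadic: "\<bar>f (real v / 2 ^ (m + p)) - f (real u / 2 ^ (m + p)) - L * (real v / 2 ^ (m + p) - real u / 2 ^ (m + p))\<bar>
      \<le> e * (real v / 2 ^ (m + p) - real u / 2 ^ (m + p))"
    if "u \<le> v" "j * 2 ^ p \<le> u" "v \<le> (j + 2) * 2 ^ p" for u v p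
    using that
  proof (induction v rule: dec_induct)
    case base
    show ?case by simp
  next
    case (step v)
    let ?h = "1 / 2 ^ (m + p) :: real"
    have 1: "real (Suc v) / 2 ^ (m + p) - real v / 2 ^ (m + p) = ?h"
      by (simp add: field_simps)
    have "f (real (Suc v) / 2 ^ (m + p)) - f (real v / 2 ^ (m + p)) - L * ?h = (D (m + p) v - L) * ?h"
      by (simp add: D_def field_simps)
    moreover have "\<bar>(D (m + p) v - L) * ?h\<bar> \<le> e * ?h"
      unfolding abs_mult using slope[of p v] step by (intro mult_mono) auto
    moreover have "\<bar>f (real v / 2 ^ (m + p)) - f (real u / 2 ^ (m + p)) - L * (real v / 2 ^ (m + p) - real u / 2 ^ (m + p))\<bar>
      \<le> e * (real v / 2 ^ (m + p) - real u / 2 ^ (m + p))"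
      using step by auto
    moreover have "L * (real (Suc v) / 2 ^ (m + p) - real u / 2 ^ (m + p)) =
        L * ?h + L * (real v / 2 ^ (m + p) - real u / 2 ^ (m + p))"
      "e * (real (Suc v) / 2 ^ (m + p) - real u / 2 ^ (m + p)) =
        e * ?h + e * (real v / 2 ^ (m + p) - real u / 2 ^ (m + p))"
      using 1 by (simp_all add: algebra_simps add_divide_distrib)
    ultimately show ?case by linarith
  qed
  have main: "\<bar>f t - f s - L * (t - s)\<bar> \<le> e * (t - s)"
    if st: "real j / 2 ^ m \<le> s" "s < t" "t \<le> real (j + 2) / 2 ^ m" for s t
  proof -
    \<comment> \<open>Dyadic points approach s from the right and t from the left, so they never
      leave the two cells; continuity of f then carries the dyadic estimate over to s and t.\<close>
    define u where "u p = nat \<lceil>2 ^ (m + p) * s\<rceil>" for p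
    define v where "v p = nat \<lfloor>2 ^ (m + p) * t\<rfloor>" for p
    have sp: "0 < s" using st(1) ja \<open>0 \<le> a\<close> by linarith
    have u: "2 ^ (m + p) * s \<le> real (u p)" "real (u p) < 2 ^ (m + p) * s + 1" for p
      using sp ceiling_correct[of "2 ^ (m + p) * s"] unfolding u_def by (auto simp: of_nat_nat)
    have v: "real (v p) \<le> 2 ^ (m + p) * t" "2 ^ (m + p) * t - 1 < real (v p)" for p
      using sp st(2) unfolding v_def by (auto simp: of_nat_nat)
    have h0: "(\<lambda>p. 1 / 2 ^ (m + p)) \<longlonglongrightarrow> (0::real)"
      using LIMSEQ_ignore_initial_segment[OF LIMSEQ_power_zero[of "1 / 2 :: real"], of m]
      by (simp add: power_divide add.commute)
    have "(\<lambda>p. s + 1 / 2 ^ (m + p)) \<longlonglongrightarrow> s + 0" "(\<lambda>p. t - 1 / 2 ^ (m + p)) \<longlonglongrightarrow> t - 0"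
      by (intro tendsto_intros h0)+
    then have lims: "(\<lambda>p. s + 1 / 2 ^ (m + p)) \<longlonglongrightarrow> s" "(\<lambda>p. t - 1 / 2 ^ (m + p)) \<longlonglongrightarrow> t" by simp_all
    have ubd: "s \<le> real (u p) / 2 ^ (m + p)" "real (u p) / 2 ^ (m + p) \<le> s + 1 / 2 ^ (m + p)" for p
      using u[of p] by (auto simp: field_simps)
    have ul: "(\<lambda>p. real (u p) / 2 ^ (m + p)) \<longlonglongrightarrow> s"
      using ubd by (intro tendsto_sandwich[OF _ _ tendsto_const lims(1)]) auto
    have vbd: "real (v p) / 2 ^ (m + p) \<le> t" "t - 1 / 2 ^ (m + p) \<le> real (v p) / 2 ^ (m + p)" for p
      using divide_right_mono[OF less_imp_le[OF v(2)[of p]], of "2 ^ (m + p)"] v(1)[of p]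
      by (auto simp: diff_divide_distrib divide_le_eq mult.commute)
    have vl: "(\<lambda>p. real (v p) / 2 ^ (m + p)) \<longlonglongrightarrow> t"
      using vbd by (intro tendsto_sandwich[OF _ _ lims(2) tendsto_const]) auto
    have "isCont f s" "isCont f t"
      using cont st ja jb by (auto simp: continuous_on_eq_continuous_at)
    then have fl: "(\<lambda>p. f (real (u p) / 2 ^ (m + p))) \<longlonglongrightarrow> f s" "(\<lambda>p. f (real (v p) / 2 ^ (m + p))) \<longlonglongrightarrow> f t"
      using ul vl by (auto intro: isCont_tendsto_compose)
    have "eventually (\<lambda>p. 1 / 2 ^ (m + p) < (t - s) / 2) sequentially"
      using h0 by (rule order_tendstoD) (use st in simp)
    then have "eventually (\<lambda>p. \<bar>f (real (v p) / 2 ^ (m + p)) - f (real (u p) / 2 ^ (m + p)) -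
        L * (real (v p) / 2 ^ (m + p) - real (u p) / 2 ^ (m + p))\<bar>
      \<le> e * (real (v p) / 2 ^ (m + p) - real (u p) / 2 ^ (m + p))) sequentially"
    proof eventually_elim
      case (elim p)
      have "real (u p) / 2 ^ (m + p) \<le> real (v p) / 2 ^ (m + p)"
      proof -
        have "A \<le> C" if "A \<le> s + h" "t - h \<le> C" "h < (t - s) / 2" for A C h
          using that by (simp add: field_simps)
        from this[OF ubd(2) vbd(2) elim] show ?thesis .
      qed
      then have "u p \<le> v p" by (simp add: divide_le_cancel)
      moreover have "real j / 2 ^ m \<le> real (u p) / 2 ^ (m + p)" "real (v p) / 2 ^ (m + p) \<le> real (j + 2) / 2 ^ m"
        using ubd(1)[of p] vbd(1)[of p] st by linarith+
      then have "real (j * 2 ^ p) \<le> real (u p)" "real (v p) \<le> real ((j + 2) * 2 ^ p)"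
        by (auto simp: power_add field_simps)
      then have "j * 2 ^ p \<le> u p" "v p \<le> (j + 2) * 2 ^ p"
        by (simp_all only: of_nat_le_iff)
      ultimately show ?case by (rule dyadic)
    qed
    then show ?thesis
      by (rule tendsto_le[OF _ _ _, rotated 3]) (use fl ul vl in \<open>auto intro!: tendsto_intros\<close>)
  qed
  show "\<exists>d>0. \<exists>L. \<forall>s t. x - d < s \<and> s < t \<and> t < x + d \<longrightarrow> \<bar>f t - f s - L * (t - s)\<bar> \<le> e * (t - s)"
  proof (intro exI conjI allI impI)
    show "0 < 1 / (2 * 2 ^ m :: real)" by simp
    fix s t assume st: "x - 1 / (2 * 2 ^ m) < s \<and> s < t \<and> t < x + 1 / (2 * 2 ^ m)"
    have "real j / 2 ^ m \<le> x - 1 / (2 * 2 ^ m)" "x + 1 / (2 * 2 ^ m) \<le> real (j + 2) / 2 ^ m"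
      using divide_right_mono[OF j(1), of "2 ^ m"]
        divide_right_mono[of "2 ^ m * x + 1 / 2" "real (j + 2)" "2 ^ m"] j(2)
      by (auto simp: diff_divide_distrib add_divide_distrib)
    with st show "\<bar>f t - f s - L * (t - s)\<bar> \<le> e * (t - s)" by (intro main) auto
  qed
qed

section \<open>The fractional kernel\<close>

text \<open>In increments of the process the term (-u)_+^\<alpha> cancels, which leaves differences
  of this kernel. For \<beta> = \<alpha> in the range of the process it is itself not square
  integrable at minus infinity; for \<beta> = \<alpha> - 1 it is the kernel of the derivative up to
  the factor \<alpha>.\<close>

definition frac_kernel :: "real \<Rightarrow> real \<Rightarrow> real \<Rightarrow> real \<Rightarrow> real" where
  "frac_kernel \<beta> \<gamma> t u = pos_powr (t - u) \<beta> * \<bar>u\<bar> powr (- \<gamma> / 2)"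

lemma gfbm_kernel_diff:
  "gfbm_kernel \<alpha> \<gamma> t u - gfbm_kernel \<alpha> \<gamma> s u = frac_kernel \<alpha> \<gamma> t u - frac_kernel \<alpha> \<gamma> s u"
  by (simp add: gfbm_kernel_def frac_kernel_def algebra_simps)

lemma pos_powr_measurable [measurable]: "(\<lambda>x. pos_powr x a) \<in> borel_measurable borel"
  unfolding pos_powr_def by measurable

lemma frac_kernel_measurable [measurable]: "frac_kernel \<beta> \<gamma> t \<in> borel_measurable borel"
  unfolding frac_kernel_def[abs_def] by measurable

lemma abs_powr_half_power2: "(\<bar>u\<bar> powr (- \<gamma> / 2))\<^sup>2 = \<bar>u :: real\<bar> powr (- \<gamma>)"
  by (simp add: power2_eq_square flip: powr_add)

section \<open>Mean square error of the kernel quotients against the derivative kernel\<close>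

definition powr_remainder :: "real \<Rightarrow> real \<Rightarrow> real \<Rightarrow> real" where
  "powr_remainder \<alpha> h x = (pos_powr (x + h) \<alpha> - pos_powr x \<alpha>) / h - \<alpha> * pos_powr x (\<alpha> - 1)"

lemma powr_remainder_measurable [measurable]: "powr_remainder \<alpha> h \<in> borel_measurable borel"
  unfolding powr_remainder_def[abs_def] by measurable

text \<open>In the variable x = t - u the error is one function of x, the same for all t, times the
  singular weight in u. This separates the estimate of the power from that of the weight.\<close>

lemma frac_kernel_remainder:
  "(frac_kernel \<alpha> \<gamma> (t + h) u - frac_kernel \<alpha> \<gamma> t u) / h - \<alpha> * frac_kernel (\<alpha> - 1) \<gamma> t u =
    powr_remainder \<alpha> h (t - u) * \<bar>u\<bar> powr (- \<gamma> / 2)"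
proof -
  have "t + h - u = t - u + h" by simp
  then show ?thesis
    by (simp only: frac_kernel_def powr_remainder_def) (simp add: diff_divide_distrib algebra_simps)
qed

lemma powr_diff_quotient:
  fixes x h \<alpha> :: real
  assumes "0 < x" "0 < h"
  shows "\<exists>z. x < z \<and> z < x + h \<and> ((x + h) powr \<alpha> - x powr \<alpha>) / h = \<alpha> * z powr (\<alpha> - 1)"
proof -
  have "\<exists>z. x < z \<and> z < x + h \<and> (x + h) powr \<alpha> - x powr \<alpha> = (x + h - x) * (\<alpha> * z powr (\<alpha> - 1))"
    using assms by (intro MVT2 has_real_derivative_powr) auto
  then show ?thesis using assms by (auto simp: field_simps)
qed

text \<open>Below -h both powers vanish, and on (-h, 0] only the shifted one is present. For x > 0
  the mean value theorem gives \<alpha> (z^(\<alpha> - 1) - x^(\<alpha> - 1)) with z > x. As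
  \<alpha> < 1 this power decreases, which gives the bound that is good near 0; a second mean value
  step gives the bound that is good far out.\<close>

lemma powr_remainder_bounds:
  assumes \<alpha>: "1 / 2 < \<alpha>" "\<alpha> < 1" and h: "0 < h"
  shows "x \<le> - h \<Longrightarrow> powr_remainder \<alpha> h x = 0"
    and "x \<le> 0 \<Longrightarrow> \<bar>powr_remainder \<alpha> h x\<bar> \<le> h powr (\<alpha> - 1)"
    and "0 < x \<Longrightarrow> \<bar>powr_remainder \<alpha> h x\<bar> \<le> x powr (\<alpha> - 1)"
    and "0 < x \<Longrightarrow> \<bar>powr_remainder \<alpha> h x\<bar> \<le> h * x powr (\<alpha> - 2)"
proof -
  show 0: "powr_remainder \<alpha> h x = 0" if "x \<le> - h"
    using that h by (simp add: powr_remainder_def pos_powr_def)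
  show "\<bar>powr_remainder \<alpha> h x\<bar> \<le> h powr (\<alpha> - 1)" if "x \<le> 0"
  proof (cases "x \<le> - h")
    case False
    then have "\<bar>powr_remainder \<alpha> h x\<bar> = (x + h) powr \<alpha> / h"
      using that h by (simp add: powr_remainder_def pos_powr_def)
    also have "\<dots> \<le> h powr \<alpha> / h"
      using False that h \<alpha> by (intro divide_right_mono powr_mono2) auto
    also have "\<dots> = h powr (\<alpha> - 1)"
      using h by (simp add: powr_diff)
    finally show ?thesis .
  qed (use 0 in simp)
  assume x: "0 < x"
  obtain z where z: "x < z" "z < x + h"
    and eq: "((x + h) powr \<alpha> - x powr \<alpha>) / h = \<alpha> * z powr (\<alpha> - 1)"
    using powr_diff_quotient[OF x h] by blast
  have R: "powr_remainder \<alpha> h x = \<alpha> * z powr (\<alpha> - 1) - \<alpha> * x powr (\<alpha> - 1)"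
    using x h eq by (simp add: powr_remainder_def pos_powr_def)
  have zx: "z powr (\<alpha> - 1) \<le> x powr (\<alpha> - 1)"
    using x z \<alpha> by (intro powr_mono2') auto
  have A: "\<bar>powr_remainder \<alpha> h x\<bar> = \<alpha> * (x powr (\<alpha> - 1) - z powr (\<alpha> - 1))"
    using zx \<alpha> unfolding R by (simp add: right_diff_distrib)
  also have "\<dots> \<le> 1 * (x powr (\<alpha> - 1) - z powr (\<alpha> - 1))"
    using zx \<alpha> by (intro mult_right_mono) auto
  finally have B: "\<bar>powr_remainder \<alpha> h x\<bar> \<le> x powr (\<alpha> - 1) - z powr (\<alpha> - 1)" by simp
  then show "\<bar>powr_remainder \<alpha> h x\<bar> \<le> x powr (\<alpha> - 1)"
    using powr_ge_zero[of z "\<alpha> - 1"] by linarith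
  obtain y where y: "x < y" "y < x + (z - x)"
    and eq': "((x + (z - x)) powr (\<alpha> - 1) - x powr (\<alpha> - 1)) / (z - x) = (\<alpha> - 1) * y powr (\<alpha> - 1 - 1)"
    using powr_diff_quotient[OF x, of "z - x" "\<alpha> - 1"] z by auto
  have "x powr (\<alpha> - 1) - z powr (\<alpha> - 1) = (z - x) * ((1 - \<alpha>) * y powr (\<alpha> - 2))"
    using eq' z by (simp add: field_simps)
  also have "\<dots> \<le> h * (1 * x powr (\<alpha> - 2))"
    using x y z \<alpha> by (intro mult_mono powr_mono2') auto
  finally show "\<bar>powr_remainder \<alpha> h x\<bar> \<le> h * x powr (\<alpha> - 2)"
    using B by simp
qed

text \<open>The line is split at -h, 0 and h. Each region contributes a multiple of h^(2\<alpha> -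
  1), and these multiples are the three summands of the constant, in this order. Integrability at 0
  needs 2\<alpha> - 2 > -1, at infinity 2\<alpha> - 4 < -1.\<close>

lemma nn_integral_powr_remainder:
  assumes \<alpha>: "1 / 2 < \<alpha>" "\<alpha> < 1" and h: "0 < h"
  shows "(\<integral>\<^sup>+x. ennreal ((powr_remainder \<alpha> h x)\<^sup>2) \<partial>lborel) \<le>
    ennreal ((1 + 1 / (2 * \<alpha> - 1) + 1 / (3 - 2 * \<alpha>)) * h powr (2 * \<alpha> - 1))"
proof -
  let ?f = "\<lambda>x. ennreal (h powr (2 * \<alpha> - 2)) * indicator {-h..0} x"
  let ?g = "\<lambda>x. ennreal (x powr (2 * \<alpha> - 2)) * indicator {0..h} x"
  let ?k = "\<lambda>x. ennreal (h\<^sup>2 * x powr (2 * \<alpha> - 4)) * indicator {h..} x"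
  have pw: "(x powr (\<alpha> - 1))\<^sup>2 = x powr (2 * \<alpha> - 2)" "(x powr (\<alpha> - 2))\<^sup>2 = x powr (2 * \<alpha> - 4)" for x :: real
    by (simp_all add: power2_eq_square flip: powr_add)
  note bd = powr_remainder_bounds[OF assms]
  have le: "ennreal ((powr_remainder \<alpha> h x)\<^sup>2) \<le> ?f x + (?g x + ?k x)" for x
  proof -
    consider "x \<le> -h" | "- h < x" "x \<le> 0" | "0 < x" "x \<le> h" | "h < x" by linarith
    then show ?thesis
    proof cases
      case 2
      then have "(powr_remainder \<alpha> h x)\<^sup>2 \<le> h powr (2 * \<alpha> - 2)"
        using power_mono[OF bd(2)[of x], of 2] by (simp add: pw)
      then show ?thesis using 2 by (auto intro!: add_increasing2 ennreal_leI)
    next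
      case 3
      then have "(powr_remainder \<alpha> h x)\<^sup>2 \<le> x powr (2 * \<alpha> - 2)"
        using power_mono[OF bd(3)[of x], of 2] by (simp add: pw)
      then show ?thesis using 3 by (auto intro!: add_increasing add_increasing2 ennreal_leI)
    next
      case 4
      then have "(powr_remainder \<alpha> h x)\<^sup>2 \<le> h\<^sup>2 * x powr (2 * \<alpha> - 4)"
        using power_mono[OF bd(4)[of x], of 2] h by (simp add: pw power_mult_distrib)
      then show ?thesis using 4 h by (auto intro!: add_increasing add_increasing2 ennreal_leI)
    qed (use bd(1) in simp)
  qed
  have f: "integral\<^sup>N lborel ?f = ennreal (h powr (2 * \<alpha> - 1))"
  proof -
    have "integral\<^sup>N lborel ?f = ennreal (h powr (2 * \<alpha> - 2) * h powr 1)"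
      using h by (simp add: nn_integral_cmult ennreal_mult)
    then show ?thesis unfolding powr_add[symmetric] by (simp add: algebra_simps)
  qed
  have g: "integral\<^sup>N lborel ?g = ennreal (1 / (2 * \<alpha> - 1) * h powr (2 * \<alpha> - 1))"
    using has_integral_powr_from_0[of "2 * \<alpha> - 2" h] \<alpha> h
    by (subst nn_integral_has_integral_lebesgue') (auto simp: algebra_simps)
  have k: "integral\<^sup>N lborel ?k = ennreal (1 / (3 - 2 * \<alpha>) * h powr (2 * \<alpha> - 1))"
  proof -
    have "((\<lambda>x. h\<^sup>2 * x powr (2 * \<alpha> - 4)) has_integral h\<^sup>2 * (-(h powr (2 * \<alpha> - 4 + 1)) / (2 * \<alpha> - 4 + 1))) {h..}"
      using \<alpha> h by (intro has_integral_mult_right has_integral_powr_to_inf) auto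
    then have "integral\<^sup>N lborel ?k = ennreal (h\<^sup>2 * (-(h powr (2 * \<alpha> - 4 + 1)) / (2 * \<alpha> - 4 + 1)))"
      by (intro nn_integral_has_integral_lebesgue') auto
    also have "h\<^sup>2 * (-(h powr (2 * \<alpha> - 4 + 1)) / (2 * \<alpha> - 4 + 1)) = 1 / (3 - 2 * \<alpha>) * (h powr 2 * h powr (2 * \<alpha> - 3))"
      using \<alpha> h by (simp add: divide_simps) (simp add: algebra_simps)
    also have "h powr 2 * h powr (2 * \<alpha> - 3) = h powr (2 * \<alpha> - 1)"
      by (simp flip: powr_add)
    finally show ?thesis .
  qed
  have "(\<integral>\<^sup>+x. ennreal ((powr_remainder \<alpha> h x)\<^sup>2) \<partial>lborel) \<le> (\<integral>\<^sup>+x. ?f x + (?g x + ?k x) \<partial>lborel)"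
    by (intro nn_integral_mono le)
  also have "\<dots> = integral\<^sup>N lborel ?f + (integral\<^sup>N lborel ?g + integral\<^sup>N lborel ?k)"
    by (subst nn_integral_add, simp, simp, subst nn_integral_add) auto
  also have "\<dots> = ennreal ((1 + 1 / (2 * \<alpha> - 1) + 1 / (3 - 2 * \<alpha>)) * h powr (2 * \<alpha> - 1))"
    unfolding f g k using \<alpha> by (simp add: algebra_simps flip: ennreal_plus)
  finally show ?thesis .
qed

lemma nn_integral_abs_powr_finite:
  assumes "\<gamma> < 1" "0 \<le> c"
  shows "(\<integral>\<^sup>+u. ennreal (\<bar>u\<bar> powr (- \<gamma>)) * indicator {-c..c} u \<partial>lborel) < \<infinity>"
proof -
  have 1: "((\<lambda>u. \<bar>u\<bar> powr (- \<gamma>)) has_integral c powr (- \<gamma> + 1) / (- \<gamma> + 1)) {0..c}"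
    using has_integral_powr_from_0[of "- \<gamma>" c] assms by (auto intro: has_integral_eq[rotated])
  then have "((\<lambda>u. \<bar>u\<bar> powr (- \<gamma>)) has_integral c powr (- \<gamma> + 1) / (- \<gamma> + 1)) {-c..0}"
    using has_integral_reflect_real[of "\<lambda>u. \<bar>u\<bar> powr (- \<gamma>)" _ c 0] by simp
  from has_integral_combine[OF _ _ this 1] assms show ?thesis
    by (subst nn_integral_has_integral_lebesgue') auto
qed

text \<open>The singularities of the weight and of the power are kept apart. For |u| \<le> a / 2 the
  weight is singular, but t - u \<ge> a / 2, where the error is of order h; elsewhere the weight is
  at most (a / 2)^(-\<gamma>) and the unweighted bound applies. The h^2 from the first region is
  absorbed into h^(2\<alpha> - 1) because h \<le> 1.\<close>

lemma frac_kernel_remainder_bound: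
  assumes \<alpha>: "1 / 2 < \<alpha>" "\<alpha> < 1" and \<gamma>: "0 \<le> \<gamma>" "\<gamma> < 1" and a: "0 < a"
  shows "\<exists>C\<ge>0. \<forall>t\<ge>a. \<forall>h. 0 < h \<and> h \<le> 1 \<longrightarrow>
    (\<integral>\<^sup>+u. ennreal (((frac_kernel \<alpha> \<gamma> (t + h) u - frac_kernel \<alpha> \<gamma> t u) / h - \<alpha> * frac_kernel (\<alpha> - 1) \<gamma> t u)\<^sup>2) \<partial>lborel)
      \<le> ennreal (C * h powr (2 * \<alpha> - 1))"
proof -
  define G where "G = enn2real (\<integral>\<^sup>+u. ennreal (\<bar>u\<bar> powr (- \<gamma>)) * indicator {-(a / 2)..a / 2} u \<partial>lborel)"
  have G: "(\<integral>\<^sup>+u. ennreal (\<bar>u\<bar> powr (- \<gamma>)) * indicator {-(a / 2)..a / 2} u \<partial>lborel) = ennreal G" "0 \<le> G"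
    using nn_integral_abs_powr_finite[OF \<gamma>(2), of "a / 2"] a by (auto simp: G_def)
  define c1 where "c1 = 1 + 1 / (2 * \<alpha> - 1) + 1 / (3 - 2 * \<alpha>)"
  have c1: "0 \<le> c1" using \<alpha> by (simp add: c1_def)
  define C where "C = (a / 2) powr (- \<gamma>) * c1 + (a / 2) powr (2 * \<alpha> - 4) * G"
  have "(\<integral>\<^sup>+u. ennreal ((powr_remainder \<alpha> h (t - u) * \<bar>u\<bar> powr (- \<gamma> / 2))\<^sup>2) \<partial>lborel) \<le> ennreal (C * h powr (2 * \<alpha> - 1))"
    if t: "a \<le> t" and h: "0 < h" "h \<le> 1" for t h
  proof -
    let ?A = "ennreal ((a / 2) powr (- \<gamma>))" and ?B = "ennreal (h\<^sup>2 * (a / 2) powr (2 * \<alpha> - 4))"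
    have sq: "(powr_remainder \<alpha> h (t - u) * \<bar>u\<bar> powr (- \<gamma> / 2))\<^sup>2 =
        (powr_remainder \<alpha> h (t - u))\<^sup>2 * \<bar>u\<bar> powr (- \<gamma>)" for u
      by (simp only: power_mult_distrib abs_powr_half_power2)
    have le: "ennreal ((powr_remainder \<alpha> h (t - u) * \<bar>u\<bar> powr (- \<gamma> / 2))\<^sup>2) \<le>
        ?A * ennreal ((powr_remainder \<alpha> h (t - u))\<^sup>2) + ?B * (ennreal (\<bar>u\<bar> powr (- \<gamma>)) * indicator {-(a / 2)..a / 2} u)" for u
    proof (cases "\<bar>u\<bar> \<le> a / 2")
      case True
      then have x: "a / 2 \<le> t - u" using t by (simp add: abs_le_iff)
      then have "(powr_remainder \<alpha> h (t - u))\<^sup>2 \<le> (h * (t - u) powr (\<alpha> - 2))\<^sup>2"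
        using power_mono[OF powr_remainder_bounds(4)[OF \<alpha> h(1), of "t - u"], of 2] a by simp
      also have "\<dots> \<le> (h * (a / 2) powr (\<alpha> - 2))\<^sup>2"
        using x a \<alpha> h by (intro power_mono mult_left_mono powr_mono2') auto
      also have "\<dots> = h\<^sup>2 * (a / 2) powr (2 * \<alpha> - 4)"
        by (simp add: power_mult_distrib) (simp add: power2_eq_square flip: powr_add)
      finally have "(powr_remainder \<alpha> h (t - u))\<^sup>2 * \<bar>u\<bar> powr (- \<gamma>) \<le> h\<^sup>2 * (a / 2) powr (2 * \<alpha> - 4) * \<bar>u\<bar> powr (- \<gamma>)"
        by (rule mult_right_mono) simp
      then have "ennreal ((powr_remainder \<alpha> h (t - u) * \<bar>u\<bar> powr (- \<gamma> / 2))\<^sup>2) \<le> ?B * ennreal (\<bar>u\<bar> powr (- \<gamma>))"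
        unfolding sq by (simp add: ennreal_leI flip: ennreal_mult)
      moreover have "u \<in> {-(a / 2)..a / 2}" using True unfolding atLeastAtMost_iff by linarith
      ultimately show ?thesis by (simp add: add_increasing)
    next
      case False
      then have "\<bar>u\<bar> powr (- \<gamma>) \<le> (a / 2) powr (- \<gamma>)"
        using a \<gamma> by (intro powr_mono2') auto
      then have "(powr_remainder \<alpha> h (t - u))\<^sup>2 * \<bar>u\<bar> powr (- \<gamma>) \<le> (a / 2) powr (- \<gamma>) * (powr_remainder \<alpha> h (t - u))\<^sup>2"
        by (subst mult.commute) (intro mult_right_mono, auto)
      then have "ennreal ((powr_remainder \<alpha> h (t - u) * \<bar>u\<bar> powr (- \<gamma> / 2))\<^sup>2) \<le>
          ?A * ennreal ((powr_remainder \<alpha> h (t - u))\<^sup>2)"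
        unfolding sq by (simp add: ennreal_leI flip: ennreal_mult)
      then show ?thesis by (auto intro!: add_increasing2)
    qed
    have "(\<integral>\<^sup>+u. ennreal ((powr_remainder \<alpha> h (t - u) * \<bar>u\<bar> powr (- \<gamma> / 2))\<^sup>2) \<partial>lborel) \<le>
        (\<integral>\<^sup>+u. ?A * ennreal ((powr_remainder \<alpha> h (t - u))\<^sup>2) +
          ?B * (ennreal (\<bar>u\<bar> powr (- \<gamma>)) * indicator {-(a / 2)..a / 2} u) \<partial>lborel)"
      by (intro nn_integral_mono le)
    also have "\<dots> = ?A * (\<integral>\<^sup>+u. ennreal ((powr_remainder \<alpha> h (t - u))\<^sup>2) \<partial>lborel) + ?B * ennreal G"
      unfolding G(1)[symmetric] by (simp add: nn_integral_add nn_integral_cmult)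
    also have "(\<integral>\<^sup>+u. ennreal ((powr_remainder \<alpha> h (t - u))\<^sup>2) \<partial>lborel) =
        (\<integral>\<^sup>+u. ennreal ((powr_remainder \<alpha> h u)\<^sup>2) \<partial>lborel)"
      using nn_integral_real_affine[of "\<lambda>u. ennreal ((powr_remainder \<alpha> h u)\<^sup>2)" "-1" t] by simp
    also have "?A * \<dots> + ?B * ennreal G \<le> ?A * ennreal (c1 * h powr (2 * \<alpha> - 1)) + ?B * ennreal G"
      unfolding c1_def using nn_integral_powr_remainder[OF \<alpha> h(1)] by (intro add_mono mult_left_mono) auto
    also have "\<dots> = ennreal ((a / 2) powr (- \<gamma>) * c1 * h powr (2 * \<alpha> - 1) + h\<^sup>2 * (a / 2) powr (2 * \<alpha> - 4) * G)"
      using c1 G(2) by (simp add: mult.assoc flip: ennreal_mult ennreal_plus)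
    also have "\<dots> \<le> ennreal (C * h powr (2 * \<alpha> - 1))"
    proof (rule ennreal_leI)
      have "h powr 2 \<le> h powr (2 * \<alpha> - 1)"
        using h \<alpha> by (intro powr_mono') auto
      then have "h\<^sup>2 \<le> h powr (2 * \<alpha> - 1)" using h by simp
      then have "h\<^sup>2 * ((a / 2) powr (2 * \<alpha> - 4) * G) \<le> h powr (2 * \<alpha> - 1) * ((a / 2) powr (2 * \<alpha> - 4) * G)"
        using G(2) by (intro mult_right_mono) auto
      then show "(a / 2) powr (- \<gamma>) * c1 * h powr (2 * \<alpha> - 1) + h\<^sup>2 * (a / 2) powr (2 * \<alpha> - 4) * G \<le> C * h powr (2 * \<alpha> - 1)"
        by (simp add: C_def algebra_simps)
    qed
    finally show ?thesis .
  qed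
  moreover have "0 \<le> C" using c1 G(2) by (simp add: C_def)
  ultimately show ?thesis
    unfolding frac_kernel_remainder by blast
qed

text \<open>For s < u < s + h / 2 only the later kernel is nonzero, and s + h - u lies between h / 2
  and h. The minimum is the smaller of the two end values relative to h^(2\<beta>), so both signs of
  \<beta> are covered; the factor 1/2 comes from the length of the interval.\<close>

lemma frac_kernel_quotient_ge:
  assumes s: "0 \<le> s" and h: "0 < h" and \<gamma>: "0 \<le> \<gamma>"
  shows "ennreal (min 1 (2 powr (- (2 * \<beta>))) / 2 * h powr (2 * \<beta> - 1) * (s + h) powr (- \<gamma>)) \<le>
    (\<integral>\<^sup>+u. ennreal (((frac_kernel \<beta> \<gamma> (s + h) u - frac_kernel \<beta> \<gamma> s u) / h)\<^sup>2) \<partial>lborel)"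
proof -
  define c where "c = min 1 (2 powr (- (2 * \<beta>)))"
  have c: "0 < c" by (simp add: c_def)
  define L where "L = c * h powr (2 * \<beta>) * (s + h) powr (- \<gamma>) / h\<^sup>2"
  have L: "0 \<le> L" using c by (simp add: L_def)
  have le: "L \<le> ((frac_kernel \<beta> \<gamma> (s + h) u - frac_kernel \<beta> \<gamma> s u) / h)\<^sup>2" if u: "s < u" "u < s + h / 2" for u
  proof -
    define y where "y = s + h - u"
    have y: "h / 2 < y" "y < h" "0 < y" using u h by (auto simp: y_def field_simps)
    have "c * h powr (2 * \<beta>) \<le> y powr (2 * \<beta>)"
    proof (cases "0 \<le> \<beta>")
      case True
      have "c * h powr (2 * \<beta>) \<le> 2 powr (- (2 * \<beta>)) * h powr (2 * \<beta>)"
        by (intro mult_right_mono) (auto simp: c_def)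
      also have "\<dots> = (h / 2) powr (2 * \<beta>)"
        using h by (simp add: powr_divide powr_minus_divide)
      also have "\<dots> \<le> y powr (2 * \<beta>)"
        using True y h by (intro powr_mono2) auto
      finally show ?thesis .
    next
      case False
      have "c * h powr (2 * \<beta>) \<le> 1 * h powr (2 * \<beta>)"
        by (intro mult_right_mono) (auto simp: c_def)
      also have "\<dots> \<le> y powr (2 * \<beta>)"
        using False y h by (simp add: powr_mono2')
      finally show ?thesis .
    qed
    moreover have "(s + h) powr (- \<gamma>) \<le> \<bar>u\<bar> powr (- \<gamma>)"
      using u s h \<gamma> by (intro powr_mono2') auto
    ultimately have "c * h powr (2 * \<beta>) * (s + h) powr (- \<gamma>) \<le> y powr (2 * \<beta>) * \<bar>u\<bar> powr (- \<gamma>)"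
      using c by (intro mult_mono) auto
    moreover have "(frac_kernel \<beta> \<gamma> (s + h) u - frac_kernel \<beta> \<gamma> s u)\<^sup>2 = y powr (2 * \<beta>) * \<bar>u\<bar> powr (- \<gamma>)"
    proof -
      have "frac_kernel \<beta> \<gamma> (s + h) u - frac_kernel \<beta> \<gamma> s u = y powr \<beta> * \<bar>u\<bar> powr (- \<gamma> / 2)"
        using u y by (simp add: frac_kernel_def pos_powr_def y_def[symmetric])
      then show ?thesis
        by (simp only: power_mult_distrib abs_powr_half_power2) (simp add: power2_eq_square flip: powr_add)
    qed
    ultimately show ?thesis
      by (simp add: L_def power_divide divide_right_mono)
  qed
  have hp: "h powr (2 * \<beta> - 1) = h powr (2 * \<beta>) / h\<^sup>2 * h"
    using h by (simp add: powr_diff power2_eq_square)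
  have "ennreal (c / 2 * h powr (2 * \<beta> - 1) * (s + h) powr (- \<gamma>)) = ennreal (L * (h / 2))"
    unfolding hp L_def by (simp add: field_simps)
  also have "\<dots> = (\<integral>\<^sup>+u. ennreal L * indicator {s<..<s + h / 2} u \<partial>lborel)"
    using h ennreal_mult[OF L, of "h / 2"] by (simp add: nn_integral_cmult)
  also have "\<dots> \<le> (\<integral>\<^sup>+u. ennreal (((frac_kernel \<beta> \<gamma> (s + h) u - frac_kernel \<beta> \<gamma> s u) / h)\<^sup>2) \<partial>lborel)"
    using le by (intro nn_integral_mono) (auto simp: indicator_def intro!: ennreal_leI)
  finally show ?thesis by (simp add: c_def)
qed

text \<open>For \<beta> = 1/2 and s > 0 the range u > s contributes only a bounded amount, so the
  divergence must come from u < s. There the quotient of the square roots is 1 / (sqrt (s + h - u) +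
  sqrt (s - u)), whose square is at least 1 / (4 (s + h - u)); integrating this gives the logarithm.
  On [s / 2, s] the weight stays above s^(-\<gamma>).\<close>

lemma frac_kernel_half_quotient_ge:
  assumes s: "0 < s" and h: "0 < h" and \<gamma>: "0 \<le> \<gamma>"
  shows "ennreal (s powr (- \<gamma>) / 4 * (ln (s / 2) - ln h)) \<le>
    (\<integral>\<^sup>+u. ennreal (((frac_kernel (1 / 2) \<gamma> (s + h) u - frac_kernel (1 / 2) \<gamma> s u) / h)\<^sup>2) \<partial>lborel)"
proof -
  let ?L = "\<lambda>u. s powr (- \<gamma>) / 4 * (1 / (s + h - u))"
  have le: "?L u \<le> ((frac_kernel (1 / 2) \<gamma> (s + h) u - frac_kernel (1 / 2) \<gamma> s u) / h)\<^sup>2"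
    if u: "u \<in> {s / 2..s}" for u
  proof -
    define a b where "a = sqrt (s + h - u)" and "b = sqrt (s - u)"
    have ab: "0 < a" "0 \<le> b" "b \<le> a" "a\<^sup>2 = s + h - u" "b\<^sup>2 = s - u"
      using u h by (auto simp: a_def b_def)
    have "a\<^sup>2 - b\<^sup>2 = h" using ab by simp
    then have "(a - b) * (a + b) = h" by (simp add: power2_eq_square algebra_simps)
    then have q: "(a - b) / h = 1 / (a + b)"
      using h ab by (auto simp: field_simps)
    have fr: "frac_kernel (1 / 2) \<gamma> (s + h) u - frac_kernel (1 / 2) \<gamma> s u = (a - b) * \<bar>u\<bar> powr (- \<gamma> / 2)"
      using u h by (auto simp: frac_kernel_def pos_powr_def a_def b_def powr_half_sqrt left_diff_distrib)
    have "((frac_kernel (1 / 2) \<gamma> (s + h) u - frac_kernel (1 / 2) \<gamma> s u) / h)\<^sup>2 =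
        (1 / (a + b))\<^sup>2 * \<bar>u\<bar> powr (- \<gamma>)"
      unfolding fr times_divide_eq_left[symmetric] q by (simp only: power_mult_distrib abs_powr_half_power2)
    moreover have "s powr (- \<gamma>) \<le> \<bar>u\<bar> powr (- \<gamma>)"
      using u s \<gamma> by (intro powr_mono2') auto
    moreover have "(1 / (2 * a))\<^sup>2 \<le> (1 / (a + b))\<^sup>2"
      using ab by (intro power_mono divide_left_mono) auto
    ultimately have "(1 / (2 * a))\<^sup>2 * s powr (- \<gamma>) \<le> ((frac_kernel (1 / 2) \<gamma> (s + h) u - frac_kernel (1 / 2) \<gamma> s u) / h)\<^sup>2"
      by (simp only:) (intro mult_mono, auto)
    then show ?thesis
      using ab by (simp add: power_divide power_mult_distrib mult.commute)
  qed
  have "((\<lambda>u. 1 / (s + h - u)) has_integral (- ln (s + h - s) - (- ln (s + h - s / 2)))) {s / 2..s}"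
    using s h by (intro fundamental_theorem_of_calculus)
      (auto intro!: derivative_eq_intros simp flip: has_real_derivative_iff_has_vector_derivative)
  then have I: "(?L has_integral s powr (- \<gamma>) / 4 * (ln (s / 2 + h) - ln h)) {s / 2..s}"
    by (intro has_integral_mult_right) (simp add: algebra_simps)
  have "ln (s / 2) \<le> ln (s / 2 + h)" using s h by simp
  then have "ennreal (s powr (- \<gamma>) / 4 * (ln (s / 2) - ln h)) \<le> ennreal (s powr (- \<gamma>) / 4 * (ln (s / 2 + h) - ln h))"
    by (intro ennreal_leI mult_left_mono) auto
  also have "\<dots> = (\<integral>\<^sup>+u. ennreal (?L u) * indicator {s / 2..s} u \<partial>lborel)"
    using I h by (intro nn_integral_has_integral_lebesgue'[symmetric]) auto
  also have "\<dots> \<le> (\<integral>\<^sup>+u. ennreal (((frac_kernel (1 / 2) \<gamma> (s + h) u - frac_kernel (1 / 2) \<gamma> s u) / h)\<^sup>2) \<partial>lborel)"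
    using le by (intro nn_integral_mono) (auto simp: indicator_def intro!: ennreal_leI)
  finally show ?thesis .
qed

lemma filterlim_inverse_Suc_powr:
  assumes "e < 0"
  shows "filterlim (\<lambda>n. (1 / real (Suc n)) powr e) at_top sequentially"
proof -
  have "filterlim (\<lambda>n. real (Suc n) powr (- e)) at_top sequentially"
    using assms by (intro filterlim_compose[OF real_powr_at_top]
        filterlim_compose[OF filterlim_real_sequentially] filterlim_Suc) auto
  then show ?thesis by (simp add: powr_minus_divide powr_divide)
qed

text \<open>There are three rates: h^(2\<beta> - 1) for \<beta> < 1/2; at \<beta> = 1/2 the weight
  yields h^(-\<gamma>) for s = 0 and the logarithm takes over for s > 0. The process uses this with
  \<beta> = \<alpha>, its derivative with \<beta> = \<alpha> - 1.\<close>

lemma filterlim_frac_kernel_quotient: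
  assumes s: "0 \<le> s" and \<gamma>: "0 \<le> \<gamma>" and \<beta>: "\<beta> < 1 / 2 \<or> \<beta> = 1 / 2 \<and> 0 < \<gamma>"
    and int: "\<And>n. integrable lborel (\<lambda>u. ((frac_kernel \<beta> \<gamma> (s + 1 / real (Suc n)) u - frac_kernel \<beta> \<gamma> s u) / (1 / real (Suc n)))\<^sup>2)"
  shows "filterlim (\<lambda>n. \<integral>u. ((frac_kernel \<beta> \<gamma> (s + 1 / real (Suc n)) u - frac_kernel \<beta> \<gamma> s u) / (1 / real (Suc n)))\<^sup>2 \<partial>lborel)
    at_top sequentially"
proof -
  let ?h = "\<lambda>n. 1 / real (Suc n)"
  let ?I = "\<lambda>n. \<integral>u. ((frac_kernel \<beta> \<gamma> (s + ?h n) u - frac_kernel \<beta> \<gamma> s u) / ?h n)\<^sup>2 \<partial>lborel"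
  have nn: "(\<integral>\<^sup>+u. ennreal (((frac_kernel \<beta> \<gamma> (s + ?h n) u - frac_kernel \<beta> \<gamma> s u) / ?h n)\<^sup>2) \<partial>lborel) = ennreal (?I n)" for n
    by (rule nn_integral_eq_integral[OF int]) simp
  have I0: "0 \<le> ?I n" for n by (rule Bochner_Integration.integral_nonneg) simp
  define c where "c = min 1 (2 powr (- (2 * \<beta>))) / 2"
  have c: "0 < c" by (simp add: c_def)
  have rect: "c * ?h n powr (2 * \<beta> - 1) * (s + ?h n) powr (- \<gamma>) \<le> ?I n" for n
    using frac_kernel_quotient_ge[OF s _ \<gamma>, of "?h n" \<beta>] unfolding nn c_def ennreal_le_iff[OF I0] by simp
  consider "\<beta> < 1 / 2" | "\<beta> = 1 / 2" "s = 0" "0 < \<gamma>" | "\<beta> = 1 / 2" "0 < s"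
    using s \<beta> by fastforce
  then show ?thesis
  proof cases
    case 1
    have le: "c * (s + 1) powr (- \<gamma>) * ?h n powr (2 * \<beta> - 1) \<le> ?I n" for n
    proof -
      have "(s + 1) powr (- \<gamma>) \<le> (s + ?h n) powr (- \<gamma>)"
        using s \<gamma> by (intro powr_mono2') (auto simp: add_nonneg_pos)
      then have "c * ?h n powr (2 * \<beta> - 1) * (s + 1) powr (- \<gamma>) \<le> c * ?h n powr (2 * \<beta> - 1) * (s + ?h n) powr (- \<gamma>)"
        using c by (intro mult_left_mono) auto
      then show ?thesis using rect[of n] by (simp add: mult_ac)
    qed
    have lim: "filterlim (\<lambda>n. c * (s + 1) powr (- \<gamma>) * ?h n powr (2 * \<beta> - 1)) at_top sequentially"
      using c s 1 by (intro filterlim_tendsto_pos_mult_at_top[OF tendsto_const] filterlim_inverse_Suc_powr) auto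
    show ?thesis
      by (rule filterlim_at_top_mono[OF lim]) (intro always_eventually allI le)
  next
    case 2
    have le: "c * ?h n powr (- \<gamma>) \<le> ?I n" for n
      using rect[of n] unfolding 2(1,2) by simp
    have lim: "filterlim (\<lambda>n. c * ?h n powr (- \<gamma>)) at_top sequentially"
      using c 2 by (intro filterlim_tendsto_pos_mult_at_top[OF tendsto_const] filterlim_inverse_Suc_powr) auto
    show ?thesis
      by (rule filterlim_at_top_mono[OF lim]) (intro always_eventually allI le)
  next
    case 3
    have le: "s powr (- \<gamma>) / 4 * (ln (s / 2) + ln (real (Suc n))) \<le> ?I n" for n
      using frac_kernel_half_quotient_ge[OF 3(2) _ \<gamma>, of "?h n"] nn[of n] I0[of n]
      unfolding 3(1) by (simp add: ln_div)
    have lim: "filterlim (\<lambda>n. s powr (- \<gamma>) / 4 * (ln (s / 2) + ln (real (Suc n)))) at_top sequentially"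
      using 3 by (intro filterlim_tendsto_pos_mult_at_top[OF tendsto_const] filterlim_tendsto_add_at_top[OF tendsto_const]
        filterlim_compose[OF ln_at_top] filterlim_compose[OF filterlim_real_sequentially] filterlim_Suc) auto
    show ?thesis
      by (rule filterlim_at_top_mono[OF lim]) (intro always_eventually allI le)
  qed
qed

section \<open>Paths of the generalized fractional Brownian motion\<close>

lemma filterlim_add_inverse_Suc:
  fixes s :: real
  assumes "\<And>n. s + 1 / real (Suc n) \<in> S"
  shows "filterlim (\<lambda>n. s + 1 / real (Suc n)) (at s within S) sequentially"
proof -
  have "(\<lambda>n. s + 1 / real (Suc n)) \<longlonglongrightarrow> s + 0"
    by (intro tendsto_intros LIMSEQ_Suc[OF lim_1_over_n])
  then show ?thesis
    using assms by (auto simp: filterlim_at intro!: always_eventually)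
qed

lemma DERIV_quotient_bounded:
  fixes f :: "real \<Rightarrow> real"
  assumes D: "(f has_real_derivative D) (at s within S)" and S: "\<And>n. s + 1 / real (Suc n) \<in> S"
  shows "\<exists>K. \<forall>n. \<bar>(f (s + 1 / real (Suc n)) - f s) / (1 / real (Suc n))\<bar> \<le> K"
proof -
  have "(\<lambda>n. (f (s + 1 / real (Suc n)) - f s) / (s + 1 / real (Suc n) - s)) \<longlonglongrightarrow> D"
    using D[unfolded has_field_derivative_iff] filterlim_add_inverse_Suc[OF S] by (rule filterlim_compose)
  then have "Bseq (\<lambda>n. (f (s + 1 / real (Suc n)) - f s) / (1 / real (Suc n)))"
    unfolding add_diff_cancel_left' by (rule convergent_imp_Bseq[OF convergentI])
  then show ?thesis
    unfolding Bseq_def real_norm_def by blast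
qed

text \<open>At s = t the closed indicator agrees with the strict cut-off because
  \<open>0 powr a\<close> is 0.\<close>

lemma indicator_kernel_eq_frac_kernel:
  "indicator {..t} s * (\<alpha> * (t - s) powr (\<alpha> - 1) * \<bar>s\<bar> powr (- \<gamma> / 2)) = \<alpha> * frac_kernel (\<alpha> - 1) \<gamma> t s"
  by (cases "s < t") (auto simp: frac_kernel_def pos_powr_def indicator_def)

context gfbm begin

text \<open>Positivity comes from the first integral. Its integrability is taken from the Wiener
  integral at time 1, whose squared kernel is the integrand on (0, 1); without it the Bochner
  integral could be 0 by default. The second integral is nonnegative in any case.\<close>

lemma gfbm_const_pos: "0 < gfbm_const \<alpha> \<gamma>"
proof -
  let ?f = "\<lambda>v. (1 - v) powr (2 * \<alpha>) * v powr (- \<gamma>)"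
  obtain Y where W: "has_wiener_integral M B (gfbm_kernel \<alpha> \<gamma> 1) Y"
    using process_integral[of 1] by auto
  have eq: "indicator {0<..<1} v *\<^sub>R (gfbm_kernel \<alpha> \<gamma> 1 v)\<^sup>2 = indicator {0<..<1} v *\<^sub>R ?f v" for v
  proof (cases "v \<in> {0<..<1}")
    case True
    then have "gfbm_kernel \<alpha> \<gamma> 1 v = (1 - v) powr \<alpha> * \<bar>v\<bar> powr (- \<gamma> / 2)"
      by (simp add: gfbm_kernel_def pos_powr_def)
    then have "(gfbm_kernel \<alpha> \<gamma> 1 v)\<^sup>2 = ((1 - v) powr \<alpha>)\<^sup>2 * \<bar>v\<bar> powr (- \<gamma>)"
      by (simp only: power_mult_distrib abs_powr_half_power2)
    also have "((1 - v) powr \<alpha>)\<^sup>2 = (1 - v) powr (2 * \<alpha>)"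
      by (simp add: power2_eq_square flip: powr_add)
    finally show ?thesis using True by simp
  qed simp
  have "integrable lborel (\<lambda>v. indicator {0<..<1} v *\<^sub>R (gfbm_kernel \<alpha> \<gamma> 1 v)\<^sup>2)"
    using has_wiener_integral_char(1)[OF W] by (intro integrable_mult_indicator) auto
  then have int: "integrable lborel (\<lambda>v. indicator {0<..<1} v *\<^sub>R ?f v)"
    by (simp only: eq)
  have "0 \<noteq> (\<integral>v. indicator {0<..<1} v *\<^sub>R ?f v \<partial>lborel)"
  proof
    assume "0 = (\<integral>v. indicator {0<..<1} v *\<^sub>R ?f v \<partial>lborel)"
    then have "AE v in lborel. indicator {0<..<1} v *\<^sub>R ?f v = 0"
      using integral_nonneg_eq_0_iff_AE[OF int] by simp
    then have "AE v in lborel. v \<notin> {0<..<1::real}"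
      by eventually_elim (auto simp: indicator_def)
    then have "{0<..<1::real} \<in> null_sets lborel"
      by (subst AE_iff_null_sets) auto
    then show False by (auto simp: null_sets_def)
  qed
  moreover have "0 \<le> (\<integral>v. indicator {0<..<1} v *\<^sub>R ?f v \<partial>lborel)"
    by (rule Bochner_Integration.integral_nonneg) simp
  moreover have "0 \<le> (LBINT v:{0<..}. ((1 + v) powr \<alpha> - v powr \<alpha>)\<^sup>2 * v powr (- \<gamma>))"
    unfolding set_lebesgue_integral_def by (rule Bochner_Integration.integral_nonneg) simp
  ultimately have "0 < (LBINT v:{0<..<1}. ?f v) +
      (LBINT v:{0<..}. ((1 + v) powr \<alpha> - v powr \<alpha>)\<^sup>2 * v powr (- \<gamma>))"
    unfolding set_lebesgue_integral_def by linarith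
  then show ?thesis
    by (simp add: gfbm_const_def)
qed

text \<open>Division by the normalising constant leaves the plain kernel, and the free parameter h
  lets one statement serve all difference quotients.\<close>

lemma has_wiener_integral_increment:
  assumes "0 \<le> s" "0 \<le> t"
  shows "has_wiener_integral M B (\<lambda>u. (frac_kernel \<alpha> \<gamma> t u - frac_kernel \<alpha> \<gamma> s u) / h)
    (\<lambda>\<omega>. (X t \<omega> - X s \<omega>) / (gfbm_const \<alpha> \<gamma> * h))"
proof -
  obtain Ys where Ws: "has_wiener_integral M B (gfbm_kernel \<alpha> \<gamma> s) Ys"
    and Xs: "AE \<omega> in M. X s \<omega> = gfbm_const \<alpha> \<gamma> * Ys \<omega>"
    using process_integral[OF assms(1)] by auto
  obtain Yt where Wt: "has_wiener_integral M B (gfbm_kernel \<alpha> \<gamma> t) Yt"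
    and Xt: "AE \<omega> in M. X t \<omega> = gfbm_const \<alpha> \<gamma> * Yt \<omega>"
    using process_integral[OF assms(2)] by auto
  have "(\<lambda>u. 1 / h * gfbm_kernel \<alpha> \<gamma> t u + (- 1 / h) * gfbm_kernel \<alpha> \<gamma> s u) =
      (\<lambda>u. (frac_kernel \<alpha> \<gamma> t u - frac_kernel \<alpha> \<gamma> s u) / h)"
    unfolding gfbm_kernel_diff[symmetric] by (simp add: diff_divide_distrib)
  with has_wiener_integral_lincomb[OF Wt Ws, of "1 / h" "- 1 / h"]
  have "has_wiener_integral M B (\<lambda>u. (frac_kernel \<alpha> \<gamma> t u - frac_kernel \<alpha> \<gamma> s u) / h)
      (\<lambda>\<omega>. 1 / h * Yt \<omega> + (- 1 / h) * Ys \<omega>)" by simp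
  moreover have "AE \<omega> in M. 1 / h * Yt \<omega> + (- 1 / h) * Ys \<omega> = (X t \<omega> - X s \<omega>) / (gfbm_const \<alpha> \<gamma> * h)"
    using Xs Xt
  proof eventually_elim
    case (elim \<omega>)
    have "(X t \<omega> - X s \<omega>) / (gfbm_const \<alpha> \<gamma> * h) = (gfbm_const \<alpha> \<gamma> * (Yt \<omega> - Ys \<omega>)) / (gfbm_const \<alpha> \<gamma> * h)"
      using elim by (simp add: algebra_simps)
    also have "\<dots> = (Yt \<omega> - Ys \<omega>) / h" using gfbm_const_pos by simp
    finally show ?case by (simp add: diff_divide_distrib)
  qed
  ultimately show ?thesis
    using process_measurable[OF assms(1)] process_measurable[OF assms(2)]
    by (elim has_wiener_integral_cong_AE) auto
qed

section \<open>Unbounded difference quotients for \<alpha> \<le> 1/2\<close>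

lemma filterlim_increment_variance:
  assumes "0 \<le> s" "\<alpha> \<le> 1 / 2" "0 < \<gamma>"
  shows "filterlim (\<lambda>n. \<integral>u. ((frac_kernel \<alpha> \<gamma> (s + 1 / real (Suc n)) u - frac_kernel \<alpha> \<gamma> s u) / (1 / real (Suc n)))\<^sup>2 \<partial>lborel)
    at_top sequentially"
proof (rule filterlim_frac_kernel_quotient)
  show "integrable lborel (\<lambda>u. ((frac_kernel \<alpha> \<gamma> (s + 1 / real (Suc n)) u - frac_kernel \<alpha> \<gamma> s u) / (1 / real (Suc n)))\<^sup>2)" for n
    using assms by (intro has_wiener_integral_char(1)[OF has_wiener_integral_increment]) auto
qed (use assms in auto)

text \<open>Sampling from the right along s + 1 / (n + 1) stays in the half-line even for s = 0 and
  involves countably many variables. Unboundedness along this sequence already excludes a finite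
  upper limit and a derivative.\<close>

lemma AE_increment_unbounded:
  assumes "0 \<le> s" "\<alpha> \<le> 1 / 2" "0 < \<gamma>"
  shows "AE \<omega> in M. \<forall>K m. \<exists>n\<ge>m. K < \<bar>(X (s + 1 / real (Suc n)) \<omega> - X s \<omega>) / (1 / real (Suc n))\<bar>"
proof -
  let ?c = "gfbm_const \<alpha> \<gamma>"
  have "AE \<omega> in M. \<forall>K m. \<exists>n\<ge>m. K < \<bar>(X (s + 1 / real (Suc n)) \<omega> - X s \<omega>) / (?c * (1 / real (Suc n)))\<bar>"
    using assms
    by (intro has_wiener_integral_unbounded[OF has_wiener_integral_increment filterlim_increment_variance]) auto
  then show ?thesis
  proof eventually_elim
    case (elim \<omega>)
    show ?case
    proof (intro allI)
      fix K m
      obtain n where n: "n \<ge> m" and K: "K / ?c < \<bar>(X (s + 1 / real (Suc n)) \<omega> - X s \<omega>) / (?c * (1 / real (Suc n)))\<bar>"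
        using elim by blast
      have "\<bar>d / (?c * h)\<bar> = \<bar>d / h\<bar> / ?c" for d h
        using gfbm_const_pos by (simp add: abs_mult)
      with K have "K < \<bar>(X (s + 1 / real (Suc n)) \<omega> - X s \<omega>) / (1 / real (Suc n))\<bar>"
        using gfbm_const_pos by (simp only: divide_less_cancel)
      with n show "\<exists>n\<ge>m. K < \<bar>(X (s + 1 / real (Suc n)) \<omega> - X s \<omega>) / (1 / real (Suc n))\<bar>" by blast
    qed
  qed
qed

lemma AE_Limsup_increment:
  assumes "0 \<le> s" "\<alpha> \<le> 1 / 2" "0 < \<gamma>"
  shows "AE \<omega> in M. Limsup (at s within {0..}) (\<lambda>t. ereal \<bar>(X t \<omega> - X s \<omega>) / (t - s)\<bar>) = \<infinity>"
  using AE_increment_unbounded[OF assms]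
proof eventually_elim
  case (elim \<omega>)
  let ?q = "\<lambda>t. ereal \<bar>(X t \<omega> - X s \<omega>) / (t - s)\<bar>"
  have "ereal K \<le> Limsup (at s within {0..}) ?q" for K
  proof (rule ccontr)
    assume "\<not> ereal K \<le> Limsup (at s within {0..}) ?q"
    then have "\<forall>\<^sub>F t in at s within {0..}. ?q t < ereal K"
      by (intro Limsup_lessD) simp
    then have "\<forall>\<^sub>F n in sequentially. ?q (s + 1 / real (Suc n)) < ereal K"
    proof (rule eventually_compose_filterlim)
      show "filterlim (\<lambda>n. s + 1 / real (Suc n)) (at s within {0..}) sequentially"
        by (rule filterlim_add_inverse_Suc) (use assms(1) in simp)
    qed
    then obtain m where m: "\<And>n. m \<le> n \<Longrightarrow> ?q (s + 1 / real (Suc n)) < ereal K"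
      by (auto simp: eventually_sequentially)
    obtain n where n: "m \<le> n" and K: "K < \<bar>(X (s + 1 / real (Suc n)) \<omega> - X s \<omega>) / (1 / real (Suc n))\<bar>"
      using elim by blast
    from m[OF n] have "\<bar>(X (s + 1 / real (Suc n)) \<omega> - X s \<omega>) / (1 / real (Suc n))\<bar> < K"
      by (simp only: add_diff_cancel_left' less_ereal.simps)
    with K show False by (rule less_asym)
  qed
  then show ?case by (intro ereal_top) auto
qed

text \<open>A mean square limit Y would eventually bound the second moments of the quotients by 2 +
  2 E(Y^2), while they equal the squared constant times variances that tend to infinity.\<close>

lemma not_mean_square_differentiable:
  assumes s: "0 \<le> s" and "\<alpha> \<le> 1 / 2" "0 < \<gamma>"
  shows "\<not> mean_square_differentiable_at M {0..} X s"
proof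
  assume "mean_square_differentiable_at M {0..} X s"
  then obtain Y where [measurable]: "Y \<in> borel_measurable M" and Y: "integrable M (\<lambda>\<omega>. (Y \<omega>)\<^sup>2)"
    and lim: "((\<lambda>t. \<integral>\<^sup>+\<omega>. ennreal (((X t \<omega> - X s \<omega>) / (t - s) - Y \<omega>)\<^sup>2) \<partial>M) \<longlongrightarrow> 0) (at s within {0..})"
    by (auto simp: mean_square_differentiable_at_def)
  let ?c = "gfbm_const \<alpha> \<gamma>" and ?h = "\<lambda>n. 1 / real (Suc n)"
  let ?Z = "\<lambda>n \<omega>. (X (s + ?h n) \<omega> - X s \<omega>) / ?h n"
  define v where "v n = (\<integral>u. ((frac_kernel \<alpha> \<gamma> (s + ?h n) u - frac_kernel \<alpha> \<gamma> s u) / ?h n)\<^sup>2 \<partial>lborel)" for n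
  have v_lim: "filterlim v at_top sequentially"
    using filterlim_increment_variance[OF assms] by (simp add: v_def[abs_def])
  have [measurable]: "X s \<in> borel_measurable M" "X (s + ?h n) \<in> borel_measurable M" for n
    using s by (auto intro!: process_measurable)
  have Z: "(\<integral>\<^sup>+\<omega>. ennreal ((?Z n \<omega>)\<^sup>2) \<partial>M) = ennreal (?c\<^sup>2 * v n)" for n
  proof -
    have W: "has_wiener_integral M B (\<lambda>u. (frac_kernel \<alpha> \<gamma> (s + ?h n) u - frac_kernel \<alpha> \<gamma> s u) / ?h n)
        (\<lambda>\<omega>. (X (s + ?h n) \<omega> - X s \<omega>) / (?c * ?h n))"
      using s by (intro has_wiener_integral_increment) auto
    have "?Z n \<omega> = ?c * ((X (s + ?h n) \<omega> - X s \<omega>) / (?c * ?h n))" for \<omega>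
      using gfbm_const_pos by simp
    then have "(\<integral>\<^sup>+\<omega>. ennreal ((?Z n \<omega>)\<^sup>2) \<partial>M) =
        (\<integral>\<^sup>+\<omega>. ennreal (?c\<^sup>2) * ennreal (((X (s + ?h n) \<omega> - X s \<omega>) / (?c * ?h n))\<^sup>2) \<partial>M)"
      by (simp only: power_mult_distrib ennreal_mult zero_le_power2)
    also have "\<dots> = ennreal (?c\<^sup>2) * (\<integral>\<^sup>+\<omega>. ennreal (((X (s + ?h n) \<omega> - X s \<omega>) / (?c * ?h n))\<^sup>2) \<partial>M)"
      by (rule nn_integral_cmult) measurable
    also have "(\<integral>\<^sup>+\<omega>. ennreal (((X (s + ?h n) \<omega> - X s \<omega>) / (?c * ?h n))\<^sup>2) \<partial>M) = ennreal (v n)"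
      using has_wiener_integral_moment[OF W, of 1] by (simp add: v_def)
    finally show ?thesis by (simp add: ennreal_mult v_def)
  qed
  have "filterlim (\<lambda>n. s + ?h n) (at s within {0..}) sequentially"
    by (rule filterlim_add_inverse_Suc) (use s in auto)
  from filterlim_compose[OF lim this]
  have "(\<lambda>n. \<integral>\<^sup>+\<omega>. ennreal ((?Z n \<omega> - Y \<omega>)\<^sup>2) \<partial>M) \<longlonglongrightarrow> 0"
    by (simp only: add_diff_cancel_left')
  then have ev1: "eventually (\<lambda>n. (\<integral>\<^sup>+\<omega>. ennreal ((?Z n \<omega> - Y \<omega>)\<^sup>2) \<partial>M) < 1) sequentially"
    by (rule order_tendstoD) simp
  define y where "y = (\<integral>\<omega>. (Y \<omega>)\<^sup>2 \<partial>M)"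
  have y: "0 \<le> y" "(\<integral>\<^sup>+\<omega>. ennreal ((Y \<omega>)\<^sup>2) \<partial>M) = ennreal y"
    using Y by (auto simp: y_def nn_integral_eq_integral)
  have ev2: "eventually (\<lambda>n. (2 + 2 * y) / ?c\<^sup>2 < v n) sequentially"
    using v_lim by (auto simp: filterlim_at_top_dense)
  obtain n where n1: "(\<integral>\<^sup>+\<omega>. ennreal ((?Z n \<omega> - Y \<omega>)\<^sup>2) \<partial>M) < 1" and n2: "(2 + 2 * y) / ?c\<^sup>2 < v n"
    using eventually_happens[OF eventually_conj[OF ev1 ev2]] by auto
  have "ennreal (?c\<^sup>2 * v n) = (\<integral>\<^sup>+\<omega>. ennreal ((?Z n \<omega> - 0)\<^sup>2) \<partial>M)"
    by (simp only: Z diff_zero)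
  also have "\<dots> \<le> 2 * (\<integral>\<^sup>+\<omega>. ennreal ((?Z n \<omega> - Y \<omega>)\<^sup>2) \<partial>M) + 2 * (\<integral>\<^sup>+\<omega>. ennreal ((Y \<omega> - 0)\<^sup>2) \<partial>M)"
    by (rule nn_integral_power2_diff_le) measurable
  also have "\<dots> \<le> 2 * 1 + 2 * ennreal y"
    using n1 y by (intro add_mono mult_left_mono) auto
  also have "\<dots> = ennreal (2 + 2 * y)"
    using y(1) by (simp add: ennreal_mult)
  finally have "?c\<^sup>2 * v n \<le> 2 + 2 * y"
    using y(1) by (subst (asm) ennreal_le_iff) auto
  with n2 show False
    using gfbm_const_pos by (simp add: divide_less_eq mult.commute)
qed

text \<open>The single time 0 suffices: a one-sided derivative there would bound the quotients along
  1 / (n + 1).\<close>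

lemma AE_not_differentiable_on:
  assumes "\<alpha> \<le> 1 / 2" "0 < \<gamma>"
  shows "AE \<omega> in M. \<not> (\<lambda>t. X t \<omega>) differentiable_on {0..}"
  using AE_increment_unbounded[OF order_refl assms]
proof eventually_elim
  case (elim \<omega>)
  show ?case
  proof
    assume "(\<lambda>t. X t \<omega>) differentiable_on {0..}"
    then have "(\<lambda>t. X t \<omega>) differentiable (at 0 within {0..})"
      by (simp add: differentiable_on_def)
    then obtain D where "((\<lambda>t. X t \<omega>) has_real_derivative D) (at 0 within {0..})"
      by (auto simp: real_differentiable_def)
    from DERIV_quotient_bounded[OF this] elim show False
      by (fastforce simp: not_le[symmetric])
  qed
qed

section \<open>Continuously differentiable paths for \<alpha> > 1/2\<close>

lemma second_difference_variance:
  assumes \<alpha>: "1 / 2 < \<alpha>" and a: "0 < a"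
  shows "\<exists>C\<ge>0. \<forall>t\<ge>a. \<forall>h. 0 < h \<and> 2 * h \<le> 1 \<longrightarrow>
    (\<exists>v. 0 \<le> v \<and> v \<le> C * h\<^sup>2 * h powr (2 * \<alpha> - 1) \<and>
      (\<forall>k. (\<integral>\<^sup>+\<omega>. ennreal (((X (t + 2 * h) \<omega> - 2 * X (t + h) \<omega> + X t \<omega>) / gfbm_const \<alpha> \<gamma>) ^ (2 * k)) \<partial>M) =
        ennreal (fact (2 * k) / (2 ^ k * fact k) * v ^ k)))"
proof -
  have \<alpha>1: "\<alpha> < 1" using alpha_range gamma_range by simp
  let ?c = "gfbm_const \<alpha> \<gamma>" and ?\<kappa> = "frac_kernel \<alpha> \<gamma>" and ?g = "\<lambda>t u. \<alpha> * frac_kernel (\<alpha> - 1) \<gamma> t u"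
  obtain C where C: "0 \<le> C" and bound: "\<And>t h. a \<le> t \<Longrightarrow> 0 < h \<Longrightarrow> h \<le> 1 \<Longrightarrow>
      (\<integral>\<^sup>+u. ennreal (((?\<kappa> (t + h) u - ?\<kappa> t u) / h - ?g t u)\<^sup>2) \<partial>lborel) \<le> ennreal (C * h powr (2 * \<alpha> - 1))"
    using frac_kernel_remainder_bound[OF \<alpha> \<alpha>1 gamma_range a] by blast
  have "\<exists>v. 0 \<le> v \<and> v \<le> 24 * C * h\<^sup>2 * h powr (2 * \<alpha> - 1) \<and>
      (\<forall>k. (\<integral>\<^sup>+\<omega>. ennreal (((X (t + 2 * h) \<omega> - 2 * X (t + h) \<omega> + X t \<omega>) / ?c) ^ (2 * k)) \<partial>M) =
        ennreal (fact (2 * k) / (2 ^ k * fact k) * v ^ k))"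
    if t: "a \<le> t" and h: "0 < h" "2 * h \<le> 1" for t h
  proof -
    define r where "r h u = (?\<kappa> (t + h) u - ?\<kappa> t u) / h - ?g t u" for h u
    have [measurable]: "r h \<in> borel_measurable borel" for h
      unfolding r_def[abs_def] by measurable
    \<comment> \<open>The second difference is 2h times the quotient with step 2h minus 2h times the
      quotient with step h. The derivative kernel cancels and only the two errors r remain, which is
      the source of the factor h^(2\<alpha> - 1) beyond h^2.\<close>
    define f where "f u = 2 * h * ((?\<kappa> (t + 2 * h) u - ?\<kappa> t u) / (2 * h)) + (- 2 * h) * ((?\<kappa> (t + h) u - ?\<kappa> t u) / h)" for u
    have W: "has_wiener_integral M B f
        (\<lambda>\<omega>. 2 * h * ((X (t + 2 * h) \<omega> - X t \<omega>) / (?c * (2 * h))) + (- 2 * h) * ((X (t + h) \<omega> - X t \<omega>) / (?c * h)))"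
      unfolding f_def using t h a
      by (intro has_wiener_integral_lincomb has_wiener_integral_increment) auto
    have Weq: "2 * h * ((X (t + 2 * h) \<omega> - X t \<omega>) / (?c * (2 * h))) + (- 2 * h) * ((X (t + h) \<omega> - X t \<omega>) / (?c * h)) =
        (X (t + 2 * h) \<omega> - 2 * X (t + h) \<omega> + X t \<omega>) / ?c" for \<omega>
      using h gfbm_const_pos by (simp add: field_simps)
    define v where "v = (\<integral>u. (f u)\<^sup>2 \<partial>lborel)"
    have v: "0 \<le> v" by (simp add: v_def)
    have f: "f u = 2 * h * (r (2 * h) u - r h u)" for u
      using h by (simp add: f_def r_def field_simps)
    have "ennreal v = (\<integral>\<^sup>+u. ennreal ((f u)\<^sup>2) \<partial>lborel)"
      unfolding v_def using has_wiener_integral_char(1)[OF W] by (intro nn_integral_eq_integral[symmetric]) auto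
    also have "\<dots> = (\<integral>\<^sup>+u. ennreal (4 * h\<^sup>2) * ennreal ((r (2 * h) u - r h u)\<^sup>2) \<partial>lborel)"
      by (simp add: f power_mult_distrib flip: ennreal_mult)
    also have "\<dots> = ennreal (4 * h\<^sup>2) * (\<integral>\<^sup>+u. ennreal ((r (2 * h) u - r h u)\<^sup>2) \<partial>lborel)"
      by (rule nn_integral_cmult) measurable
    also have "\<dots> \<le> ennreal (4 * h\<^sup>2) *
        (2 * (\<integral>\<^sup>+u. ennreal ((r (2 * h) u - 0)\<^sup>2) \<partial>lborel) + 2 * (\<integral>\<^sup>+u. ennreal ((0 - r h u)\<^sup>2) \<partial>lborel))"
      by (intro mult_left_mono nn_integral_power2_diff_le) auto
    also have "\<dots> \<le> ennreal (4 * h\<^sup>2) *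
        (2 * ennreal (C * (2 * h) powr (2 * \<alpha> - 1)) + 2 * ennreal (C * h powr (2 * \<alpha> - 1)))"
      using bound[OF t, of "2 * h", folded r_def] bound[OF t, of h, folded r_def] h
      by (intro mult_left_mono add_mono) auto
    also have "\<dots> = ennreal (4 * h\<^sup>2 * (2 * (C * (2 * h) powr (2 * \<alpha> - 1)) + 2 * (C * h powr (2 * \<alpha> - 1))))"
      using C by (simp add: ennreal_mult)
    finally have "v \<le> 4 * h\<^sup>2 * (2 * (C * (2 * h) powr (2 * \<alpha> - 1)) + 2 * (C * h powr (2 * \<alpha> - 1)))"
      using C by (subst (asm) ennreal_le_iff) auto
    \<comment> \<open>Since 2\<alpha> - 1 < 1, doubling h at most doubles the power, and the
      constant becomes 4 * (2 * 2 + 2) = 24.\<close>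
    also have "\<dots> \<le> 4 * h\<^sup>2 * (2 * (C * (2 * h powr (2 * \<alpha> - 1))) + 2 * (C * h powr (2 * \<alpha> - 1)))"
    proof -
      have "2 powr (2 * \<alpha> - 1) \<le> (2 :: real) powr 1"
        using \<alpha>1 by (intro powr_mono) auto
      then have "(2 * h) powr (2 * \<alpha> - 1) \<le> 2 * h powr (2 * \<alpha> - 1)"
        using h by (simp add: powr_mult mult_right_mono)
      then show ?thesis
        using C by (intro mult_left_mono add_mono) auto
    qed
    also have "\<dots> = 24 * C * h\<^sup>2 * h powr (2 * \<alpha> - 1)" by (simp add: algebra_simps)
    finally have "v \<le> 24 * C * h\<^sup>2 * h powr (2 * \<alpha> - 1)" .
    with v show ?thesis
      using has_wiener_integral_moment[OF W] unfolding Weq v_def by blast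
  qed
  then show ?thesis
    using C by (intro exI[of _ "24 * C"]) auto
qed

text \<open>The second differences of level n are measured against q^n / 2^n, which uses only half
  of the available decay: the rest, in a high moment, beats the number of cells, while q^n makes the
  slope changes summable.\<close>

lemma AE_C1_on:
  assumes \<alpha>: "1 / 2 < \<alpha>" and a: "0 < a"
  shows "AE \<omega> in M. \<exists>f'. (\<forall>t\<in>{a<..<b}. ((\<lambda>r. X r \<omega>) has_real_derivative f' t) (at t)) \<and> continuous_on {a<..<b} f'"
proof -
  let ?c = "gfbm_const \<alpha> \<gamma>"
  obtain C where C: "0 \<le> C" and var: "\<And>t h. a \<le> t \<Longrightarrow> 0 < h \<Longrightarrow> 2 * h \<le> 1 \<Longrightarrow>
    \<exists>v. 0 \<le> v \<and> v \<le> C * h\<^sup>2 * h powr (2 * \<alpha> - 1) \<and>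
      (\<forall>k. (\<integral>\<^sup>+\<omega>. ennreal (((X (t + 2 * h) \<omega> - 2 * X (t + h) \<omega> + X t \<omega>) / ?c) ^ (2 * k)) \<partial>M) =
        ennreal (fact (2 * k) / (2 ^ k * fact k) * v ^ k))"
    using second_difference_variance[OF assms] by blast
  \<comment> \<open>For h = 2^(-n) the gain h^(2\<alpha> - 1) in the variance is q^(4n). Normalising
    Z by q^n spends q^(2n) of it, so the variance of Z is still of order q^(2n).\<close>
  define q :: real where "q = 2 powr (- ((2 * \<alpha> - 1) / 4))"
  have q: "0 < q" "q < 1" using \<alpha> by (auto simp: q_def powr_less_one)
  have q4: "(1 / 2 ^ n) powr (2 * \<alpha> - 1) = (q ^ n) ^ 4" for n :: nat
  proof -
    have "(1 / 2 ^ n) powr (2 * \<alpha> - 1) = 2 powr (- (real n * (2 * \<alpha> - 1)))"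
      by (simp add: powr_divide powr_minus_divide powr_powr flip: powr_realpow)
    also have "\<dots> = (q ^ n) ^ 4"
      using q(1) by (simp add: q_def powr_powr flip: powr_realpow) (simp add: algebra_simps)
    finally show ?thesis .
  qed
  \<comment> \<open>The order 2k is chosen so that the moments decay faster than (1/4)^n; with at
    most m 2^n cells per level this leaves a geometric series of ratio 1/2.\<close>
  obtain k where k: "(q\<^sup>2) ^ k < 1 / 4"
    using real_arch_pow_inv[of "1 / 4" "q\<^sup>2"] q by (auto simp: power_less_one_iff)
  then have k0: "k \<noteq> 0" by (cases k) auto
  define A where "A = fact (2 * k) / (2 ^ k * fact k) * C ^ k"
  have A: "0 \<le> A" using C by (simp add: A_def)
  define Z where "Z n i \<omega> = 2 ^ n / q ^ n * ((X (real (i + 2) / 2 ^ n) \<omega> - 2 * X (real (i + 1) / 2 ^ n) \<omega> + X (real i / 2 ^ n) \<omega>) / ?c)"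
    for n i :: nat and \<omega>
  have [measurable]: "X (real i / 2 ^ n) \<in> borel_measurable M" for i n :: nat
    by (rule process_measurable) simp
  have [measurable]: "Z n i \<in> borel_measurable M" for n i
    unfolding Z_def[abs_def] by measurable
  have moment: "(\<integral>\<^sup>+\<omega>. ennreal ((Z n i \<omega>) ^ (2 * k)) \<partial>M) \<le> ennreal (A * (1 / 4) ^ n)"
    if n: "1 \<le> n" and i: "a < real i / 2 ^ n" for n i
  proof -
    let ?h = "1 / 2 ^ n :: real"
    have "(2::real) ^ 1 \<le> 2 ^ n" using n by (intro power_increasing) auto
    then have h: "0 < ?h" "2 * ?h \<le> 1" by auto
    have pts: "real (i + 2) / 2 ^ n = real i / 2 ^ n + 2 * ?h" "real (i + 1) / 2 ^ n = real i / 2 ^ n + ?h"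
      by (simp_all add: add_divide_distrib)
    obtain v where v: "0 \<le> v" "v \<le> C * ?h\<^sup>2 * ?h powr (2 * \<alpha> - 1)"
      and mom: "\<And>k. (\<integral>\<^sup>+\<omega>. ennreal (((X (real (i + 2) / 2 ^ n) \<omega> - 2 * X (real (i + 1) / 2 ^ n) \<omega> + X (real i / 2 ^ n) \<omega>) / ?c) ^ (2 * k)) \<partial>M) =
        ennreal (fact (2 * k) / (2 ^ k * fact k) * v ^ k)"
      using var[OF less_imp_le[OF i] h] unfolding pts by blast
    have "(\<integral>\<^sup>+\<omega>. ennreal ((Z n i \<omega>) ^ (2 * k)) \<partial>M) = (\<integral>\<^sup>+\<omega>. ennreal ((2 ^ n / q ^ n) ^ (2 * k)) *
        ennreal (((X (real (i + 2) / 2 ^ n) \<omega> - 2 * X (real (i + 1) / 2 ^ n) \<omega> + X (real i / 2 ^ n) \<omega>) / ?c) ^ (2 * k)) \<partial>M)"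
      unfolding Z_def power_mult_distrib by (simp only: ennreal_mult zero_le_even_power even_mult_iff even_numeral simp_thms)
    also have "\<dots> = ennreal ((2 ^ n / q ^ n) ^ (2 * k)) * ennreal (fact (2 * k) / (2 ^ k * fact k) * v ^ k)"
      unfolding mom[symmetric]
      by (rule nn_integral_cmult) measurable
    also have "\<dots> = ennreal (fact (2 * k) / (2 ^ k * fact k) * ((2 ^ n / q ^ n)\<^sup>2 * v) ^ k)"
    proof -
      have "(2 ^ n / q ^ n) ^ (2 * k) = ((2 ^ n / q ^ n)\<^sup>2) ^ k" by (simp only: power_mult)
      then show ?thesis
        using v by (simp only: ennreal_mult[symmetric] power_mult_distrib mult_ac zero_le_power zero_le_power2 mult_nonneg_nonneg)
          (simp add: ennreal_mult[symmetric] mult_ac)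
    qed
    also have "\<dots> \<le> ennreal (fact (2 * k) / (2 ^ k * fact k) * (C * (q ^ n)\<^sup>2) ^ k)"
    proof (intro ennreal_leI mult_left_mono power_mono)
      have "(2 ^ n / q ^ n)\<^sup>2 * v \<le> (2 ^ n / q ^ n)\<^sup>2 * (C * ?h\<^sup>2 * (q ^ n) ^ 4)"
        using v(2) unfolding q4 by (intro mult_left_mono) auto
      also have "\<dots> = C * (q ^ n)\<^sup>2"
        using q by (simp add: power_divide field_simps flip: power_add power_mult)
      finally show "(2 ^ n / q ^ n)\<^sup>2 * v \<le> C * (q ^ n)\<^sup>2" .
    qed (use v q in auto)
    also have "\<dots> = ennreal (A * ((q\<^sup>2) ^ k) ^ n)"
      by (simp add: A_def power_mult_distrib power_mult[symmetric] mult_ac)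
    also have "\<dots> \<le> ennreal (A * (1 / 4) ^ n)"
      using k A q by (intro ennreal_leI mult_left_mono power_mono) auto
    finally show ?thesis .
  qed
  obtain m :: nat where m: "b \<le> real m" using real_arch_simple by blast
  \<comment> \<open>The condition n \<ge> 1 ensures 2h \<le> 1 for h = 2^(-n), as the variance bound
    requires; since m \<ge> b, all cells relevant to the interval are counted from level 1
    on.\<close>
  define J where "J n = {i. i < m * 2 ^ n \<and> 1 \<le> n \<and> a < real i / 2 ^ n}" for n
  have J: "finite (J n)" "card (J n) \<le> m * 2 ^ n" for n
  proof -
    have sub: "J n \<subseteq> {..<m * 2 ^ n}" by (auto simp: J_def)
    then show "finite (J n)" by (rule finite_subset) simp
    show "card (J n) \<le> m * 2 ^ n" using card_mono[OF _ sub] by simp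
  qed
  define G where "G \<omega> = (\<Sum>n. \<Sum>i\<in>J n. ennreal ((Z n i \<omega>) ^ (2 * k)))" for \<omega>
  have [measurable]: "G \<in> borel_measurable M" unfolding G_def[abs_def] by measurable
  have "(\<integral>\<^sup>+\<omega>. G \<omega> \<partial>M) = (\<Sum>n. \<integral>\<^sup>+\<omega>. (\<Sum>i\<in>J n. ennreal ((Z n i \<omega>) ^ (2 * k))) \<partial>M)"
    unfolding G_def by (rule nn_integral_suminf) measurable
  also have "\<dots> = (\<Sum>n. \<Sum>i\<in>J n. \<integral>\<^sup>+\<omega>. ennreal ((Z n i \<omega>) ^ (2 * k)) \<partial>M)"
    by (intro suminf_cong nn_integral_sum) measurable
  also have "\<dots> \<le> (\<Sum>n. ennreal (A * real m * (1 / 2) ^ n))"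
  proof (intro suminf_le allI)
    fix n
    have "(\<Sum>i\<in>J n. \<integral>\<^sup>+\<omega>. ennreal ((Z n i \<omega>) ^ (2 * k)) \<partial>M) \<le> (\<Sum>i\<in>J n. ennreal (A * (1 / 4) ^ n))"
      by (intro sum_mono moment) (auto simp: J_def)
    also have "\<dots> = ennreal (real (card (J n)) * (A * (1 / 4) ^ n))"
      using A by (simp add: ennreal_mult ennreal_of_nat_eq_real_of_nat)
    also have "\<dots> \<le> ennreal (real (m * 2 ^ n) * (A * (1 / 4) ^ n))"
      using A J(2)[of n] by (intro ennreal_leI mult_right_mono) (auto simp only: of_nat_le_iff mult_nonneg_nonneg zero_le_power zero_le_divide_1_iff zero_le_numeral)
    also have "real (m * 2 ^ n) * (A * (1 / 4) ^ n) = A * real m * (1 / 2) ^ n"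
    proof -
      have "(2::real) ^ n * (1 / 4) ^ n = (1 / 2) ^ n" by (simp flip: power_mult_distrib)
      then show ?thesis by simp
    qed
    finally show "(\<Sum>i\<in>J n. \<integral>\<^sup>+\<omega>. ennreal ((Z n i \<omega>) ^ (2 * k)) \<partial>M) \<le> ennreal (A * real m * (1 / 2) ^ n)" .
  qed auto
  also have "\<dots> = ennreal (\<Sum>n. A * real m * (1 / 2) ^ n)"
    using A by (intro suminf_ennreal2 summable_mult summable_geometric) auto
  finally have "(\<integral>\<^sup>+\<omega>. G \<omega> \<partial>M) \<noteq> \<infinity>"
    by (auto simp: top_unique)
  then have "AE \<omega> in M. G \<omega> \<noteq> \<infinity>"
    by (intro nn_integral_PInf_AE) auto
  then show ?thesis
    using continuous_paths
  proof eventually_elim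
    case (elim \<omega>)
    \<comment> \<open>Finiteness of G bounds every single Z^(2k). This dominates |Z| only when |Z|
      \<ge> 1, hence the maximum with 1.\<close>
    define K where "K = max 1 (enn2real (G \<omega>))"
    have Z_le: "\<bar>Z n i \<omega>\<bar> \<le> K" if "i \<in> J n" for n i
    proof -
      have "ennreal ((Z n i \<omega>) ^ (2 * k)) \<le> (\<Sum>i\<in>J n. ennreal ((Z n i \<omega>) ^ (2 * k)))"
        using that J(1) by (intro member_le_sum) auto
      also have "\<dots> \<le> G \<omega>"
        unfolding G_def using sum_le_suminf[of "\<lambda>n. \<Sum>i\<in>J n. ennreal ((Z n i \<omega>) ^ (2 * k))" "{n}"] by simp
      also have "\<dots> = ennreal (enn2real (G \<omega>))"
        using elim(1) by (simp add: less_top)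
      finally have "(Z n i \<omega>) ^ (2 * k) \<le> enn2real (G \<omega>)"
        by (subst (asm) ennreal_le_iff) auto
      moreover have "\<bar>Z n i \<omega>\<bar> \<le> (Z n i \<omega>) ^ (2 * k)" if "1 \<le> \<bar>Z n i \<omega>\<bar>"
      proof -
        have "\<bar>Z n i \<omega>\<bar> ^ 1 \<le> \<bar>Z n i \<omega>\<bar> ^ (2 * k)"
          using that k0 by (intro power_increasing) auto
        then show ?thesis by (simp add: power_even_abs)
      qed
      ultimately show ?thesis unfolding K_def by linarith
    qed
    show ?case
    proof (rule C1_if_dyadic_second_differences)
      show "continuous_on {a<..<b} (\<lambda>r. X r \<omega>)"
        using elim(2) a by (auto intro: continuous_on_subset)
      show "0 \<le> a" using a by simp
      show "summable (\<lambda>n. ?c * K * q ^ n)"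
        using q by (intro summable_mult summable_geometric) auto
      show "0 \<le> ?c * K * q ^ n" for n
        using gfbm_const_pos q by (simp add: K_def)
      fix n i :: nat
      assume n: "1 \<le> n" and i: "a < real i / 2 ^ n" "real (i + 2) / 2 ^ n < b"
      have "real i < real m * 2 ^ n"
      proof -
        have "real (i + 2) / 2 ^ n < real m" using i m by linarith
        then have "real (i + 2) < real m * 2 ^ n" by (simp add: divide_less_eq)
        then show ?thesis by simp
      qed
      then have "i < m * 2 ^ n"
        by (metis of_nat_less_iff of_nat_mult of_nat_numeral of_nat_power)
      then have "\<bar>Z n i \<omega>\<bar> \<le> K"
        using n i by (intro Z_le) (simp add: J_def)
      then show "2 ^ n * \<bar>X (real (i + 2) / 2 ^ n) \<omega> - 2 * X (real (i + 1) / 2 ^ n) \<omega> + X (real i / 2 ^ n) \<omega>\<bar> \<le> ?c * K * q ^ n"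
        using gfbm_const_pos q by (simp add: Z_def abs_mult divide_le_eq mult_ac del: of_nat_add)
    qed
  qed
qed

text \<open>The intervals (1 / (n + 1), n + 1) exhaust the open half-line at the price of countably
  many null sets. Derivatives are unique, so the local ones all agree with \<open>deriv\<close> and
  fit together.\<close>

lemma AE_C1:
  assumes \<alpha>: "1 / 2 < \<alpha>"
  shows "AE \<omega> in M. (\<forall>t>0. ((\<lambda>r. X r \<omega>) has_real_derivative deriv (\<lambda>r. X r \<omega>) t) (at t)) \<and>
    continuous_on {0<..} (deriv (\<lambda>r. X r \<omega>))"
proof -
  have "AE \<omega> in M. \<forall>n. \<exists>f'. (\<forall>t\<in>{1 / real (Suc n)<..<real (Suc n)}. ((\<lambda>r. X r \<omega>) has_real_derivative f' t) (at t)) \<and>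
      continuous_on {1 / real (Suc n)<..<real (Suc n)} f'"
    unfolding AE_all_countable by (intro allI AE_C1_on[OF \<alpha>]) simp
  then show ?thesis
  proof eventually_elim
    case (elim \<omega>)
    have loc: "((\<lambda>r. X r \<omega>) has_real_derivative deriv (\<lambda>r. X r \<omega>) t) (at t) \<and> isCont (deriv (\<lambda>r. X r \<omega>)) t"
      if "0 < t" for t
    proof -
      obtain n1 where n1: "1 / real (Suc n1) < t"
        using reals_Archimedean[OF \<open>0 < t\<close>] by (auto simp: inverse_eq_divide)
      obtain n2 :: nat where n2: "t < real n2" using reals_Archimedean2 by blast
      define n where "n = max n1 n2"
      define I where "I = {1 / real (Suc n)<..<real (Suc n)}"
      have "1 / real (Suc n) \<le> 1 / real (Suc n1)" by (intro divide_left_mono) (auto simp: n_def)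
      then have t: "t \<in> I" using n1 n2 by (auto simp: n_def I_def)
      obtain f' where f': "\<And>t. t \<in> I \<Longrightarrow> ((\<lambda>r. X r \<omega>) has_real_derivative f' t) (at t)"
        and cont: "continuous_on I f'"
        using elim unfolding I_def by blast
      have eq: "deriv (\<lambda>r. X r \<omega>) t = f' t" if "t \<in> I" for t
        using f'[OF that] by (rule DERIV_imp_deriv)
      have "continuous_on I (deriv (\<lambda>r. X r \<omega>))"
        using cont by (simp add: eq cong: continuous_on_cong)
      moreover have "open I" by (simp add: I_def)
      ultimately show ?thesis
        using f'[OF t] eq[OF t] t by (simp add: continuous_on_eq_continuous_at)
    qed
    then show ?case by (auto intro: continuous_at_imp_continuous_on)
  qed
qed

text \<open>A limit along a fixed sequence of random variables is measurable in \<omega>, and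
  \<open>lim\<close> gives it some value on the exceptional paths too. Division by the constant
  makes it the Wiener integral itself, so the derivative of X is the constant times it.\<close>

definition path_derivative :: "real \<Rightarrow> 'a \<Rightarrow> real" where
  "path_derivative t \<omega> = lim (\<lambda>n. (X (t + 1 / real (Suc n)) \<omega> - X t \<omega>) / (gfbm_const \<alpha> \<gamma> * (1 / real (Suc n))))"

lemma path_derivative_tendsto:
  assumes "((\<lambda>r. X r \<omega>) has_real_derivative D) (at t)"
  shows "(\<lambda>n. (X (t + 1 / real (Suc n)) \<omega> - X t \<omega>) / (gfbm_const \<alpha> \<gamma> * (1 / real (Suc n)))) \<longlonglongrightarrow> D / gfbm_const \<alpha> \<gamma>"
    and "gfbm_const \<alpha> \<gamma> * path_derivative t \<omega> = D"
proof -
  let ?c = "gfbm_const \<alpha> \<gamma>"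
  have "(\<lambda>n. (X (t + 1 / real (Suc n)) \<omega> - X t \<omega>) / (t + 1 / real (Suc n) - t)) \<longlonglongrightarrow> D"
    using assms[unfolded has_field_derivative_iff] filterlim_add_inverse_Suc[of t UNIV]
    by (rule filterlim_compose) simp
  then have "(\<lambda>n. (X (t + 1 / real (Suc n)) \<omega> - X t \<omega>) / (1 / real (Suc n)) / ?c) \<longlonglongrightarrow> D / ?c"
    unfolding add_diff_cancel_left' using gfbm_const_pos by (intro tendsto_divide tendsto_const) auto
  then show lim: "(\<lambda>n. (X (t + 1 / real (Suc n)) \<omega> - X t \<omega>) / (?c * (1 / real (Suc n)))) \<longlonglongrightarrow> D / ?c"
    by (simp only: divide_divide_eq_left mult.commute)
  then show "?c * path_derivative t \<omega> = D"
    unfolding path_derivative_def limI[OF lim] using gfbm_const_pos by simp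
qed

lemma path_derivative_measurable:
  assumes "0 < t" shows "path_derivative t \<in> borel_measurable M"
proof -
  have [measurable]: "X t \<in> borel_measurable M" "X (t + 1 / real (Suc n)) \<in> borel_measurable M" for n
    using assms by (auto intro!: process_measurable)
  show ?thesis unfolding path_derivative_def[abs_def] by measurable
qed

text \<open>Square integrability of the derivative kernel, singular at u = t, is not computed
  separately: it comes with the L2 convergence of the quotients.\<close>

lemma has_wiener_integral_path_derivative:
  assumes \<alpha>: "1 / 2 < \<alpha>" and t: "0 < t"
  shows "has_wiener_integral M B (\<lambda>u. \<alpha> * frac_kernel (\<alpha> - 1) \<gamma> t u) (path_derivative t)"
proof -
  have \<alpha>1: "\<alpha> < 1" using alpha_range gamma_range by simp
  let ?\<kappa> = "frac_kernel \<alpha> \<gamma>" and ?h = "\<lambda>n. 1 / real (Suc n)"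
  obtain C where bound: "\<And>h. 0 < h \<Longrightarrow> h \<le> 1 \<Longrightarrow>
      (\<integral>\<^sup>+u. ennreal (((?\<kappa> (t + h) u - ?\<kappa> t u) / h - \<alpha> * frac_kernel (\<alpha> - 1) \<gamma> t u)\<^sup>2) \<partial>lborel)
        \<le> ennreal (C * h powr (2 * \<alpha> - 1))"
    using frac_kernel_remainder_bound[OF \<alpha> \<alpha>1 gamma_range t] by blast
  show ?thesis
  proof (rule has_wiener_integral_limit)
    show "has_wiener_integral M B (\<lambda>u. (?\<kappa> (t + ?h n) u - ?\<kappa> t u) / ?h n)
        (\<lambda>\<omega>. (X (t + ?h n) \<omega> - X t \<omega>) / (gfbm_const \<alpha> \<gamma> * ?h n))" for n
      using t by (intro has_wiener_integral_increment) auto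
    show "path_derivative t \<in> borel_measurable M"
      by (rule path_derivative_measurable[OF t])
    have "(\<lambda>n. ?h n powr (2 * \<alpha> - 1)) \<longlonglongrightarrow> 0"
      using tendsto_powr2[OF LIMSEQ_Suc[OF lim_1_over_n] tendsto_const, of "2 * \<alpha> - 1"] \<alpha> by auto
    then have "(\<lambda>n. ennreal (C * ?h n powr (2 * \<alpha> - 1))) \<longlonglongrightarrow> ennreal (C * 0)"
      by (intro tendsto_ennrealI tendsto_mult tendsto_const)
    then have lim: "(\<lambda>n. ennreal (C * ?h n powr (2 * \<alpha> - 1))) \<longlonglongrightarrow> 0" by simp
    have le: "(\<integral>\<^sup>+u. ennreal (((?\<kappa> (t + ?h n) u - ?\<kappa> t u) / ?h n - \<alpha> * frac_kernel (\<alpha> - 1) \<gamma> t u)\<^sup>2) \<partial>lborel)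
        \<le> ennreal (C * ?h n powr (2 * \<alpha> - 1))" for n
      by (rule bound) auto
    show "(\<lambda>n. \<integral>\<^sup>+u. ennreal (((?\<kappa> (t + ?h n) u - ?\<kappa> t u) / ?h n - \<alpha> * frac_kernel (\<alpha> - 1) \<gamma> t u)\<^sup>2) \<partial>lborel) \<longlonglongrightarrow> 0"
      by (rule tendsto_sandwich[OF _ _ tendsto_const lim]) (intro always_eventually allI le zero_le)+
    show "AE \<omega> in M. (\<lambda>n. (X (t + ?h n) \<omega> - X t \<omega>) / (gfbm_const \<alpha> \<gamma> * ?h n)) \<longlonglongrightarrow> path_derivative t \<omega>"
      using AE_C1[OF \<alpha>]
    proof eventually_elim
      case (elim \<omega>)
      then have D: "((\<lambda>r. X r \<omega>) has_real_derivative deriv (\<lambda>r. X r \<omega>) t) (at t)" using t by blast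
      have "deriv (\<lambda>r. X r \<omega>) t / gfbm_const \<alpha> \<gamma> = path_derivative t \<omega>"
        using path_derivative_tendsto(2)[OF D] gfbm_const_pos by (simp add: field_simps)
      then show ?case using path_derivative_tendsto(1)[OF D] by simp
    qed
  qed measurable
qed

text \<open>Up to the factor \<alpha>, increments of the derivative have the kernel with exponent
  \<alpha> - 1 < 1/2, so the variances of their quotients grow at least like h^(2\<alpha> - 3), and
  the argument for unbounded quotients applies again.\<close>

lemma AE_path_derivative_not_differentiable:
  assumes \<alpha>: "1 / 2 < \<alpha>" and t: "0 < t"
  shows "AE \<omega> in M. \<not> (\<lambda>r. gfbm_const \<alpha> \<gamma> * path_derivative r \<omega>) differentiable (at t)"
proof -
  let ?c = "gfbm_const \<alpha> \<gamma>" and ?h = "\<lambda>n. 1 / real (Suc n)" and ?g = "frac_kernel (\<alpha> - 1) \<gamma>"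
  have W: "has_wiener_integral M B (\<lambda>u. (?g (t + ?h n) u - ?g t u) / ?h n)
      (\<lambda>\<omega>. (path_derivative (t + ?h n) \<omega> - path_derivative t \<omega>) / (\<alpha> * ?h n))" for n
  proof -
    have "has_wiener_integral M B (\<lambda>u. 1 / (\<alpha> * ?h n) * (\<alpha> * ?g (t + ?h n) u) + (- 1 / (\<alpha> * ?h n)) * (\<alpha> * ?g t u))
       (\<lambda>\<omega>. 1 / (\<alpha> * ?h n) * path_derivative (t + ?h n) \<omega> + (- 1 / (\<alpha> * ?h n)) * path_derivative t \<omega>)"
      using t by (intro has_wiener_integral_lincomb has_wiener_integral_path_derivative \<alpha>) (auto simp: add_pos_pos)
    moreover have "1 / (\<alpha> * d) * (\<alpha> * x) + (- 1 / (\<alpha> * d)) * (\<alpha> * y) = (x - y) / d"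
      "1 / (\<alpha> * d) * x + (- 1 / (\<alpha> * d)) * y = (x - y) / (\<alpha> * d)" for d x y
      using \<alpha> by (simp_all add: diff_divide_distrib)
    ultimately show ?thesis by (simp only:)
  qed
  have "filterlim (\<lambda>n. \<integral>u. ((?g (t + ?h n) u - ?g t u) / ?h n)\<^sup>2 \<partial>lborel) at_top sequentially"
    using alpha_range gamma_range t
    by (intro filterlim_frac_kernel_quotient has_wiener_integral_char(1)[OF W]) auto
  from has_wiener_integral_unbounded[OF W this] show ?thesis
  proof eventually_elim
    case (elim \<omega>)
    show ?case
    proof
      assume "(\<lambda>r. ?c * path_derivative r \<omega>) differentiable (at t)"
      then obtain D where "((\<lambda>r. ?c * path_derivative r \<omega>) has_real_derivative D) (at t)"
        by (auto simp: real_differentiable_def)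
      from DERIV_quotient_bounded[OF this] obtain K where
        K: "\<And>n. \<bar>(?c * path_derivative (t + ?h n) \<omega> - ?c * path_derivative t \<omega>) / ?h n\<bar> \<le> K" by auto
      have pos: "0 < ?c * \<alpha>" using gfbm_const_pos \<alpha> by simp
      obtain n where n: "K / (?c * \<alpha>) < \<bar>(path_derivative (t + ?h n) \<omega> - path_derivative t \<omega>) / (\<alpha> * ?h n)\<bar>"
        using elim by blast
      have "\<bar>(x - y) / (\<alpha> * d)\<bar> = \<bar>(?c * x - ?c * y) / d\<bar> / (?c * \<alpha>)" for x y d
        using gfbm_const_pos \<alpha> unfolding right_diff_distrib[symmetric] by (simp add: abs_mult)
      with n have "K < \<bar>(?c * path_derivative (t + ?h n) \<omega> - ?c * path_derivative t \<omega>) / ?h n\<bar>"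
        using pos by (simp only: divide_less_cancel)
      with K[of n] show False by simp
    qed
  qed
qed

end

theorem theorem4p1:
  fixes M :: "'a measure" and B :: "real set \<Rightarrow> 'a \<Rightarrow> real"
    and \<alpha> \<gamma> H :: real and X :: "real \<Rightarrow> 'a \<Rightarrow> real"
  assumes X: "gfbm M B \<alpha> \<gamma> X"
    and H: "H = \<alpha> - \<gamma> / 2 + 1 / 2"
  shows "(- 1 / 2 + \<gamma> / 2 < \<alpha> \<and> \<alpha> \<le> 1 / 2 \<and> 0 < \<gamma> \<and> \<gamma> < 1 \<longrightarrow>
            H \<in> {0<..<1} \<and>
            (\<forall>s\<ge>0. \<not> mean_square_differentiable_at M {0..} X s) \<and>
            (AE \<omega> in M. \<not> (\<lambda>t. X t \<omega>) differentiable_on {0..}) \<and>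
            (\<forall>s\<ge>0. AE \<omega> in M.
               Limsup (at s within {0..}) (\<lambda>t. ereal \<bar>(X t \<omega> - X s \<omega>) / (t - s)\<bar>) = \<infinity>)) \<and>
         (1 / 2 < \<alpha> \<and> \<alpha> < 1 / 2 + \<gamma> / 2 \<and> 0 < \<gamma> \<and> \<gamma> < 1 \<longrightarrow>
            H \<in> {1 / 2<..<1} \<and>
            (\<exists>I. (\<forall>t>0. has_wiener_integral M B
                    (\<lambda>s. indicator {..t} s * (\<alpha> * (t - s) powr (\<alpha> - 1) * \<bar>s\<bar> powr (- \<gamma> / 2)))
                    (I t)) \<and>
                 (AE \<omega> in M.
                    (\<forall>t>0. ((\<lambda>r. X r \<omega>) has_real_derivative gfbm_const \<alpha> \<gamma> * I t \<omega>) (at t)) \<and>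
                    continuous_on {0<..} (\<lambda>t. gfbm_const \<alpha> \<gamma> * I t \<omega>)) \<and>
                 (\<forall>t>0. AE \<omega> in M.
                    \<not> (\<lambda>r. gfbm_const \<alpha> \<gamma> * I r \<omega>) differentiable (at t))))"
proof -
  interpret gfbm M B \<alpha> \<gamma> X by (rule X)
  \<comment> \<open>On a continuously differentiable path the identification with the derivative
    holds at every t > 0 at once, so one null set serves all times and continuity carries
    over.\<close>
  have "AE \<omega> in M. (\<forall>t>0. ((\<lambda>r. X r \<omega>) has_real_derivative gfbm_const \<alpha> \<gamma> * path_derivative t \<omega>) (at t)) \<and>
      continuous_on {0<..} (\<lambda>t. gfbm_const \<alpha> \<gamma> * path_derivative t \<omega>)" if \<alpha>: "1 / 2 < \<alpha>"
    using AE_C1[OF \<alpha>]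
  proof eventually_elim
    case (elim \<omega>)
    then have eq: "gfbm_const \<alpha> \<gamma> * path_derivative t \<omega> = deriv (\<lambda>r. X r \<omega>) t" if "0 < t" for t
      using that by (intro path_derivative_tendsto(2)) auto
    have "continuous_on {0<..} (\<lambda>t. gfbm_const \<alpha> \<gamma> * path_derivative t \<omega>) \<longleftrightarrow>
        continuous_on {0<..} (deriv (\<lambda>r. X r \<omega>))"
      by (rule continuous_on_cong) (auto simp: eq)
    with elim eq show ?case by simp
  qed
  note C1 = this
  have part1: "H \<in> {0<..<1} \<and> (\<forall>s\<ge>0. \<not> mean_square_differentiable_at M {0..} X s) \<and>
      (AE \<omega> in M. \<not> (\<lambda>t. X t \<omega>) differentiable_on {0..}) \<and>
      (\<forall>s\<ge>0. AE \<omega> in M.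
         Limsup (at s within {0..}) (\<lambda>t. ereal \<bar>(X t \<omega> - X s \<omega>) / (t - s)\<bar>) = \<infinity>)"
    if "\<alpha> \<le> 1 / 2" "0 < \<gamma>"
    \<comment> \<open>The bounds 0 < H < 1 are the range of \<alpha> shifted by 1/2 -
      \<gamma>/2.\<close>
    using that H alpha_range gamma_range not_mean_square_differentiable[OF _ that]
      AE_not_differentiable_on[OF that] AE_Limsup_increment[OF _ that]
    by (intro conjI allI impI) auto
  have part2: "H \<in> {1 / 2<..<1} \<and>
      (\<exists>I. (\<forall>t>0. has_wiener_integral M B
              (\<lambda>s. indicator {..t} s * (\<alpha> * (t - s) powr (\<alpha> - 1) * \<bar>s\<bar> powr (- \<gamma> / 2))) (I t)) \<and>
           (AE \<omega> in M.
              (\<forall>t>0. ((\<lambda>r. X r \<omega>) has_real_derivative gfbm_const \<alpha> \<gamma> * I t \<omega>) (at t)) \<and>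
              continuous_on {0<..} (\<lambda>t. gfbm_const \<alpha> \<gamma> * I t \<omega>)) \<and>
           (\<forall>t>0. AE \<omega> in M. \<not> (\<lambda>r. gfbm_const \<alpha> \<gamma> * I r \<omega>) differentiable (at t)))"
    if \<alpha>: "1 / 2 < \<alpha>"
    unfolding indicator_kernel_eq_frac_kernel
    \<comment> \<open>Here \<alpha> > 1/2 and \<gamma> < 1 give H > 1 - \<gamma>/2 > 1/2.\<close>
    using \<alpha> H alpha_range gamma_range C1[OF \<alpha>] has_wiener_integral_path_derivative[OF \<alpha>]
      AE_path_derivative_not_differentiable[OF \<alpha>]
    by (intro conjI exI[of _ path_derivative] allI impI) auto
  show ?thesis using part1 part2 by blast
qed

end
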